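(* Let $P_{\lambda}:\mathbb{R}^n\to\mathbb{R}^m$, $\lambda\in\Lambda$, be orthogonal projections, where $\Lambda$ is a compact metric space, and suppose that $\lambda\mapsto P_{\lambda}x$ is continuous for every $x\in\mathbb{R}^n$. Let $\omega$ be a finite non-zero Borel measure on $\Lambda$. Let $s>m$. Suppose that there exists a positive number $C$ such that, whenever $\mu\in\mathcal{M}(B^n(0,1))$ satisfies $\mu(B(x,r))\leq r^s$ for all $x\in\mathbb{R}^n$, $r>0$, one has $P_{\lambda\sharp}\mu\ll\mathcal{L}^m$ for $\omega$ almost all $\lambda\in\Lambda$ and $$\iint D(P_{\lambda\sharp}\mu,u)^2\,d\mathcal{L}^m u\,d\omega\lambda < C .$$ If $A\subset\mathbb{R}^n$ is $\mathcal{H}^s$ measurable, $0<\mathcal{H}^s(A)<\infty$ and $\theta^s_{\ast}(A,x)>0$ for $\mathcal{H}^s$ almost all $x\in A$, then for $\mathcal{H}^s\times\omega$ almost all $(x,\lambda)\in A\times\Lambda$, $$\dim \big(P_{\lambda}^{-1}\{P_{\lambda}x\}\cap A\big) = s-m,$$ and for $\omega$ almost all $\lambda\in\Lambda$, $$\mathcal{L}^m\big(\{u\in\mathbb{R}^m: \dim (P_{\lambda}^{-1}\{u\}\cap A) = s-m\}\big) > 0.$$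
   Context: Throughout $n\geq 2$. $\mathcal{L}^m$ is Lebesgue measure on $\mathbb{R}^m$, $\mathcal{H}^s$ is $s$-dimensional Hausdorff measure, and $\dim$ is Hausdorff dimension. $B(x,r)=B^n(x,r)$ is the closed ball in $\mathbb{R}^n$ with centre $x$ and radius $r$. An orthogonal projection $P:\mathbb{R}^n\to\mathbb{R}^m$ is a linear map onto $\mathbb{R}^m$ that is isometric on the orthogonal complement of its kernel (i.e. $PP^{*}=\mathrm{Id}_{\mathbb{R}^m}$). For $A\subset\mathbb{R}^n$, $\mathcal{M}(A)$ is the set of non-zero finite Borel measures $\mu$ on $\mathbb{R}^n$ with compact support $\operatorname{spt}\mu\subset A$. The push-forward of $\mu$ under a map $f$ is $f_{\sharp}\mu(E)=\mu(f^{-1}(E))$, and $\ll$ denotes absolute continuity. For $\nu\in\mathcal{M}(\mathbb{R}^m)$ the derivative at $u\in\mathbb{R}^m$ is $$D(\nu,u)=\lim_{\delta\to 0}\alpha(m)^{-1}\delta^{-m}\nu(B(u,\delta)),\qquad \alpha(m)=\mathcal{L}^m(B^m(0,1)),$$ when the limit exists; it exists and is finite for $\mathcal{L}^m$ almost all $u$. The lower $s$-density of $A\subset\mathbb{R}^n$ at $x$ is $$\theta^s_{\ast}(A,x)=\liminf_{r\to 0}(2r)^{-s}\mathcal{H}^s(A\cap B(x,r)).$$ *)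

theory Defs
  imports "HOL-Analysis.Analysis"
begin

text \<open>
  Hausdorff measure. The convention is \<open>0 ^ 0 = 1\<close> for nonempty sets, so that the
  \<open>0\<close>-dimensional measure counts points; note that \<open>0 powr 0 = 0\<close>.
  The diameter is only meaningful for bounded sets, hence the boundedness requirement on covers.
\<close>

definition diam_pow :: "real \<Rightarrow> 'a::metric_space set \<Rightarrow> ennreal" where
  "diam_pow s E = (if E = {} then 0 else if s = 0 then 1 else ennreal (diameter E powr s))"

definition hausdorff_content :: "real \<Rightarrow> real \<Rightarrow> 'a::metric_space set \<Rightarrow> ennreal" where
  "hausdorff_content \<delta> s A =
     (INF E\<in>{E::nat \<Rightarrow> 'a set. A \<subseteq> (\<Union>i. E i) \<and> (\<forall>i. bounded (E i) \<and> diameter (E i) \<le> \<delta>)}.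
        \<Sum>i. diam_pow s (E i))"

definition hausdorff_outer :: "real \<Rightarrow> 'a::metric_space set \<Rightarrow> ennreal" where
  "hausdorff_outer s A = (SUP \<delta>\<in>{0<..}. hausdorff_content \<delta> s A)"

text \<open>The restriction of the outer measure to its Caratheodory measurable sets.\<close>

definition hausdorff_measure :: "real \<Rightarrow> 'a::metric_space measure" where
  "hausdorff_measure s =
     measure_of UNIV (lambda_system UNIV UNIV (hausdorff_outer s)) (hausdorff_outer s)"

definition hausdorff_dim :: "'a::metric_space set \<Rightarrow> ereal" where
  "hausdorff_dim A = (INF t\<in>{t. 0 \<le> t \<and> hausdorff_outer t A = 0}. ereal t)"

definition lower_density :: "real \<Rightarrow> 'a::metric_space set \<Rightarrow> 'a \<Rightarrow> ennreal" where
  "lower_density s A x =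
     Liminf (at_right 0) (\<lambda>r. ennreal ((2 * r) powr (- s)) * hausdorff_outer s (A \<inter> cball x r))"

definition orthogonal_projection ::
    "('a::euclidean_space \<Rightarrow> 'b::euclidean_space) \<Rightarrow> bool" where
  "orthogonal_projection P \<longleftrightarrow>
     linear P \<and> surj P \<and> (\<forall>x \<in> orthogonal_comp {z. P z = 0}. norm (P x) = norm x)"

definition measure_support :: "'a::topological_space measure \<Rightarrow> 'a set" where
  "measure_support \<mu> = \<Inter>{F. closed F \<and> emeasure \<mu> (- F) = 0}"

definition compactly_supported_measures :: "'a::euclidean_space set \<Rightarrow> 'a measure set" where
  "compactly_supported_measures A =
     {\<mu>. sets \<mu> = sets borel \<and> finite_measure \<mu> \<and> emeasure \<mu> UNIV \<noteq> 0 \<and>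
         compact (measure_support \<mu>) \<and> measure_support \<mu> \<subseteq> A}"

text \<open>
  For a finite Borel measure the limit exists almost everywhere; where it does not,
  the value is unspecified.
\<close>

definition measure_derivative :: "'a::euclidean_space measure \<Rightarrow> 'a \<Rightarrow> ennreal" where
  "measure_derivative \<nu> u =
     Lim (at_right 0)
       (\<lambda>\<delta>. emeasure \<nu> (cball u \<delta>) /
            (emeasure lborel (cball (0::'a) 1) * ennreal (\<delta> ^ DIM('a))))"

lemma diam_pow_empty [simp]: "diam_pow s {} = 0"
  by (simp add: diam_pow_def)

lemma hausdorff_content_mono:
  "A \<subseteq> B \<Longrightarrow> hausdorff_content \<delta> s A \<le> hausdorff_content \<delta> s B"
  unfolding hausdorff_content_def by (rule INF_superset_mono) auto

lemma hausdorff_content_empty: "0 < \<delta> \<Longrightarrow> hausdorff_content \<delta> s {} = 0"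
proof -
  assume "0 < \<delta>"
  then have "hausdorff_content \<delta> s ({}::'a set) \<le> (\<Sum>i::nat. diam_pow s ({}::'a set))"
    unfolding hausdorff_content_def by (intro INF_lower) (auto simp: diameter_def)
  then show ?thesis by simp
qed

lemma hausdorff_content_subadditive:
  fixes A :: "nat \<Rightarrow> 'a::metric_space set"
  shows "hausdorff_content \<delta> s (\<Union>i. A i) \<le> (\<Sum>i. hausdorff_content \<delta> s (A i))"
proof (rule ennreal_le_epsilon)
  fix e :: real
  assume e: "0 < e" and fin: "(\<Sum>i. hausdorff_content \<delta> s (A i)) < top"
  have "\<exists>E. A n \<subseteq> (\<Union>i. E i) \<and> (\<forall>i::nat. bounded (E i) \<and> diameter (E i) \<le> \<delta>) \<and>
      (\<Sum>i. diam_pow s (E i)) \<le> hausdorff_content \<delta> s (A n) + ennreal (e * (1/2) ^ Suc n)" for n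
  proof -
    have "hausdorff_content \<delta> s (A n) < top"
      using fin by (auto simp: less_top dest: ennreal_suminf_lessD)
    moreover have "0 < ennreal (e * (1/2) ^ Suc n)"
      using e by simp
    ultimately have "hausdorff_content \<delta> s (A n) <
        hausdorff_content \<delta> s (A n) + ennreal (e * (1/2) ^ Suc n)"
      using ennreal_add_left_cancel_less[of "hausdorff_content \<delta> s (A n)" 0] by (simp add: less_top)
    then show ?thesis
      unfolding hausdorff_content_def[of \<delta> s "A n"] INF_less_iff by (auto intro: less_imp_le)
  qed
  then obtain E where E: "\<And>n. A n \<subseteq> (\<Union>i. E n i)"
      "\<And>n i::nat. bounded (E n i) \<and> diameter (E n i) \<le> \<delta>"
      "\<And>n. (\<Sum>i. diam_pow s (E n i)) \<le> hausdorff_content \<delta> s (A n) + ennreal (e * (1/2) ^ Suc n)"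
    by metis
  define F where "F = (\<lambda>k. case_prod E (prod_decode k))"
  have "(\<Union>i. A i) \<subseteq> (\<Union>k. F k)"
  proof
    fix x assume "x \<in> (\<Union>i. A i)"
    then obtain n i where "x \<in> E n i" using E(1) by blast
    then have "x \<in> F (prod_encode (n, i))" by (simp add: F_def)
    then show "x \<in> (\<Union>k. F k)" by blast
  qed
  moreover have "bounded (F k) \<and> diameter (F k) \<le> \<delta>" for k
    using E(2) by (simp add: F_def split: prod.split)
  ultimately have "hausdorff_content \<delta> s (\<Union>i. A i) \<le> (\<Sum>k. diam_pow s (F k))"
    unfolding hausdorff_content_def by (intro INF_lower) auto
  also have "\<dots> = (\<Sum>k. (\<lambda>(n, i). diam_pow s (E n i)) (prod_decode k))"
    by (simp add: F_def case_prod_beta)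
  also have "\<dots> = (\<Sum>n. \<Sum>i. diam_pow s (E n i))"
    by (rule suminf_ennreal_2dimen) simp
  also have "\<dots> \<le> (\<Sum>n. hausdorff_content \<delta> s (A n) + ennreal (e * (1/2) ^ Suc n))"
    by (intro suminf_le E(3)) auto
  also have "\<dots> = (\<Sum>n. hausdorff_content \<delta> s (A n)) + (\<Sum>n. ennreal (e * (1/2) ^ Suc n))"
    by (rule suminf_add[symmetric]) auto
  also have "(\<Sum>n. ennreal (e * (1/2) ^ Suc n)) = ennreal e"
    using e sums_mult[OF power_half_series, of e] by (intro suminf_ennreal_eq) auto
  finally show "hausdorff_content \<delta> s (\<Union>i. A i) \<le> (\<Sum>i. hausdorff_content \<delta> s (A i)) + ennreal e" .
qed

lemma outer_measure_space_hausdorff_outer: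
  "outer_measure_space UNIV (hausdorff_outer s :: 'a::metric_space set \<Rightarrow> ennreal)"
  unfolding outer_measure_space_def
proof (intro conjI)
  show "positive UNIV (hausdorff_outer s :: 'a set \<Rightarrow> ennreal)"
    by (simp add: positive_def hausdorff_outer_def hausdorff_content_empty image_constant_conv)
  show "increasing UNIV (hausdorff_outer s :: 'a set \<Rightarrow> ennreal)"
    unfolding increasing_def hausdorff_outer_def
    by (auto intro!: SUP_mono hausdorff_content_mono)
  show "countably_subadditive UNIV (hausdorff_outer s :: 'a set \<Rightarrow> ennreal)"
    unfolding countably_subadditive_def
  proof (intro allI impI)
    fix A :: "nat \<Rightarrow> 'a set"
    show "hausdorff_outer s (\<Union>i. A i) \<le> (\<Sum>i. hausdorff_outer s (A i))"
      unfolding hausdorff_outer_def[of s "\<Union>i. A i"]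
    proof (rule SUP_least)
      fix \<delta> :: real assume "\<delta> \<in> {0<..}"
      then have "hausdorff_content \<delta> s (A i) \<le> hausdorff_outer s (A i)" for i
        unfolding hausdorff_outer_def by (rule SUP_upper)
      then have "(\<Sum>i. hausdorff_content \<delta> s (A i)) \<le> (\<Sum>i. hausdorff_outer s (A i))"
        by (intro suminf_le) auto
      then show "hausdorff_content \<delta> s (\<Union>i. A i) \<le> (\<Sum>i. hausdorff_outer s (A i))"
        using hausdorff_content_subadditive[of \<delta> s A] by (rule order_trans[rotated])
    qed
  qed
qed

lemma measure_space_hausdorff_outer:
  "measure_space UNIV (lambda_system UNIV UNIV (hausdorff_outer s))
     (hausdorff_outer s :: 'a::metric_space set \<Rightarrow> ennreal)"
  using sigma_algebra.caratheodory_lemma[OF sigma_algebra_Pow, of "UNIV :: 'a set"]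
    outer_measure_space_hausdorff_outer[of s] by simp

lemma space_hausdorff_measure [simp]: "space (hausdorff_measure s) = UNIV"
  by (simp add: hausdorff_measure_def)

lemma sets_hausdorff_measure:
  "sets (hausdorff_measure s :: 'a::metric_space measure) =
     lambda_system UNIV UNIV (hausdorff_outer s)"
  unfolding hausdorff_measure_def
  by (rule sigma_algebra.sets_measure_of_eq)
     (use measure_space_hausdorff_outer[of s, where ?'a = 'a] in \<open>simp add: measure_space_def\<close>)

lemma emeasure_hausdorff_measure:
  fixes A :: "'a::metric_space set"
  assumes "A \<in> sets (hausdorff_measure s)"
  shows "emeasure (hausdorff_measure s) A = hausdorff_outer s A"
  unfolding hausdorff_measure_def
  by (rule emeasure_measure_of_sigma)
     (use measure_space_hausdorff_outer[of s, where ?'a = 'a] assms in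
        \<open>simp_all add: measure_space_def sets_hausdorff_measure\<close>)

end

theory Submission
  imports Defs
begin

text \<open>
  Write \<open>m\<close> for the dimension of the target. The proof bounds the dimension of slices from below
  without constructing measures on them. Let \<open>\<mu>\<close> be the restriction of the \<open>s\<close>-dimensional
  Hausdorff measure to a compact piece \<open>K\<close> of \<open>A\<close> at whose points the measure of \<open>A\<close> in small balls
  is comparable to \<open>r powr s\<close>.

  The hypothesis is invariant under scaling. Applied to normalised copies of the restrictions of \<open>\<mu>\<close>
  to balls of radius \<open>r\<close>, it bounds the integral over \<open>\<omega>\<close> of the squared \<open>L\<^sup>2\<close> norms of their
  projected densities by a constant times \<open>r powr (2 * s - m)\<close> (\<open>local_energy\<close>). By the lower
  regularity, \<open>K\<close> is covered by at most a constant times \<open>2 powr (j * s)\<close> balls of radius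
  \<open>(1/2) ^ j\<close> (\<open>exists_nets_of_lower_regular\<close>). Hence, for \<open>t < s - m\<close>, the sum of the energies of all
  net balls, weighted with \<open>2 powr (j * t)\<close>, is finite (\<open>net_energy_ae_finite\<close>): for almost all
  \<open>(l, u)\<close> the densities \<open>h\<close> of the pieces at \<open>u\<close> have a finite sum of squares, weighted with the
  inverse \<open>t\<close>-th powers of the radii. If the slice of \<open>K\<close> over such a \<open>u\<close> were \<open>t\<close>-null,
  finitely many net balls with a small \<open>t\<close>-sum of radii would cover it, and then also the part of
  \<open>K\<close> over a neighbourhood of \<open>u\<close>. The density of the projection of \<open>\<mu>\<close> at \<open>u\<close> would be at most the
  sum of the densities \<open>h\<close> of these balls, which is small by an inequality of Cauchy-Schwarz type;
  so it would be zero (\<open>density_zero_of_null_slice\<close>). Thus slices have dimension at least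
  \<open>s - m\<close> wherever the projected density is positive, that is, almost everywhere for the projected
  measure.

  The upper bound holds for Lebesgue almost all \<open>u\<close> and every \<open>l\<close>: integrating covers of \<open>A\<close> over
  the slices shows that their \<open>(s - m)\<close>-dimensional measure is finite
  (\<open>slice_hausdorff_finite\<close>). Absolute continuity of the projections turns this into a statement
  about almost all points of \<open>A\<close>.

  Up to a null set, \<open>A\<close> is a countable union of pieces \<open>K\<close> as above (\<open>compact_pieces\<close>). This rests on
  the finiteness of upper densities, the assumption on lower densities, and the regularity of
  Hausdorff measure. To apply Fubini's theorem, the conditions on \<open>(l, u)\<close> are stated through the
  upper derivative of the projected measures along a fixed sequence of radii, which is jointly
  measurable; the differentiation theorem for measures with a density
  (\<open>differentiation_of_density\<close>) identifies it almost everywhere with the derivative in the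
  hypothesis.
\<close>

section \<open>Hausdorff measure as a metric outer measure\<close>

lemma hausdorff_outer_space:
  "positive UNIV (hausdorff_outer s :: 'a::metric_space set \<Rightarrow> ennreal)"
  "increasing UNIV (hausdorff_outer s :: 'a::metric_space set \<Rightarrow> ennreal)"
  "countably_subadditive UNIV (hausdorff_outer s :: 'a::metric_space set \<Rightarrow> ennreal)"
  using outer_measure_space_hausdorff_outer[of s, where 'a = 'a]
  by (auto simp: outer_measure_space_def)

lemma hausdorff_outer_empty [simp]: "hausdorff_outer s {} = 0"
  using hausdorff_outer_space(1) by (simp add: positive_def)

lemma hausdorff_outer_mono: "A \<subseteq> B \<Longrightarrow> hausdorff_outer s A \<le> hausdorff_outer s B"
  using hausdorff_outer_space(2) by (auto simp: increasing_def)

lemma hausdorff_outer_countable_subadditive: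
  fixes A :: "nat \<Rightarrow> 'a::metric_space set"
  shows "hausdorff_outer s (\<Union>i. A i) \<le> (\<Sum>i. hausdorff_outer s (A i))"
proof -
  have "\<forall>A::nat \<Rightarrow> 'a set. range A \<subseteq> UNIV \<longrightarrow> disjoint_family A \<longrightarrow> (\<Union>i. A i) \<in> UNIV \<longrightarrow>
      hausdorff_outer s (\<Union>i. A i) \<le> (\<Sum>i. hausdorff_outer s (A i))"
    using hausdorff_outer_space(3)[of s, where 'a = 'a] by (simp add: countably_subadditive_def)
  then have "hausdorff_outer s (\<Union>i. disjointed A i) \<le> (\<Sum>i. hausdorff_outer s (disjointed A i))"
    by (simp add: disjoint_family_disjointed)
  also have "\<dots> \<le> (\<Sum>i. hausdorff_outer s (A i))"
    by (intro suminf_le hausdorff_outer_mono disjointed_subset) auto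
  finally show ?thesis by (simp add: UN_disjointed_eq)
qed

lemma hausdorff_outer_subadditive:
  "hausdorff_outer s (A \<union> B) \<le> hausdorff_outer s A + hausdorff_outer s B"
proof -
  define C where "C = (\<lambda>i::nat. if i = 0 then A else if i = 1 then B else {})"
  have "hausdorff_outer s (A \<union> B) \<le> hausdorff_outer s (\<Union>i. C i)"
    by (rule hausdorff_outer_mono) (auto simp: C_def split: if_splits)
  also have "\<dots> \<le> (\<Sum>i. hausdorff_outer s (C i))"
    by (rule hausdorff_outer_countable_subadditive)
  also have "\<dots> = (\<Sum>i\<in>{0, 1}. hausdorff_outer s (C i))"
    by (rule suminf_finite) (auto simp: C_def)
  finally show ?thesis by (simp add: C_def)
qed

lemma hausdorff_content_antimono:
  "\<delta> \<le> \<delta>' \<Longrightarrow> hausdorff_content \<delta>' s A \<le> hausdorff_content \<delta> s A"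
  unfolding hausdorff_content_def by (rule INF_superset_mono) (auto intro: order_trans)

lemma hausdorff_content_le_outer: "0 < \<delta> \<Longrightarrow> hausdorff_content \<delta> s A \<le> hausdorff_outer s A"
  unfolding hausdorff_outer_def by (rule SUP_upper) simp

lemma hausdorff_content_tendsto_outer:
  "(\<lambda>n. hausdorff_content (1 / Suc n) s A) \<longlonglongrightarrow> hausdorff_outer s A"
proof -
  have "incseq (\<lambda>n. hausdorff_content (1 / Suc n) s A)"
    by (intro incseq_SucI hausdorff_content_antimono) (simp add: field_simps)
  then have "(\<lambda>n. hausdorff_content (1 / Suc n) s A) \<longlonglongrightarrow> (SUP n. hausdorff_content (1 / Suc n) s A)"
    by (rule LIMSEQ_SUP)
  also have "(SUP n. hausdorff_content (1 / Suc n) s A) = hausdorff_outer s A"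
  proof (rule antisym)
    show "(SUP n. hausdorff_content (1 / Suc n) s A) \<le> hausdorff_outer s A"
      by (intro SUP_least hausdorff_content_le_outer) simp
    show "hausdorff_outer s A \<le> (SUP n. hausdorff_content (1 / Suc n) s A)"
      unfolding hausdorff_outer_def
    proof (rule SUP_mono)
      fix \<delta> :: real assume "\<delta> \<in> {0<..}"
      then obtain n where "1 / real (Suc n) < \<delta>"
        using nat_approx_posE by auto
      then show "\<exists>n\<in>UNIV. hausdorff_content \<delta> s A \<le> hausdorff_content (1 / Suc n) s A"
        by (intro bexI[of _ n] hausdorff_content_antimono) auto
    qed
  qed
  finally show ?thesis .
qed

text \<open>
  A set of diameter below the distance of \<open>S\<close> and \<open>T\<close> cannot meet both, so a fine cover of the
  union splits into a cover of \<open>S\<close> and one of \<open>T\<close>. This additivity is what makes Borel sets measurable.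
\<close>

lemma hausdorff_outer_separated:
  fixes S T :: "'a::metric_space set"
  assumes d: "0 < d" and sep: "\<And>x y. x \<in> S \<Longrightarrow> y \<in> T \<Longrightarrow> d \<le> dist x y"
  shows "hausdorff_outer s S + hausdorff_outer s T \<le> hausdorff_outer s (S \<union> T)"
proof -
  have content: "hausdorff_content \<delta> s S + hausdorff_content \<delta> s T \<le> hausdorff_content \<delta> s (S \<union> T)"
    if \<delta>: "0 < \<delta>" "\<delta> < d" for \<delta>
    unfolding hausdorff_content_def[of \<delta> s "S \<union> T"]
  proof (rule INF_greatest)
    fix E assume "E \<in> {E::nat \<Rightarrow> 'a set. S \<union> T \<subseteq> (\<Union>i. E i) \<and> (\<forall>i. bounded (E i) \<and> diameter (E i) \<le> \<delta>)}"
    then have E: "S \<union> T \<subseteq> (\<Union>i. E i)" "\<And>i. bounded (E i)" "\<And>i. diameter (E i) \<le> \<delta>" by auto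
    define R where "R = (\<lambda>Q i. if E i \<inter> Q = {} then {} else E i)"
    have R: "hausdorff_content \<delta> s Q \<le> (\<Sum>i. diam_pow s (R Q i))" if "Q \<subseteq> S \<union> T" for Q
      unfolding hausdorff_content_def
    proof (rule INF_lower, intro CollectI conjI allI)
      show "Q \<subseteq> (\<Union>i. R Q i)" using E(1) that by (fastforce simp: R_def)
      show "bounded (R Q i)" "diameter (R Q i) \<le> \<delta>" for i
        using E(2)[of i] E(3)[of i] \<delta> by (simp_all add: R_def)
    qed
    have one: "diam_pow s (R S i) + diam_pow s (R T i) \<le> diam_pow s (E i)" for i
    proof (cases "E i \<inter> S = {} \<or> E i \<inter> T = {}")
      case False
      then obtain x y where "x \<in> E i" "x \<in> S" "y \<in> E i" "y \<in> T" by auto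
      then have "d \<le> diameter (E i)"
        using sep[of x y] diameter_bounded_bound[OF E(2), of x i y] by auto
      then show ?thesis using E(3)[of i] \<delta> by auto
    qed (auto simp: R_def)
    have "hausdorff_content \<delta> s S + hausdorff_content \<delta> s T
        \<le> (\<Sum>i. diam_pow s (R S i)) + (\<Sum>i. diam_pow s (R T i))"
      by (intro add_mono R) auto
    also have "\<dots> = (\<Sum>i. diam_pow s (R S i) + diam_pow s (R T i))"
      by (rule suminf_add) auto
    also have "\<dots> \<le> (\<Sum>i. diam_pow s (E i))" by (intro suminf_le one) auto
    finally show "hausdorff_content \<delta> s S + hausdorff_content \<delta> s T \<le> (\<Sum>i. diam_pow s (E i))" .
  qed
  have ev: "eventually (\<lambda>n. 1 / real (Suc n) < d) sequentially"
    using LIMSEQ_inverse_real_of_nat d by (simp add: inverse_eq_divide order_tendstoD(2))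
  show ?thesis
  proof (rule tendsto_le[OF _ hausdorff_content_tendsto_outer tendsto_add[OF hausdorff_content_tendsto_outer hausdorff_content_tendsto_outer]])
    show "eventually (\<lambda>n. hausdorff_content (1 / Suc n) s S + hausdorff_content (1 / Suc n) s T
        \<le> hausdorff_content (1 / Suc n) s (S \<union> T)) sequentially"
      using ev by eventually_elim (rule content, auto)
  qed simp
qed

lemma ennreal_suminf_tail_small:
  fixes f :: "nat \<Rightarrow> ennreal"
  assumes fin: "(\<Sum>i. f i) < \<infinity>" and e: "0 < e"
  shows "eventually (\<lambda>n. (\<Sum>i. f (i + n)) \<le> ennreal e) sequentially"
proof -
  define g where "g = (\<lambda>i. enn2real (f i))"
  have f: "f i = ennreal (g i)" for i
    using ennreal_suminf_lessD[OF fin, of i] by (simp add: g_def less_top)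
  have g0: "0 \<le> g i" for i by (simp add: g_def)
  have sg: "summable g"
    using fin g0 unfolding f by (intro summable_suminf_not_top) auto
  have "eventually (\<lambda>n. norm (\<Sum>i. g (i + n)) < e) sequentially"
    using suminf_exist_split[OF e sg] by (auto simp: eventually_sequentially)
  then show ?thesis
  proof eventually_elim
    case (elim n)
    have "(\<Sum>i. f (i + n)) = ennreal (\<Sum>i. g (i + n))"
      unfolding f by (rule suminf_ennreal2) (use g0 sg in \<open>auto simp: summable_iff_shift\<close>)
    then show ?case using elim by (auto intro!: ennreal_leI)
  qed
qed

text \<open>
  Caratheodory's criterion for metric outer measures. A test set \<open>X\<close> is exhausted, away from \<open>F\<close>,
  by its points \<open>A k\<close> at distance at least \<open>1 / (k + 1)\<close>, which are separated from \<open>X \<inter> F\<close>. What is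
  left is a union of shells \<open>B k\<close>; shells whose indices have the same parity are separated from
  each other, hence their measures sum to at most \<open>H X\<close> and the tails of both sums are small.
\<close>

lemma closed_sets_hausdorff_measure:
  fixes F :: "'a::metric_space set"
  assumes F: "closed F"
  shows "F \<in> sets (hausdorff_measure s)"
proof -
  define H where "H = (hausdorff_outer s :: 'a set \<Rightarrow> ennreal)"
  have key: "H (X \<inter> F) + H (X - F) \<le> H X" for X
  proof (cases "F = {} \<or> H X = \<infinity>")
    case True then show ?thesis by (auto simp: H_def)
  next
    case False
    then have ne: "F \<noteq> {}" and fin: "H X < \<infinity>" by (auto simp: less_top)
    define A where "A = (\<lambda>k::nat. {x\<in>X. 1 / (real k + 1) \<le> infdist x F})"
    define B where "B = (\<lambda>k::nat. {x\<in>X. 1 / (real k + 2) \<le> infdist x F \<and> infdist x F < 1 / (real k + 1)})"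
    have pos: "0 < infdist x F" if "x \<notin> F" for x
      using that in_closed_iff_infdist_zero[OF F ne] infdist_nonneg[of x F] by (auto simp: less_le)
    have part: "(\<Sum>i<n. H (B (2 * i + p))) \<le> H (\<Union>i<n. B (2 * i + p))" for n p
    proof (induction n)
      case (Suc n)
      have "H (\<Union>i<n. B (2 * i + p)) + H (B (2 * n + p)) \<le> H ((\<Union>i<n. B (2 * i + p)) \<union> B (2 * n + p))"
        unfolding H_def
      proof (rule hausdorff_outer_separated)
        \<comment> \<open>For \<open>n = 0\<close> the union is empty and any gap will do, while the difference is negative if also \<open>p = 0\<close>.\<close>
        show "(if n > 0 then 1 / (real (2 * n + p)) - 1 / (real (2 * n + p) + 1) else 1) > 0"
          by (auto intro!: frac_less2)
        fix x y assume "x \<in> (\<Union>i<n. B (2 * i + p))" and y: "y \<in> B (2 * n + p)"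
        then obtain i where i: "i < n" "x \<in> B (2 * i + p)" by auto
        have "1 / real (2 * n + p) \<le> 1 / (real (2 * i + p) + 2)"
          using i(1) by (intro divide_left_mono) auto
        also have "\<dots> \<le> infdist x F" using i by (simp add: B_def)
        finally have "1 / real (2 * n + p) \<le> infdist x F" .
        moreover have "infdist y F < 1 / (real (2 * n + p) + 1)" using y by (simp add: B_def)
        ultimately show "(if n > 0 then 1 / (real (2 * n + p)) - 1 / (real (2 * n + p) + 1) else 1) \<le> dist x y"
          using infdist_triangle[of x F y] i(1) by (auto simp: dist_commute)
      qed
      moreover have "(\<Union>i<Suc n. B (2 * i + p)) = (\<Union>i<n. B (2 * i + p)) \<union> B (2 * n + p)"
        by (auto simp: less_Suc_eq)
      ultimately show ?case using Suc by (auto intro: order_trans add_mono)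
    qed (simp add: H_def)
    have total: "(\<Sum>i. H (B (2 * i + p))) < \<infinity>" for p
    proof -
      have "(\<Sum>i. H (B (2 * i + p))) \<le> H X"
      proof (rule suminf_le_const)
        fix n
        have "H (\<Union>i<n. B (2 * i + p)) \<le> H X"
          unfolding H_def by (rule hausdorff_outer_mono) (auto simp: B_def)
        then show "(\<Sum>i<n. H (B (2 * i + p))) \<le> H X" using part order_trans by blast
      qed simp
      then show ?thesis using fin by (rule le_less_trans)
    qed
    show ?thesis
    proof (rule ennreal_le_epsilon)
      fix e :: real assume e: "0 < e"
      have "eventually (\<lambda>n. (\<Sum>i. H (B (2 * (i + n) + 0))) \<le> ennreal (e / 2) \<and>
          (\<Sum>i. H (B (2 * (i + n) + 1))) \<le> ennreal (e / 2)) sequentially"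
        using ennreal_suminf_tail_small[OF total, of "e / 2" 0] ennreal_suminf_tail_small[OF total, of "e / 2" 1] e
        by (auto simp: eventually_conj_iff)
      then obtain n where n: "(\<Sum>i. H (B (2 * (i + n) + 0))) \<le> ennreal (e / 2)"
          "(\<Sum>i. H (B (2 * (i + n) + 1))) \<le> ennreal (e / 2)"
        by (auto simp: eventually_sequentially)
      have cover: "X - F \<subseteq> A (2 * n) \<union> ((\<Union>i. B (2 * (i + n) + 0)) \<union> (\<Union>i. B (2 * (i + n) + 1)))"
      proof
        fix x assume x: "x \<in> X - F"
        show "x \<in> A (2 * n) \<union> ((\<Union>i. B (2 * (i + n) + 0)) \<union> (\<Union>i. B (2 * (i + n) + 1)))"
        proof (cases "x \<in> A (2 * n)")
          case False
          define k where "k = (LEAST k. 1 / (real k + 1) \<le> infdist x F)"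
          have "infdist x F > 0" using pos x by simp
          then obtain j where "1 / real (Suc j) < infdist x F" using nat_approx_posE by blast
          then have ex: "\<exists>k. 1 / (real k + 1) \<le> infdist x F"
            by (intro exI[of _ j]) (simp add: add.commute)
          have k: "1 / (real k + 1) \<le> infdist x F" unfolding k_def using ex by (rule LeastI_ex)
          have less: "infdist x F < 1 / (real j + 1)" if "j < k" for j
            using not_less_Least[of j "\<lambda>k. 1 / (real k + 1) \<le> infdist x F"] that by (simp add: k_def)
          have "2 * n < k"
          proof (rule ccontr)
            assume "\<not> 2 * n < k"
            then have "1 / (real (2 * n) + 1) \<le> 1 / (real k + 1)" by (intro divide_left_mono) auto
            then show False using k False x by (auto simp: A_def)
          qed
          then obtain j where j: "k = Suc j" "2 * n \<le> j" by (cases k) auto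
          have xB: "x \<in> B j"
            using k less[of j] x j by (simp add: B_def add.commute)
          have "\<exists>i. j = 2 * (i + n) + 0 \<or> j = 2 * (i + n) + 1"
            using j(2) by presburger
          then show ?thesis using xB by auto
        qed simp
      qed
      have "H (X - F) \<le> H (A (2 * n)) + (H (\<Union>i. B (2 * (i + n) + 0)) + H (\<Union>i. B (2 * (i + n) + 1)))"
        unfolding H_def
        by (intro order_trans[OF hausdorff_outer_mono[OF cover]]
            order_trans[OF hausdorff_outer_subadditive] add_mono order_refl hausdorff_outer_subadditive)
      also have "\<dots> \<le> H (A (2 * n)) + ((\<Sum>i. H (B (2 * (i + n) + 0))) + (\<Sum>i. H (B (2 * (i + n) + 1))))"
        unfolding H_def by (intro add_mono order_refl hausdorff_outer_countable_subadditive)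
      also have "\<dots> \<le> H (A (2 * n)) + (ennreal (e / 2) + ennreal (e / 2))"
        by (intro add_mono order_refl n)
      also have "\<dots> = H (A (2 * n)) + ennreal e"
        using e by (simp add: ennreal_plus[symmetric] del: ennreal_plus)
      finally have le: "H (X - F) \<le> H (A (2 * n)) + ennreal e" .
      have "H (X \<inter> F) + H (A (2 * n)) \<le> H ((X \<inter> F) \<union> A (2 * n))"
        unfolding H_def
      proof (rule hausdorff_outer_separated)
        fix x y assume "x \<in> X \<inter> F" "y \<in> A (2 * n)"
        then show "1 / (real (2 * n) + 1) \<le> dist x y"
          using infdist_le[of x F y] by (auto simp: A_def dist_commute)
      qed simp
      also have "\<dots> \<le> H X" unfolding H_def by (rule hausdorff_outer_mono) (auto simp: A_def)
      finally have "H (X \<inter> F) + H (A (2 * n)) \<le> H X" .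
      then have 1: "H (X \<inter> F) + H (A (2 * n)) + ennreal e \<le> H X + ennreal e" by (rule add_right_mono)
      have "H (X \<inter> F) + H (X - F) \<le> H (X \<inter> F) + (H (A (2 * n)) + ennreal e)"
        using le by (rule add_left_mono)
      also have "\<dots> = H (X \<inter> F) + H (A (2 * n)) + ennreal e" by (simp only: add.assoc)
      also note 1
      finally show "H (X \<inter> F) + H (X - F) \<le> H X + ennreal e" .
    qed
  qed
  have "H X \<le> H (X \<inter> F) + H (X - F)" for X
    using hausdorff_outer_subadditive[of s "X \<inter> F" "X - F"] by (simp add: H_def Int_Diff_Un)
  then have "H (X \<inter> F) + H (X - F) = H X" for X using key by (rule antisym[rotated])
  then show ?thesis
    unfolding sets_hausdorff_measure lambda_system_def H_def
    by (simp add: Int_commute Diff_eq)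
qed

lemma borel_sets_hausdorff_measure:
  fixes B :: "'a::metric_space set"
  assumes "B \<in> sets borel"
  shows "B \<in> sets (hausdorff_measure s)"
proof -
  have "sets (borel :: 'a measure) \<subseteq> sets (hausdorff_measure s)"
  proof -
    have "Collect closed \<subseteq> sets (hausdorff_measure s :: 'a measure)"
      by (auto simp: closed_sets_hausdorff_measure)
    then have "sigma_sets UNIV (Collect closed) \<subseteq> sets (hausdorff_measure s :: 'a measure)"
      using sets.sigma_sets_subset[of "Collect closed" "hausdorff_measure s :: 'a measure"] by simp
    then show ?thesis by (simp add: borel_eq_closed)
  qed
  then show ?thesis using assms by auto
qed

text \<open>
  Closing the covering sets changes neither boundedness nor diameter.
\<close>

lemma hausdorff_closed_cover:
  fixes A :: "'a::metric_space set"
  assumes fin: "hausdorff_outer s A < \<infinity>" and \<delta>: "0 < \<delta>" and \<epsilon>: "0 < \<epsilon>"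
  obtains E where "A \<subseteq> (\<Union>i::nat. E i)" "\<And>i. closed (E i)" "\<And>i. bounded (E i)" "\<And>i. diameter (E i) \<le> \<delta>"
    "(\<Sum>i. diam_pow s (E i)) \<le> hausdorff_outer s A + ennreal \<epsilon>"
proof -
  have "hausdorff_content \<delta> s A < hausdorff_outer s A + ennreal \<epsilon>"
  proof (rule le_less_trans[OF hausdorff_content_le_outer[OF \<delta>]])
    show "hausdorff_outer s A < hausdorff_outer s A + ennreal \<epsilon>"
      using fin \<epsilon> ennreal_add_left_cancel_less[of "hausdorff_outer s A" 0] by (simp add: less_top)
  qed
  then obtain E where E: "A \<subseteq> (\<Union>i::nat. E i)" "\<And>i. bounded (E i)" "\<And>i. diameter (E i) \<le> \<delta>"
      "(\<Sum>i. diam_pow s (E i)) < hausdorff_outer s A + ennreal \<epsilon>"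
    unfolding hausdorff_content_def INF_less_iff by auto
  have "diam_pow s (closure (E i)) = diam_pow s (E i)" for i
    using E(2)[of i] by (simp add: diam_pow_def diameter_closure)
  then show thesis
  proof (intro that[of "\<lambda>i. closure (E i)"])
    show "A \<subseteq> (\<Union>i. closure (E i))"
      by (rule order_trans[OF E(1)]) (intro UN_mono order_refl closure_subset)
    show "diameter (closure (E i)) \<le> \<delta>" for i
      using E(2,3)[of i] by (simp add: diameter_closure)
  qed (use E in \<open>auto simp: bounded_closure less_imp_le\<close>)
qed

text \<open>
  The intersection over \<open>n\<close> of near-optimal closed covers at scale \<open>1 / (n + 1)\<close> is a Borel hull.
\<close>

lemma hausdorff_outer_borel_regular:
  fixes A :: "'a::metric_space set"
  assumes fin: "hausdorff_outer s A < \<infinity>"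
  obtains G where "G \<in> sets borel" "A \<subseteq> G" "hausdorff_outer s G = hausdorff_outer s A"
proof -
  let ?cover = "\<lambda>n E. A \<subseteq> (\<Union>i::nat. E i) \<and> (\<forall>i. closed (E i)) \<and> (\<forall>i. bounded (E i) \<and> diameter (E i) \<le> 1 / Suc n) \<and>
      (\<Sum>i. diam_pow s (E i)) \<le> hausdorff_outer s A + ennreal (1 / Suc n)"
  have "\<exists>E. ?cover n E" for n
  proof -
    have p: "0 < 1 / real (Suc n)" by simp
    show ?thesis
      by (rule hausdorff_closed_cover[OF fin p p]) (intro exI conjI allI; assumption)
  qed
  from choice[OF allI, OF this] obtain E where "\<forall>n. ?cover n (E n)" ..
  then have E: "\<And>n. A \<subseteq> (\<Union>i::nat. E n i)" "\<And>n i. closed (E n i)"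
      "\<And>n i. bounded (E n i) \<and> diameter (E n i) \<le> 1 / Suc n"
      "\<And>n. (\<Sum>i. diam_pow s (E n i)) \<le> hausdorff_outer s A + ennreal (1 / Suc n)"
    by simp_all
  define G where "G = (\<Inter>n. \<Union>i. E n i)"
  have AG: "A \<subseteq> G" using E(1) by (auto simp: G_def)
  have "hausdorff_content (1 / Suc n) s G \<le> hausdorff_outer s A + ennreal (1 / Suc n)" for n
  proof -
    have "hausdorff_content (1 / Suc n) s G \<le> (\<Sum>i. diam_pow s (E n i))"
      unfolding hausdorff_content_def by (rule INF_lower) (use E(3) in \<open>auto simp: G_def\<close>)
    then show ?thesis using E(4) order_trans by blast
  qed
  moreover have "(\<lambda>n. hausdorff_outer s A + ennreal (1 / Suc n)) \<longlonglongrightarrow> hausdorff_outer s A + ennreal 0"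
    using LIMSEQ_inverse_real_of_nat by (intro tendsto_intros) (simp add: inverse_eq_divide)
  ultimately have "hausdorff_outer s G \<le> hausdorff_outer s A + ennreal 0"
    by (intro LIMSEQ_le[OF hausdorff_content_tendsto_outer]) auto
  then have "hausdorff_outer s G = hausdorff_outer s A"
    using hausdorff_outer_mono[OF AG, of s] by auto
  moreover have "G \<in> sets borel" 
  proof -
    have "(\<Union>i. E n i) \<in> sets borel" for n
      using E(2) by (intro sets.countable_UN) (auto intro: borel_closed)
    then show ?thesis unfolding G_def by (intro sets.countable_INT) auto
  qed
  ultimately show thesis using AG that by blast
qed

section \<open>Hausdorff dimension and upper densities\<close>

lemma hausdorff_outer_zero_mono:
  fixes A :: "'a::metric_space set"
  assumes \<tau>: "0 \<le> \<tau>" "\<tau> \<le> t" and zero: "hausdorff_outer \<tau> A = 0"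
  shows "hausdorff_outer t A = 0"
proof -
  have "hausdorff_content (1 / Suc n) t A \<le> hausdorff_content (1 / Suc n) \<tau> A" for n
    unfolding hausdorff_content_def
  proof (rule INF_mono)
    fix E assume "E \<in> {E::nat \<Rightarrow> 'a set. A \<subseteq> (\<Union>i. E i) \<and> (\<forall>i. bounded (E i) \<and> diameter (E i) \<le> 1 / Suc n)}"
    then have E: "A \<subseteq> (\<Union>i. E i)" "\<And>i. bounded (E i)" "\<And>i. diameter (E i) \<le> 1 / Suc n" by auto
    have "diam_pow t (E i) \<le> diam_pow \<tau> (E i)" for i
    proof -
      have d: "0 \<le> diameter (E i)" "diameter (E i) \<le> 1"
        using diameter_ge_0[OF E(2)[of i]] order_trans[OF E(3)[of i], of 1] by simp_all
      have "diameter (E i) powr t \<le> diameter (E i) powr \<tau>" if "\<tau> \<noteq> 0"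
        using d \<tau> that by (cases "diameter (E i) = 0") (auto intro: powr_mono')
      moreover have "diameter (E i) powr t \<le> 1"
        using d \<tau> by (intro powr_le1) auto
      ultimately show ?thesis
        using \<tau> by (auto simp: diam_pow_def intro!: ennreal_leI)
    qed
    then show "\<exists>E'\<in>{E::nat \<Rightarrow> 'a set. A \<subseteq> (\<Union>i. E i) \<and> (\<forall>i. bounded (E i) \<and> diameter (E i) \<le> 1 / Suc n)}.
        (\<Sum>i. diam_pow t (E' i)) \<le> (\<Sum>i. diam_pow \<tau> (E i))"
      using E by (intro bexI[of _ E] suminf_le) auto
  qed
  then have "hausdorff_outer t A \<le> hausdorff_outer \<tau> A"
    by (intro LIMSEQ_le[OF hausdorff_content_tendsto_outer hausdorff_content_tendsto_outer]) auto
  then show ?thesis using zero by simp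
qed

text \<open>
  At scale \<open>1 / (n + 1)\<close> the \<open>t\<close>-sum of a cover is at most \<open>(1 / (n + 1)) powr (t - \<tau>)\<close> times its
  \<open>\<tau>\<close>-sum, and this factor tends to zero.
\<close>

lemma hausdorff_outer_finite_zero:
  fixes A :: "'a::metric_space set"
  assumes \<tau>: "0 < \<tau>" "\<tau> < t" and fin: "hausdorff_outer \<tau> A < \<infinity>"
  shows "hausdorff_outer t A = 0"
proof -
  have le: "hausdorff_content (1 / Suc n) t A \<le> ennreal ((1 / Suc n) powr (t - \<tau>)) * hausdorff_outer \<tau> A" for n
  proof -
    have cov: "hausdorff_content (1 / Suc n) t A \<le> ennreal ((1 / Suc n) powr (t - \<tau>)) * (\<Sum>i. diam_pow \<tau> (E i))"
      if E: "A \<subseteq> (\<Union>i. E i)" "\<And>i. bounded (E i)" "\<And>i. diameter (E i) \<le> 1 / Suc n" for E :: "nat \<Rightarrow> 'a set"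
    proof -
      have one: "diam_pow t (E i) \<le> ennreal ((1 / Suc n) powr (t - \<tau>)) * diam_pow \<tau> (E i)" for i
      proof -
        have "diameter (E i) powr t = diameter (E i) powr (t - \<tau>) * diameter (E i) powr \<tau>"
          by (simp add: powr_add[symmetric])
        also have "\<dots> \<le> (1 / Suc n) powr (t - \<tau>) * diameter (E i) powr \<tau>"
          using diameter_ge_0[OF E(2), of i] E(3)[of i] \<tau> by (intro mult_right_mono powr_mono2) auto
        finally show ?thesis
          using \<tau> by (auto simp: diam_pow_def ennreal_mult[symmetric] intro!: ennreal_leI)
      qed
      have "hausdorff_content (1 / Suc n) t A \<le> (\<Sum>i. diam_pow t (E i))"
        unfolding hausdorff_content_def using E by (intro INF_lower) auto
      also have "\<dots> \<le> (\<Sum>i. ennreal ((1 / Suc n) powr (t - \<tau>)) * diam_pow \<tau> (E i))"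
        by (intro suminf_le one) auto
      finally show ?thesis by simp
    qed
    show ?thesis
    proof (rule ennreal_le_epsilon)
      fix e :: real assume e: "0 < e"
      define c where "c = (1 / Suc n) powr (t - \<tau>)"
      have c: "0 < c" by (simp add: c_def)
      have p: "0 < 1 / real (Suc n)" "0 < e / c" using e c by simp_all
      obtain E where E: "A \<subseteq> (\<Union>i::nat. E i)" "\<And>i. closed (E i)" "\<And>i. bounded (E i)"
          "\<And>i. diameter (E i) \<le> 1 / Suc n" "(\<Sum>i. diam_pow \<tau> (E i)) \<le> hausdorff_outer \<tau> A + ennreal (e / c)"
        by (rule hausdorff_closed_cover[OF fin p]) (rule that; assumption)
      have "hausdorff_content (1 / Suc n) t A \<le> ennreal c * (\<Sum>i. diam_pow \<tau> (E i))"
        unfolding c_def by (rule cov[OF E(1,3,4)])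
      also have "\<dots> \<le> ennreal c * (hausdorff_outer \<tau> A + ennreal (e / c))"
        by (rule mult_left_mono[OF E(5)]) simp
      also have "\<dots> = ennreal c * hausdorff_outer \<tau> A + ennreal e"
        using c e by (simp add: distrib_left ennreal_mult[symmetric])
      finally show "hausdorff_content (1 / Suc n) t A
          \<le> ennreal ((1 / Suc n) powr (t - \<tau>)) * hausdorff_outer \<tau> A + ennreal e"
        by (simp add: c_def)
    qed
  qed
  obtain h where h: "0 \<le> h" "hausdorff_outer \<tau> A = ennreal h"
    using fin by (cases "hausdorff_outer \<tau> A") auto
  have "(\<lambda>n. ennreal ((1 / Suc n) powr (t - \<tau>) * h)) \<longlonglongrightarrow> ennreal (0 * h)"
  proof (intro tendsto_ennrealI tendsto_mult tendsto_const)
    have "(\<lambda>n. (1 / real (Suc n)) powr (t - \<tau>)) \<longlonglongrightarrow> 0 powr (t - \<tau>)"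
      by (rule tendsto_powr') (use LIMSEQ_inverse_real_of_nat \<tau> in \<open>auto simp: inverse_eq_divide\<close>)
    then show "(\<lambda>n. (1 / real (Suc n)) powr (t - \<tau>)) \<longlonglongrightarrow> 0"
      using \<tau> by simp
  qed
  then have "hausdorff_outer t A \<le> ennreal (0 * h)"
    by (intro LIMSEQ_le[OF hausdorff_content_tendsto_outer]) (use le h in \<open>auto simp: ennreal_mult[symmetric]\<close>)
  then show ?thesis by simp
qed

lemma hausdorff_dim_mono: "A \<subseteq> B \<Longrightarrow> hausdorff_dim A \<le> hausdorff_dim B"
  unfolding hausdorff_dim_def
proof (rule INF_superset_mono)
  assume "A \<subseteq> B"
  then have "hausdorff_outer t A = 0" if "hausdorff_outer t B = 0" for t
    using hausdorff_outer_mono[of A B t] that by simp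
  then show "{t. 0 \<le> t \<and> hausdorff_outer t B = 0} \<subseteq> {t. 0 \<le> t \<and> hausdorff_outer t A = 0}"
    by auto
qed simp

lemma hausdorff_dim_le:
  assumes "0 < \<tau>" "hausdorff_outer \<tau> A < \<infinity>"
  shows "hausdorff_dim A \<le> ereal \<tau>"
proof (rule ereal_le_epsilon2)
  fix e :: real assume "0 < e"
  then have "hausdorff_outer (\<tau> + e) A = 0"
    using assms by (intro hausdorff_outer_finite_zero[of \<tau>]) auto
  then have "hausdorff_dim A \<le> ereal (\<tau> + e)"
    unfolding hausdorff_dim_def using assms \<open>0 < e\<close> by (intro INF_lower) auto
  then show "hausdorff_dim A \<le> ereal \<tau> + ereal e" by simp
qed

text \<open>
  Since vanishing of the \<open>\<tau>\<close>-measure passes to all larger exponents, exponents arbitrarily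
  close to \<open>d\<close> suffice.
\<close>

lemma le_hausdorff_dim:
  assumes t: "\<And>t. 0 < t \<Longrightarrow> t < d \<Longrightarrow> \<exists>t'. t \<le> t' \<and> hausdorff_outer t' A \<noteq> 0" and d: "0 < d"
  shows "ereal d \<le> hausdorff_dim A"
  unfolding hausdorff_dim_def
proof (rule INF_greatest)
  fix \<tau> assume "\<tau> \<in> {\<tau>. 0 \<le> \<tau> \<and> hausdorff_outer \<tau> A = 0}"
  then have \<tau>: "0 \<le> \<tau>" "hausdorff_outer \<tau> A = 0" by auto
  show "ereal d \<le> ereal \<tau>"
  proof (rule ccontr)
    assume "\<not> ereal d \<le> ereal \<tau>"
    then have less: "\<tau> < d" by simp
    obtain t' where "(\<tau> + d) / 2 \<le> t'" "hausdorff_outer t' A \<noteq> 0"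
      using t[of "(\<tau> + d) / 2"] less d \<tau> by auto
    then show False using hausdorff_outer_zero_mono[OF \<tau>(1) _ \<tau>(2), of t'] less by auto
  qed
qed

lemma hausdorff_content_le_countable:
  fixes E :: "'i \<Rightarrow> 'a::metric_space set"
  assumes C: "countable C" and cov: "A \<subseteq> (\<Union>i\<in>C. E i)" and \<delta>: "0 < \<delta>"
    and E: "\<And>i. i \<in> C \<Longrightarrow> bounded (E i)" "\<And>i. i \<in> C \<Longrightarrow> diameter (E i) \<le> \<delta>"
  shows "hausdorff_content \<delta> s A \<le> (\<integral>\<^sup>+i. diam_pow s (E i) \<partial>count_space C)"
proof -
  define F where "F = (\<lambda>n. if n \<in> to_nat_on C ` C then E (from_nat_into C n) else {})"
  have F: "F (to_nat_on C i) = E i" if "i \<in> C" for i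
    using that C by (auto simp: F_def)
  have "hausdorff_content \<delta> s A \<le> (\<Sum>n. diam_pow s (F n))"
    unfolding hausdorff_content_def
  proof (intro INF_lower CollectI conjI allI)
    show "A \<subseteq> (\<Union>n. F n)"
    proof
      fix x assume "x \<in> A"
      then obtain i where "i \<in> C" "x \<in> E i" using cov by auto
      then show "x \<in> (\<Union>n. F n)" using F[of i] by blast
    qed
    fix n show "bounded (F n)" "diameter (F n) \<le> \<delta>"
      using E F[of "from_nat_into C n"] \<delta> C by (auto simp: F_def)
  qed
  also have "\<dots> = (\<integral>\<^sup>+n. diam_pow s (F n) \<partial>count_space UNIV)"
    by (rule nn_integral_count_space_nat[symmetric])
  also have "\<dots> = (\<integral>\<^sup>+n. diam_pow s (F n) \<partial>count_space (to_nat_on C ` C))"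
    by (rule nn_integral_count_space_eq) (auto simp: F_def)
  also have "\<dots> = (\<integral>\<^sup>+i. diam_pow s (F (to_nat_on C i)) \<partial>count_space C)"
    by (rule nn_integral_bij_count_space[symmetric]) (use C in \<open>auto simp: bij_betw_def inj_on_to_nat_on\<close>)
  also have "\<dots> = (\<integral>\<^sup>+i. diam_pow s (E i) \<partial>count_space C)"
    by (rule nn_integral_cong) (simp add: F)
  finally show ?thesis .
qed

text \<open>
  The Vitali covering lemma selects disjoint balls \<open>B i\<close> with \<open>k * r powr s < \<nu> (B i)\<close> whose
  fivefold enlargements cover the set; the \<open>s\<close>-sum of the enlargements is at most
  \<open>10 powr s / k\<close> times the total mass of \<open>\<nu>\<close>. The mass being finite, the radii tend to
  zero as \<open>k\<close> grows, so these covers become arbitrarily fine.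
\<close>

lemma infinite_upper_density_null:
  fixes \<nu> :: "'a::euclidean_space measure"
  assumes sets: "sets \<nu> = sets borel" and fin: "finite_measure \<nu>" and s: "0 < s"
  shows "hausdorff_outer s {x. \<forall>k::nat. \<exists>r>0. ennreal (real k * r powr s) < emeasure \<nu> (cball x r)} = 0"
    (is "hausdorff_outer s ?Z = 0")
proof -
  interpret finite_measure \<nu> by fact
  have sp: "space \<nu> = UNIV" using sets_eq_imp_space_eq[OF sets] by simp
  define T where "T = measure \<nu> UNIV"
  have T: "0 \<le> T" "emeasure \<nu> B \<le> ennreal T" for B
    using bounded_measure[of B] by (auto simp: T_def sp emeasure_eq_measure intro!: ennreal_leI)
  have "hausdorff_content (1 / Suc n) s ?Z \<le> 0" for n
  proof (rule ennreal_le_epsilon)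
    fix e :: real assume e: "0 < e"
    define \<rho> where "\<rho> = 1 / (10 * real (Suc n))"
    have \<rho>: "0 < \<rho>" by (simp add: \<rho>_def)
    obtain k :: nat where k: "max 1 (max (T / \<rho> powr s) (10 powr s * T / e)) < real k"
      using reals_Archimedean2 by blast
    then have k0: "0 < real k" by linarith
    have k1: "T < real k * \<rho> powr s" using k \<rho> by (simp add: divide_less_eq)
    have "10 powr s * T < real k * e" using k e by (simp add: divide_less_eq)
    then have k2: "10 powr s * T / real k \<le> e" using k0 by (simp add: divide_le_eq mult.commute)
    define K where "K = {(x, r). 0 < r \<and> ennreal (real k * r powr s) < emeasure \<nu> (cball (x::'a) r)}"
    have K: "0 < snd i \<and> snd i \<le> \<rho>" if iK: "i \<in> K" for i
    proof -
      obtain x r where i: "i = (x, r)" "0 < r" "ennreal (real k * r powr s) < emeasure \<nu> (cball x r)"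
        using iK by (cases i) (auto simp: K_def)
      have "ennreal (real k * r powr s) < ennreal T" using i(3) T(2) by (rule less_le_trans)
      then have "real k * r powr s < real k * \<rho> powr s"
        using k1 T by (simp add: ennreal_less_iff)
      then have "r powr s < \<rho> powr s" using k0 by simp
      then have "\<not> \<rho> < r" using s \<rho> powr_less_mono2[of s \<rho> r] by auto
      then show ?thesis using i by simp
    qed
    have "?Z \<subseteq> (\<Union>i\<in>K. cball (fst i) (snd i))"
    proof
      fix x assume "x \<in> ?Z"
      then obtain r where "r > 0" "ennreal (real k * r powr s) < emeasure \<nu> (cball x r)" by blast
      then show "x \<in> (\<Union>i\<in>K. cball (fst i) (snd i))" by (intro UN_I[of "(x, r)"]) (auto simp: K_def)
    qed
    then obtain C where C: "countable C" "C \<subseteq> K"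
        "pairwise (\<lambda>i j. disjnt (cball (fst i) (snd i)) (cball (fst j) (snd j))) C"
        "?Z \<subseteq> (\<Union>i\<in>C. cball (fst i) (5 * snd i))"
      by (rule Vitali_covering_lemma_cballs[OF _ K])
    have diam: "diameter (cball (fst i) (5 * snd i)) = 10 * snd i" if "i \<in> C" for i
      using K[of i] C(2) that by (auto simp: diameter_cball)
    have "hausdorff_content (1 / Suc n) s ?Z \<le> (\<integral>\<^sup>+i. diam_pow s (cball (fst i) (5 * snd i)) \<partial>count_space C)"
    proof (rule hausdorff_content_le_countable[OF C(1,4)])
      fix i assume i: "i \<in> C"
      then have "snd i \<le> \<rho>" using K[of i] C(2) by blast
      then show "diameter (cball (fst i) (5 * snd i)) \<le> 1 / Suc n"
        by (simp add: diam[OF i] \<rho>_def field_simps)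
    qed auto
    also have "\<dots> \<le> (\<integral>\<^sup>+i. ennreal (10 powr s / real k) * emeasure \<nu> (cball (fst i) (snd i)) \<partial>count_space C)"
    proof (rule nn_integral_mono)
      fix i assume "i \<in> space (count_space C)"
      then have i: "i \<in> C" by simp
      have r: "0 < snd i" and m: "ennreal (real k * snd i powr s) \<le> emeasure \<nu> (cball (fst i) (snd i))"
        using subsetD[OF C(2) i] by (auto simp: K_def split: prod.splits)
      have "diam_pow s (cball (fst i) (5 * snd i)) = ennreal ((10 * snd i) powr s)"
        using s r by (simp add: diam_pow_def diam[OF i])
      also have "\<dots> = ennreal (10 powr s / real k) * ennreal (real k * snd i powr s)"
        using r k0 by (simp add: ennreal_mult[symmetric] powr_mult)
      also have "\<dots> \<le> ennreal (10 powr s / real k) * emeasure \<nu> (cball (fst i) (snd i))"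
        by (rule mult_left_mono[OF m]) simp
      finally show "diam_pow s (cball (fst i) (5 * snd i))
          \<le> ennreal (10 powr s / real k) * emeasure \<nu> (cball (fst i) (snd i))" .
    qed
    also have "\<dots> = ennreal (10 powr s / real k) * (\<integral>\<^sup>+i. emeasure \<nu> (cball (fst i) (snd i)) \<partial>count_space C)"
      by (rule nn_integral_cmult) simp
    also have "(\<integral>\<^sup>+i. emeasure \<nu> (cball (fst i) (snd i)) \<partial>count_space C) = emeasure \<nu> (\<Union>i\<in>C. cball (fst i) (snd i))"
    proof (rule emeasure_UN_countable[symmetric, OF _ C(1)])
      show "disjoint_family_on (\<lambda>i. cball (fst i) (snd i)) C"
        using C(3) unfolding disjoint_family_on_def pairwise_def disjnt_def by blast
    qed (auto simp: sets)
    also have "ennreal (10 powr s / real k) * \<dots> \<le> ennreal (10 powr s / real k) * ennreal T"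
      by (intro mult_left_mono T) simp
    also have "\<dots> \<le> 0 + ennreal e"
      using k2 T by (simp add: ennreal_mult[symmetric] ennreal_leI)
    finally show "hausdorff_content (1 / Suc n) s ?Z \<le> 0 + ennreal e" .
  qed
  then have "hausdorff_outer s ?Z \<le> 0"
    by (intro LIMSEQ_le[OF hausdorff_content_tendsto_outer tendsto_const]) auto
  then show ?thesis by simp
qed

section \<open>Differentiation of measures with a density\<close>

definition ball_ratio :: "'a::euclidean_space measure \<Rightarrow> 'a \<Rightarrow> real \<Rightarrow> ennreal" where
  "ball_ratio \<nu> u \<delta> = emeasure \<nu> (cball u \<delta>) / (emeasure lborel (cball (0::'a) 1) * ennreal (\<delta> ^ DIM('a)))"

text \<open>
  The Vitali step behind both halves of the differentiation theorem. On \<open>E\<close> the measure \<open>\<alpha>\<close> is at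
  most \<open>a\<close> times \<open>\<beta>\<close>, while arbitrarily small balls about the points of \<open>S\<close> carry at least \<open>b\<close>
  times the \<open>\<beta>\<close>-mass. Disjoint such balls inside \<open>U\<close> exhaust \<open>S\<close>, and their union \<open>W\<close> satisfies
  \<open>b * \<beta> W \<le> \<alpha> W \<le> a * \<beta> W + \<epsilon>\<close>, where \<open>\<epsilon>\<close> accounts for the part of \<open>U\<close> outside \<open>E\<close>. As \<open>a < b\<close>,
  both masses are of order \<open>\<epsilon>\<close>.
\<close>

lemma vitali_comparison:
  fixes \<alpha> \<beta> :: "'a::euclidean_space measure" and S E U :: "'a set" and a b \<epsilon> :: real
  assumes sets_\<alpha>: "sets \<alpha> = sets borel" and sets_\<beta>: "sets \<beta> = sets borel"
    and E: "E \<in> sets borel" and SE: "S \<subseteq> E" and EU: "E \<subseteq> U" and U: "open U"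
    and ab: "0 < a" "a < b" and \<epsilon>: "0 \<le> \<epsilon>"
    and compare: "\<And>F. F \<in> sets borel \<Longrightarrow> F \<subseteq> E \<Longrightarrow> emeasure \<alpha> F \<le> ennreal a * emeasure \<beta> F"
    and excess: "emeasure \<alpha> (U - E) \<le> ennreal \<epsilon>" and fin: "emeasure \<alpha> U < \<infinity>"
    and balls: "\<And>x d. x \<in> S \<Longrightarrow> 0 < d \<Longrightarrow>
        \<exists>r. 0 < r \<and> r < d \<and> ennreal b * emeasure \<beta> (cball x r) \<le> emeasure \<alpha> (cball x r)"
  obtains W where "W \<in> sets borel" "negligible (S - W)"
    "emeasure \<beta> W \<le> ennreal (\<epsilon> / (b - a))" "emeasure \<alpha> W \<le> ennreal (a * \<epsilon> / (b - a) + \<epsilon>)"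
proof -
  define K where "K = {(x, r). x \<in> S \<and> 0 < r \<and> cball x r \<subseteq> U \<and>
      ennreal b * emeasure \<beta> (cball x r) \<le> emeasure \<alpha> (cball x r)}"
  have fine: "\<exists>i. i \<in> K \<and> x \<in> cball (fst i) (snd i) \<and> snd i < d" if x: "x \<in> S" and d: "0 < d" for x d
  proof -
    obtain e where e: "e > 0" "cball x e \<subseteq> U"
      using U x SE EU open_contains_cball by blast
    obtain r where r: "0 < r" "r < min d e" "ennreal b * emeasure \<beta> (cball x r) \<le> emeasure \<alpha> (cball x r)"
      using balls[OF x, of "min d e"] d e by auto
    have "cball x r \<subseteq> U" using e(2) r(2) subset_cball[of r e x] by auto
    then have "(x, r) \<in> K" using x r by (auto simp: K_def)
    then show ?thesis using r by (intro exI[of _ "(x, r)"]) auto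
  qed
  have pos: "0 < snd i" if "i \<in> K" for i using that by (auto simp: K_def)
  obtain C where C: "countable C" "C \<subseteq> K"
      "pairwise (\<lambda>i j. disjnt (cball (fst i) (snd i)) (cball (fst j) (snd j))) C"
      "negligible (S - (\<Union>i\<in>C. cball (fst i) (snd i)))"
    by (rule Vitali_covering_theorem_cballs[of K snd S fst, OF pos fine])
  define B where "B = (\<lambda>i::'a \<times> real. cball (fst i) (snd i))"
  define W where "W = (\<Union>i\<in>C. B i)"
  have disj: "disjoint_family_on B C"
    using C(3) unfolding disjoint_family_on_def pairwise_def disjnt_def B_def by blast
  have W_borel: "W \<in> sets borel"
    unfolding W_def by (rule sets.countable_UN'[OF C(1)]) (auto simp: B_def)
  have "B i \<subseteq> U" if "i \<in> C" for i
    using C(2) that by (cases i) (auto simp: B_def K_def)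
  then have WU: "W \<subseteq> U" by (auto simp: W_def)
  have sum_\<alpha>: "emeasure \<alpha> W = (\<integral>\<^sup>+i. emeasure \<alpha> (B i) \<partial>count_space C)"
    unfolding W_def by (rule emeasure_UN_countable[OF _ C(1) disj]) (auto simp: sets_\<alpha> B_def)
  have sum_\<beta>: "emeasure \<beta> W = (\<integral>\<^sup>+i. emeasure \<beta> (B i) \<partial>count_space C)"
    unfolding W_def by (rule emeasure_UN_countable[OF _ C(1) disj]) (auto simp: sets_\<beta> B_def)
  have b_le: "ennreal b * emeasure \<beta> W \<le> emeasure \<alpha> W"
    unfolding sum_\<alpha> sum_\<beta>
    by (subst nn_integral_cmult[symmetric], simp, rule nn_integral_mono)
       (use C(2) in \<open>auto simp: K_def B_def\<close>)
  have fin_W: "emeasure \<alpha> W < \<infinity>"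
    by (rule le_less_trans[OF emeasure_mono[OF WU] fin]) (simp add: sets_\<alpha> U borel_open)
  have "emeasure \<alpha> W \<le> emeasure \<alpha> (W \<inter> E) + emeasure \<alpha> (U - E)"
    by (rule order_trans[OF emeasure_mono emeasure_subadditive])
       (use WU W_borel E U in \<open>auto simp: sets_\<alpha> borel_open\<close>)
  also have "\<dots> \<le> ennreal a * emeasure \<beta> W + ennreal \<epsilon>"
    by (intro add_mono excess order_trans[OF compare] mult_left_mono emeasure_mono)
       (use W_borel E in \<open>auto simp: sets_\<beta>\<close>)
  finally have \<alpha>_le: "emeasure \<alpha> W \<le> ennreal a * emeasure \<beta> W + ennreal \<epsilon>" .
  have "ennreal b * emeasure \<beta> W < \<infinity>" using b_le fin_W by (rule le_less_trans)
  then have "emeasure \<beta> W < \<infinity>"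
    using ab by (auto simp: ennreal_mult_less_top)
  then obtain y where y: "0 \<le> y" "emeasure \<beta> W = ennreal y"
    by (cases "emeasure \<beta> W") auto
  obtain x where x: "0 \<le> x" "emeasure \<alpha> W = ennreal x"
    using fin_W by (cases "emeasure \<alpha> W") auto
  have 1: "b * y \<le> x"
    using b_le ab y x by (simp add: ennreal_mult[symmetric])
  have 2: "x \<le> a * y + \<epsilon>"
    using \<alpha>_le ab y x \<epsilon> by (simp add: ennreal_mult[symmetric] ennreal_plus[symmetric] del: ennreal_plus)
  have 3: "y \<le> \<epsilon> / (b - a)"
    using 1 2 ab by (simp add: field_simps)
  then have "a * y \<le> a * \<epsilon> / (b - a)"
    using ab mult_left_mono[of y "\<epsilon> / (b - a)" a] by simp
  then have 4: "x \<le> a * \<epsilon> / (b - a) + \<epsilon>" using 2 by linarith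
  show thesis
    by (rule that[of W]) (use W_borel C(4) 3 4 x y in \<open>auto simp: W_def B_def ennreal_leI\<close>)
qed

lemma negligible_of_small_superset:
  fixes S :: "'a::euclidean_space set" and c :: real
  assumes c: "0 < c"
    and small: "\<And>\<epsilon>. 0 < \<epsilon> \<Longrightarrow> \<exists>W\<in>sets borel. negligible (S - W) \<and> emeasure lborel W \<le> ennreal (c * \<epsilon>)"
  shows "negligible S"
  unfolding negligible_outer_le
proof (intro allI impI)
  fix e :: real assume e: "0 < e"
  obtain W where W: "W \<in> sets borel" "negligible (S - W)" "emeasure lborel W \<le> ennreal (c * (e / c))"
    using small[of "e / c"] e c by auto
  have le: "emeasure lebesgue W \<le> ennreal e" using W c by simp
  have "emeasure lebesgue W < \<infinity>" using le by (rule le_less_trans) simp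
  then have Wm: "W \<in> lmeasurable"
    using W(1) by (intro fmeasurableI) auto
  have meas: "measure lebesgue (W \<union> (S - W)) = measure lebesgue W"
    unfolding measure_def using W(2)[unfolded negligible_iff_null_sets] fmeasurableD[OF Wm]
    by (simp only: emeasure_Un_null_set)
  show "\<exists>T. S \<subseteq> T \<and> T \<in> lmeasurable \<and> measure lebesgue T \<le> e"
  proof (intro exI[of _ "W \<union> (S - W)"] conjI)
    show "W \<union> (S - W) \<in> lmeasurable"
      by (rule fmeasurable.Un[OF Wm negligible_imp_measurable[OF W(2)]])
    show "measure lebesgue (W \<union> (S - W)) \<le> e"
      using le e unfolding meas by (simp add: measure_def enn2real_leI)
  qed auto
qed

text \<open>
  If the limit fails at \<open>u\<close>, there are rationals \<open>p < q\<close> such that \<open>f u < p\<close> although some arbitrarily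
  small balls have ratio above \<open>q\<close>, or \<open>q < f u\<close> although some have ratio below \<open>p\<close>. The former set
  is null by \<open>vitali_comparison\<close> for \<open>\<nu>\<close> against Lebesgue measure, the latter by the same lemma
  with the two measures exchanged and the constants \<open>1 / q < 1 / p\<close>.
\<close>

lemma differentiation_of_density:
  fixes \<nu> :: "'a::euclidean_space measure" and f :: "'a \<Rightarrow> ennreal"
  assumes fin_\<nu>: "finite_measure \<nu>" and f[measurable]: "f \<in> borel_measurable lborel" and \<nu>: "\<nu> = density lborel f"
  shows "AE u in lborel. (ball_ratio \<nu> u \<longlongrightarrow> f u) (at_right 0)"
proof -
  interpret \<nu>: finite_measure \<nu> by fact
  have sets_\<nu>: "sets \<nu> = sets borel" by (simp add: \<nu>)
  have fin_top: "emeasure \<nu> (space \<nu>) \<noteq> \<infinity>" by simp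
  define R where "R = (\<lambda>u \<delta>. emeasure \<nu> (cball u \<delta>) / emeasure lborel (cball u \<delta>))"
  have pos_ball: "emeasure lborel (cball u \<delta>) \<noteq> 0" "emeasure lborel (cball u \<delta>) \<noteq> top"
    if "0 < \<delta>" for u :: 'a and \<delta>
  proof -
    show "emeasure lborel (cball u \<delta>) \<noteq> top"
      using emeasure_lborel_cball_finite[of u \<delta>] by (auto simp: less_top)
    have "measure lborel (cball u \<delta>) > 0" using content_cball_pos[OF that] .
    then show "emeasure lborel (cball u \<delta>) \<noteq> 0" by (auto simp: measure_def)
  qed
  define high where "high = (\<lambda>p q. {u. f u < ennreal p} \<inter>
      {u. \<forall>d>0. \<exists>r. 0 < r \<and> r < d \<and> ennreal q < R u r})"
  define low where "low = (\<lambda>p q. {u. ennreal q < f u} \<inter>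
      {u. \<forall>d>0. \<exists>r. 0 < r \<and> r < d \<and> R u r < ennreal p})"
  have neg_high: "negligible (high p q)" if pq: "0 < p" "p < q" for p q
  proof (rule negligible_of_small_superset[of "1 / (q - p)"])
    fix \<epsilon> :: real assume \<epsilon>: "0 < \<epsilon>"
    define E where "E = {u. f u < ennreal p}"
    have E: "E \<in> sets borel" unfolding E_def by measurable
    have "emeasure \<nu> E < emeasure \<nu> E + ennreal \<epsilon>"
      using \<epsilon> \<nu>.emeasure_finite[of E] ennreal_add_left_cancel_less[of "emeasure \<nu> E" 0 "ennreal \<epsilon>"] by simp
    then have "\<exists>U. E \<subseteq> U \<and> open U \<and> emeasure \<nu> U < emeasure \<nu> E + ennreal \<epsilon>"
      using outer_regular[OF sets_\<nu> fin_top, of E] E by (auto simp: INF_less_iff)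
    then obtain U where U: "E \<subseteq> U" "open U" "emeasure \<nu> U < emeasure \<nu> E + ennreal \<epsilon>" by blast
    have "emeasure \<nu> (U - E) = emeasure \<nu> U - emeasure \<nu> E"
      by (rule emeasure_Diff) (use U E in \<open>auto simp: sets_\<nu> borel_open\<close>)
    also have "\<dots> \<le> ennreal \<epsilon>"
      using U(3) by (auto simp: ennreal_minus_le_iff)
    finally have excess: "emeasure \<nu> (U - E) \<le> ennreal \<epsilon>" .
    obtain W where "W \<in> sets borel" "negligible (high p q - W)" "emeasure lborel W \<le> ennreal (\<epsilon> / (q - p))"
    proof (rule vitali_comparison[of \<nu> lborel E "high p q" U p q \<epsilon>])
      show "high p q \<subseteq> E" by (auto simp: high_def E_def)
      show "emeasure \<nu> F \<le> ennreal p * emeasure lborel F" if "F \<in> sets borel" "F \<subseteq> E" for F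
      proof -
        have "emeasure \<nu> F = (\<integral>\<^sup>+u. f u * indicator F u \<partial>lborel)"
          using that by (simp add: \<nu> emeasure_density)
        also have "\<dots> \<le> (\<integral>\<^sup>+u. ennreal p * indicator F u \<partial>lborel)"
          by (rule nn_integral_mono) (use that in \<open>auto simp: E_def indicator_def\<close>)
        also have "\<dots> = ennreal p * emeasure lborel F"
          using that by (simp add: nn_integral_cmult)
        finally show ?thesis .
      qed
      show "\<exists>r. 0 < r \<and> r < d \<and> ennreal q * emeasure lborel (cball x r) \<le> emeasure \<nu> (cball x r)"
        if x: "x \<in> high p q" and d: "0 < d" for x d
      proof -
        obtain r where r: "0 < r" "r < d" "ennreal q < R x r" using x d by (auto simp: high_def)
        have "ennreal q * emeasure lborel (cball x r) \<le> R x r * emeasure lborel (cball x r)"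
          using r by (intro mult_right_mono) auto
        also have "\<dots> = emeasure \<nu> (cball x r)"
          using pos_ball[OF r(1), of x] by (simp add: R_def ennreal_divide_times ennreal_divide_self less_top)
        finally show ?thesis using r by auto
      qed
    qed (use E U excess pq \<epsilon> in \<open>auto simp: sets_\<nu> \<nu>.emeasure_finite less_top[symmetric]\<close>)
    then show "\<exists>W\<in>sets borel. negligible (high p q - W) \<and> emeasure lborel W \<le> ennreal (1 / (q - p) * \<epsilon>)"
      by auto
  qed (use pq in simp)
  have neg_low: "negligible (low p q)" if pq: "0 < p" "p < q" for p q
  proof (rule negligible_of_small_superset[of "(1 / q) / (1 / p - 1 / q) + 1"])
    have gap: "1 / q < 1 / p" using pq by (simp add: frac_less2)
    then show "0 < (1 / q) / (1 / p - 1 / q) + 1" using pq by (intro add_pos_pos divide_pos_pos) auto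
    fix \<epsilon> :: real assume \<epsilon>: "0 < \<epsilon>"
    define E where "E = {u. ennreal q < f u}"
    have E: "E \<in> sets borel" unfolding E_def by measurable
    have cmp: "emeasure lborel F \<le> ennreal (1 / q) * emeasure \<nu> F" if F: "F \<in> sets borel" "F \<subseteq> E" for F
    proof -
      have "ennreal q * emeasure lborel F = (\<integral>\<^sup>+u. ennreal q * indicator F u \<partial>lborel)"
        using F by (simp add: nn_integral_cmult)
      also have "\<dots> \<le> (\<integral>\<^sup>+u. f u * indicator F u \<partial>lborel)"
        by (rule nn_integral_mono) (use F in \<open>auto simp: E_def indicator_def less_imp_le\<close>)
      also have "\<dots> = emeasure \<nu> F" using F by (simp add: \<nu> emeasure_density)
      finally have "ennreal (1 / q) * (ennreal q * emeasure lborel F) \<le> ennreal (1 / q) * emeasure \<nu> F"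
        by (intro mult_left_mono) auto
      also have "ennreal (1 / q) * (ennreal q * emeasure lborel F) = emeasure lborel F"
        using pq by (simp add: mult.assoc[symmetric] ennreal_mult[symmetric])
      finally show ?thesis .
    qed
    obtain U where U: "open U" "E \<subseteq> U" "emeasure lborel (U - E) \<le> ennreal \<epsilon>"
      using outer_regular_lborel_le[OF E \<epsilon>] by blast
    have "ennreal (1 / q) * emeasure \<nu> E < \<infinity>"
      using \<nu>.emeasure_finite[of E] by (simp add: ennreal_mult_eq_top_iff less_top[symmetric])
    then have finE: "emeasure lborel E < \<infinity>"
      by (rule le_less_trans[OF cmp[OF E order_refl]])
    have "emeasure lborel U \<le> emeasure lborel E + emeasure lborel (U - E)"
      by (rule order_trans[OF emeasure_mono emeasure_subadditive]) (use U E in \<open>auto simp: borel_open\<close>)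
    also have "\<dots> < \<infinity>" using finE U(3) by (auto simp: less_top[symmetric] top_unique)
    finally have finU: "emeasure lborel U < \<infinity>" .
    obtain W where W: "W \<in> sets borel" "negligible (low p q - W)"
      "emeasure lborel W \<le> ennreal ((1 / q) * \<epsilon> / (1 / p - 1 / q) + \<epsilon>)"
    proof (rule vitali_comparison[of lborel \<nu> E "low p q" U "1 / q" "1 / p" \<epsilon>])
      show "low p q \<subseteq> E" by (auto simp: low_def E_def)
      show "\<exists>r. 0 < r \<and> r < d \<and> ennreal (1 / p) * emeasure \<nu> (cball x r) \<le> emeasure lborel (cball x r)"
        if x: "x \<in> low p q" and d: "0 < d" for x d
      proof -
        obtain r where r: "0 < r" "r < d" "R x r < ennreal p" using x d by (auto simp: low_def)
        have "emeasure \<nu> (cball x r) = R x r * emeasure lborel (cball x r)"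
          using pos_ball[OF r(1), of x] by (simp add: R_def ennreal_divide_times ennreal_divide_self less_top)
        also have "\<dots> \<le> ennreal p * emeasure lborel (cball x r)"
          using r by (intro mult_right_mono) auto
        finally have "ennreal (1 / p) * emeasure \<nu> (cball x r)
            \<le> ennreal (1 / p) * (ennreal p * emeasure lborel (cball x r))"
          by (intro mult_left_mono) auto
        also have "\<dots> = emeasure lborel (cball x r)"
          using pq by (simp add: mult.assoc[symmetric] ennreal_mult[symmetric])
        finally show ?thesis using r by auto
      qed
    qed (use E U cmp finU gap pq \<epsilon> in \<open>auto simp: sets_\<nu>\<close>)
    have eq: "(1 / q) * \<epsilon> / (1 / p - 1 / q) + \<epsilon> = ((1 / q) / (1 / p - 1 / q) + 1) * \<epsilon>"
      by (simp add: distrib_right)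
    show "\<exists>W\<in>sets borel. negligible (low p q - W) \<and>
        emeasure lborel W \<le> ennreal (((1 / q) / (1 / p - 1 / q) + 1) * \<epsilon>)"
      using W unfolding eq by blast
  qed
  \<comment> \<open>Positive rationals suffice: \<open>f u < p\<close> forces \<open>0 < p\<close>, and a bound \<open>a\<close> below \<open>f u\<close> is itself non-negative.\<close>
  define I where "I = {(p, q). p \<in> \<rat> \<and> q \<in> \<rat> \<and> 0 < p \<and> p < (q::real)}"
  have I: "countable I"
    by (rule countable_subset[of _ "\<rat> \<times> \<rat>"]) (auto simp: I_def intro: countable_rat)
  define N where "N = (\<Union>(p, q)\<in>I. high p q \<union> low p q)"
  have "negligible N"
    unfolding N_def by (rule negligible_countable_Union)
      (use I neg_high neg_low in \<open>auto simp: I_def\<close>)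
  then have "AE u in lebesgue. u \<notin> N"
    by (intro AE_not_in) (simp add: negligible_iff_null_sets)
  then have "AE u in lborel. u \<notin> N" by (simp add: AE_completion_iff)
  then show ?thesis
  proof (rule AE_mp, intro AE_I2 impI)
    fix u assume u: "u \<notin> N"
    have ev: "eventually P (at_right (0::real))" if "\<not> (\<forall>d>0. \<exists>r. 0 < r \<and> r < d \<and> \<not> P r)" for P
      using that unfolding eventually_at_right_field by (meson less_imp_le not_less)
    have "(R u \<longlongrightarrow> f u) (at_right 0)"
    proof (rule order_tendstoI)
      fix a assume a: "a < f u"
      obtain p where p: "a < ennreal (real_of_rat p)" "ennreal (real_of_rat p) < f u"
        using ennreal_rat_dense[OF a] by blast
      obtain q where q: "ennreal (real_of_rat p) < ennreal (real_of_rat q)" "ennreal (real_of_rat q) < f u"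
        using ennreal_rat_dense[OF p(2)] by blast
      have p0: "0 < real_of_rat p" using p(1) by (intro ccontr[of "0 < _"]) (simp add: not_less ennreal_neg)
      have pq: "real_of_rat p < real_of_rat q" using q(1) p0 by (simp add: ennreal_less_iff)
      have "(real_of_rat p, real_of_rat q) \<in> I" using p0 pq by (auto simp: I_def)
      then have "u \<notin> low (real_of_rat p) (real_of_rat q)" using u by (auto simp: N_def)
      then have "eventually (\<lambda>r. \<not> R u r < ennreal (real_of_rat p)) (at_right 0)"
        using q(2) by (intro ev) (auto simp: low_def)
      then show "eventually (\<lambda>r. a < R u r) (at_right 0)"
        by (rule eventually_mono) (use p(1) in \<open>auto simp: not_less\<close>)
    next
      fix a assume a: "f u < a"
      obtain q where q: "f u < ennreal (real_of_rat q)" "ennreal (real_of_rat q) < a"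
        using ennreal_rat_dense[OF a] by blast
      obtain p where p: "f u < ennreal (real_of_rat p)" "ennreal (real_of_rat p) < ennreal (real_of_rat q)"
        using ennreal_rat_dense[OF q(1)] by blast
      have p0: "0 < real_of_rat p" using p(1) by (intro ccontr[of "0 < _"]) (simp add: not_less ennreal_neg)
      have pq: "real_of_rat p < real_of_rat q" using p(2) p0 by (simp add: ennreal_less_iff)
      have "(real_of_rat p, real_of_rat q) \<in> I" using p0 pq by (auto simp: I_def)
      then have "u \<notin> high (real_of_rat p) (real_of_rat q)" using u by (auto simp: N_def)
      then have "eventually (\<lambda>r. \<not> ennreal (real_of_rat q) < R u r) (at_right 0)"
        using p(1) by (intro ev) (auto simp: high_def)
      then show "eventually (\<lambda>r. R u r < a) (at_right 0)"
        by (rule eventually_mono) (use q(2) in \<open>auto simp: not_less\<close>)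
    qed
    moreover have "eventually (\<lambda>\<delta>. R u \<delta> = ball_ratio \<nu> u \<delta>) (at_right 0)"
      using eventually_at_right_less[of 0]
      by eventually_elim (simp add: R_def ball_ratio_def emeasure_cball ennreal_mult[symmetric])
    ultimately show "(ball_ratio \<nu> u \<longlongrightarrow> f u) (at_right 0)"
      by (rule Lim_transform_eventually)
  qed
qed

section \<open>Derivatives of projected and rescaled measures\<close>

text \<open>
  An everywhere defined and, in all parameters, measurable substitute for the derivative of a
  measure; a limit superior along a sequence is also subadditive in the measure at every point.
\<close>

definition upper_derivative :: "'a::euclidean_space measure \<Rightarrow> 'a \<Rightarrow> ennreal" where
  "upper_derivative \<nu> u = limsup (\<lambda>k. ball_ratio \<nu> u (1 / Suc k))"

lemma measurable_emeasure_cball_distr: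
  fixes f :: "'w \<Rightarrow> 'a::topological_space \<Rightarrow> 'b::euclidean_space" and \<mu> :: "'a measure"
  assumes fin: "finite_measure \<mu>" and sets[measurable_cong]: "sets \<mu> = sets borel"
    and f[measurable]: "(\<lambda>(w, x). f w x) \<in> N \<Otimes>\<^sub>M borel \<rightarrow>\<^sub>M borel"
  shows "(\<lambda>(w, u). emeasure (distr \<mu> borel (f w)) (cball u \<delta>)) \<in> borel_measurable (N \<Otimes>\<^sub>M borel)"
proof -
  interpret finite_measure \<mu> by fact
  have sp: "space \<mu> = UNIV" using sets_eq_imp_space_eq[OF sets] by simp
  define Q where "Q = {z \<in> space ((N \<Otimes>\<^sub>M borel) \<Otimes>\<^sub>M \<mu>). dist (snd (fst z)) (case (fst (fst z), snd z) of (w, x) \<Rightarrow> f w x) \<le> \<delta>}"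
  have Q: "Q \<in> sets ((N \<Otimes>\<^sub>M borel) \<Otimes>\<^sub>M \<mu>)"
    unfolding Q_def by measurable
  have "(\<lambda>p. emeasure \<mu> (Pair p -` Q)) \<in> borel_measurable (N \<Otimes>\<^sub>M borel)"
    by (rule measurable_emeasure_Pair[OF Q])
  also have "?this \<longleftrightarrow> ?thesis"
  proof (rule measurable_cong)
    fix p assume p: "p \<in> space (N \<Otimes>\<^sub>M (borel :: 'b measure))"
    obtain w u where wu: "p = (w, u)" by (cases p)
    have w: "w \<in> space N" using p by (simp add: wu space_pair_measure)
    have fw: "f w \<in> \<mu> \<rightarrow>\<^sub>M borel"
      using measurable_compose[OF measurable_Pair1'[OF w] f] by (simp add: measurable_cong_sets[OF sets refl])
    have "Pair p -` Q = f w -` cball u \<delta>"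
      using w by (auto simp: Q_def wu space_pair_measure sp)
    then show "emeasure \<mu> (Pair p -` Q) = (case p of (w, u) \<Rightarrow> emeasure (distr \<mu> borel (f w)) (cball u \<delta>))"
      using fw by (simp add: wu emeasure_distr sp)
  qed
  finally show ?thesis .
qed

lemma measurable_upper_derivative_distr:
  fixes f :: "'w \<Rightarrow> 'a::topological_space \<Rightarrow> 'b::euclidean_space" and \<mu> :: "'a measure"
  assumes "finite_measure \<mu>" "sets \<mu> = sets borel" "(\<lambda>(w, x). f w x) \<in> N \<Otimes>\<^sub>M borel \<rightarrow>\<^sub>M borel"
  shows "(\<lambda>(w, u). upper_derivative (distr \<mu> borel (f w)) u) \<in> borel_measurable (N \<Otimes>\<^sub>M borel)"
proof -
  have [measurable]: "(\<lambda>p. emeasure (distr \<mu> borel (f (fst p))) (cball (snd p) \<delta>)) \<in> borel_measurable (N \<Otimes>\<^sub>M borel)" for \<delta>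
    using measurable_emeasure_cball_distr[OF assms, of \<delta>] by (simp add: case_prod_beta)
  show ?thesis
    unfolding upper_derivative_def ball_ratio_def case_prod_beta by measurable
qed

lemma measurable_upper_derivative:
  fixes \<nu> :: "'a::euclidean_space measure"
  assumes fin: "finite_measure \<nu>" and sets: "sets \<nu> = sets borel"
  shows "upper_derivative \<nu> \<in> borel_measurable borel"
proof -
  have "(\<lambda>(w::real, u). upper_derivative (distr \<nu> borel (\<lambda>x. x)) u) \<in> borel_measurable (borel \<Otimes>\<^sub>M borel)"
    by (rule measurable_upper_derivative_distr[OF fin sets]) measurable
  from measurable_compose[OF measurable_Pair1'[of 0] this]
  have "upper_derivative (distr \<nu> borel (\<lambda>x. x)) \<in> borel_measurable borel" by simp
  moreover have "distr \<nu> borel (\<lambda>x. x) = \<nu>"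
    by (rule distr_id2) (simp add: sets)
  ultimately show ?thesis by simp
qed

lemma at_right_inverse_Suc: "filterlim (\<lambda>k. 1 / real (Suc k)) (at_right 0) sequentially"
  unfolding filterlim_at using LIMSEQ_inverse_real_of_nat by (auto simp: inverse_eq_divide)

lemma upper_derivative_ae:
  fixes \<nu> :: "'a::euclidean_space measure"
  assumes fin: "finite_measure \<nu>" and sets: "sets \<nu> = sets borel" and ac: "absolutely_continuous lborel \<nu>"
  shows "AE u in lborel. (ball_ratio \<nu> u \<longlongrightarrow> upper_derivative \<nu> u) (at_right 0)"
    and "\<nu> = density lborel (upper_derivative \<nu>)"
    and "AE u in lborel. measure_derivative \<nu> u = upper_derivative \<nu> u"
proof -
  obtain f where f: "f \<in> borel_measurable lborel" "density lborel f = \<nu>"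
    using sigma_finite_measure.Radon_Nikodym[OF sigma_finite_lborel ac] sets by auto
  have lim: "AE u in lborel. (ball_ratio \<nu> u \<longlongrightarrow> f u) (at_right 0)"
    by (rule differentiation_of_density[OF fin f(1) f(2)[symmetric]])
  have eq: "upper_derivative \<nu> u = f u" if "(ball_ratio \<nu> u \<longlongrightarrow> f u) (at_right 0)" for u
    unfolding upper_derivative_def
    by (rule lim_imp_Limsup[OF _ filterlim_compose[OF that at_right_inverse_Suc]]) simp
  show "AE u in lborel. (ball_ratio \<nu> u \<longlongrightarrow> upper_derivative \<nu> u) (at_right 0)"
    using lim by eventually_elim (simp add: eq)
  have "density lborel f = density lborel (upper_derivative \<nu>)"
    by (rule density_cong) (use f measurable_upper_derivative[OF fin sets] lim eq in auto)
  then show "\<nu> = density lborel (upper_derivative \<nu>)" using f by simp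
  show "AE u in lborel. measure_derivative \<nu> u = upper_derivative \<nu> u"
    using lim
  proof eventually_elim
    case (elim u)
    have "measure_derivative \<nu> u = f u"
      unfolding measure_derivative_def ball_ratio_def[symmetric]
      by (rule tendsto_Lim) (use elim in auto)
    then show ?case using eq[OF elim] by simp
  qed
qed

lemma nn_integral_lborel_affine:
  fixes F :: "'a::euclidean_space \<Rightarrow> ennreal"
  assumes F[measurable]: "F \<in> borel_measurable borel" and r: "0 < r"
  shows "(\<integral>\<^sup>+u. F u \<partial>lborel) = ennreal (r ^ DIM('a)) * (\<integral>\<^sup>+v. F (b + r *\<^sub>R v) \<partial>lborel)"
proof -
  have "(\<integral>\<^sup>+u. F u \<partial>lborel) = (\<integral>\<^sup>+u. F u \<partial>density (distr lborel borel (\<lambda>x. b + r *\<^sub>R x)) (\<lambda>_. \<bar>r\<bar> ^ DIM('a)))"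
    using lborel_affine[of r b] r by simp
  also have "\<dots> = ennreal (r ^ DIM('a)) * (\<integral>\<^sup>+v. F (b + r *\<^sub>R v) \<partial>lborel)"
    using r by (simp add: nn_integral_density nn_integral_distr nn_integral_cmult)
  finally show ?thesis .
qed

text \<open>
  Blowing up by the factor \<open>r\<close> multiplies the density by \<open>k / r ^ m\<close> and Lebesgue measure by
  \<open>r ^ m\<close>, so the energy is multiplied by \<open>k\<^sup>2 / r ^ m\<close>. The identity of the densities holds only
  almost everywhere, because the radii \<open>1 / (i + 1)\<close> are not invariant under the scaling.
\<close>

lemma upper_derivative_affine_image:
  fixes \<eta> \<eta>' :: "'b::euclidean_space measure"
  assumes fin: "finite_measure \<eta>" "sets \<eta> = sets borel" "absolutely_continuous lborel \<eta>"
    and fin': "finite_measure \<eta>'" "sets \<eta>' = sets borel"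
    and r: "0 < r" and k: "0 < k"
    and image: "\<And>B. B \<in> sets borel \<Longrightarrow> emeasure \<eta>' B = ennreal k * emeasure \<eta> {v. b + r *\<^sub>R v \<in> B}"
  shows "absolutely_continuous lborel \<eta>'"
    and "(\<integral>\<^sup>+u. (upper_derivative \<eta>' u)\<^sup>2 \<partial>lborel)
       = ennreal (k\<^sup>2 / r ^ DIM('b)) * (\<integral>\<^sup>+u. (upper_derivative \<eta> u)\<^sup>2 \<partial>lborel)"
proof -
  show "absolutely_continuous lborel \<eta>'"
    unfolding absolutely_continuous_def
  proof
    fix N assume N: "N \<in> null_sets (lborel :: 'b measure)"
    then have NB[measurable]: "N \<in> sets borel" by auto
    have meas: "{v. b + r *\<^sub>R v \<in> N} \<in> sets borel"
      using measurable_sets[of "\<lambda>v. b + r *\<^sub>R v" borel borel N] by (simp add: vimage_def)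
    have "0 = (\<integral>\<^sup>+u. indicator N u \<partial>lborel)" using N by auto
    also have "\<dots> = ennreal (r ^ DIM('b)) * (\<integral>\<^sup>+v. indicator N (b + r *\<^sub>R v) \<partial>lborel)"
      by (rule nn_integral_lborel_affine[OF _ r]) measurable
    also have "(\<integral>\<^sup>+v. indicator N (b + r *\<^sub>R v) \<partial>lborel) = (\<integral>\<^sup>+v. indicator {v. b + r *\<^sub>R v \<in> N} v \<partial>lborel)"
      by (intro nn_integral_cong) (simp add: indicator_def)
    also have "\<dots> = emeasure lborel {v. b + r *\<^sub>R v \<in> N}" using meas by simp
    finally have "{v. b + r *\<^sub>R v \<in> N} \<in> null_sets lborel"
      using r meas by (auto simp: null_sets_def)
    then have "{v. b + r *\<^sub>R v \<in> N} \<in> null_sets \<eta>"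
      using fin(3) by (auto simp: absolutely_continuous_def)
    then show "N \<in> null_sets \<eta>'"
      using image[OF NB] NB fin'(2) by (auto simp: null_sets_def)
  qed
  define q where "q = k / r ^ DIM('b)"
  have q: "0 \<le> q" using k r by (simp add: q_def)
  have ratio: "ball_ratio \<eta>' (b + r *\<^sub>R v) \<delta> = ennreal q * ball_ratio \<eta> v (\<delta> / r)" if \<delta>: "0 < \<delta>" for v \<delta>
  proof -
    have ball: "{w. b + r *\<^sub>R w \<in> cball (b + r *\<^sub>R v) \<delta>} = cball v (\<delta> / r)"
    proof -
      have "dist (b + r *\<^sub>R v) (b + r *\<^sub>R w) = r * dist v w" for w
        using r by (simp add: dist_norm scaleR_diff_right[symmetric])
      then show ?thesis using r by (auto simp: field_simps)
    qed
    have \<alpha>: "emeasure lborel (cball (0::'b) 1) = ennreal (unit_ball_vol (DIM('b)))" "0 < unit_ball_vol (DIM('b))"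
      by (simp_all add: emeasure_cball)
    have "ennreal k * (x / (ennreal a * ennreal (\<delta> ^ DIM('b))))
        = ennreal q * (x / (ennreal a * ennreal ((\<delta> / r) ^ DIM('b)))) * 1" if a: "0 < a" for x a
    proof -
      have "ennreal q / (ennreal a * ennreal ((\<delta> / r) ^ DIM('b))) = ennreal (q / (a * (\<delta> / r) ^ DIM('b)))"
        using a \<delta> r q by (simp add: ennreal_mult[symmetric] divide_ennreal)
      also have "\<dots> = ennreal (k / (a * \<delta> ^ DIM('b)))"
        using a \<delta> r by (simp add: q_def power_divide)
      also have "\<dots> = ennreal k / (ennreal a * ennreal (\<delta> ^ DIM('b)))"
        using a \<delta> k by (simp add: ennreal_mult[symmetric] divide_ennreal)
      finally show ?thesis
        by (metis ennreal_times_divide mult.commute mult.right_neutral)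
    qed
    then show ?thesis
      unfolding ball_ratio_def image[OF borel_closed[OF closed_cball]] ball \<alpha>(1)
      using \<alpha>(2) by (simp add: ennreal_times_divide)
  qed
  have AE: "AE v in lborel. upper_derivative \<eta>' (b + r *\<^sub>R v) = ennreal q * upper_derivative \<eta> v"
    using upper_derivative_ae(1)[OF fin]
  proof eventually_elim
    case (elim v)
    have "filterlim (\<lambda>k. 1 / real (Suc k) / r) (at_right 0) sequentially"
      unfolding filterlim_at
    proof
      have "(\<lambda>k. 1 / real (Suc k) / r) \<longlonglongrightarrow> 0 / r"
        using LIMSEQ_inverse_real_of_nat by (intro tendsto_intros) (use r in \<open>auto simp: inverse_eq_divide\<close>)
      then show "(\<lambda>k. 1 / real (Suc k) / r) \<longlonglongrightarrow> 0" by simp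
    qed (use r in auto)
    then have "(\<lambda>k. ennreal q * ball_ratio \<eta> v (1 / real (Suc k) / r)) \<longlonglongrightarrow> ennreal q * upper_derivative \<eta> v"
      by (intro ennreal_tendsto_cmult filterlim_compose[OF elim]) simp_all
    then have "(\<lambda>k. ball_ratio \<eta>' (b + r *\<^sub>R v) (1 / real (Suc k))) \<longlonglongrightarrow> ennreal q * upper_derivative \<eta> v"
      by (simp add: ratio)
    then show ?case unfolding upper_derivative_def by (intro lim_imp_Limsup) auto
  qed
  note [measurable] = measurable_upper_derivative[OF fin(1,2)] measurable_upper_derivative[OF fin']
  have "(\<integral>\<^sup>+u. (upper_derivative \<eta>' u)\<^sup>2 \<partial>lborel)
      = ennreal (r ^ DIM('b)) * (\<integral>\<^sup>+v. (upper_derivative \<eta>' (b + r *\<^sub>R v))\<^sup>2 \<partial>lborel)"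
    by (rule nn_integral_lborel_affine[OF _ r]) measurable
  also have "(\<integral>\<^sup>+v. (upper_derivative \<eta>' (b + r *\<^sub>R v))\<^sup>2 \<partial>lborel)
      = (\<integral>\<^sup>+v. ennreal (q\<^sup>2) * (upper_derivative \<eta> v)\<^sup>2 \<partial>lborel)"
    by (rule nn_integral_cong_AE, use AE in eventually_elim)
       (use q in \<open>simp add: power_mult_distrib ennreal_power\<close>)
  also have "\<dots> = ennreal (q\<^sup>2) * (\<integral>\<^sup>+v. (upper_derivative \<eta> v)\<^sup>2 \<partial>lborel)"
    by (rule nn_integral_cmult) measurable
  also have "ennreal (r ^ DIM('b)) * (ennreal (q\<^sup>2) * (\<integral>\<^sup>+v. (upper_derivative \<eta> v)\<^sup>2 \<partial>lborel))
      = ennreal (r ^ DIM('b) * q\<^sup>2) * (\<integral>\<^sup>+v. (upper_derivative \<eta> v)\<^sup>2 \<partial>lborel)"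
    using r by (simp add: ennreal_mult mult.assoc)
  also have "r ^ DIM('b) * q\<^sup>2 = k\<^sup>2 / r ^ DIM('b)"
    using r by (simp add: q_def power2_eq_square field_simps)
  finally show "(\<integral>\<^sup>+u. (upper_derivative \<eta>' u)\<^sup>2 \<partial>lborel)
       = ennreal (k\<^sup>2 / r ^ DIM('b)) * (\<integral>\<^sup>+u. (upper_derivative \<eta> u)\<^sup>2 \<partial>lborel)" .
qed

section \<open>Families of projections and the local energy bound\<close>

locale projection_family =
  fixes P :: "'l::metric_space \<Rightarrow> 'a::euclidean_space \<Rightarrow> 'b::euclidean_space"
    and \<Lambda> :: "'l set" and \<omega> :: "'l measure"
  assumes proj: "\<And>l. l \<in> \<Lambda> \<Longrightarrow> orthogonal_projection (P l)"
    and cont: "\<And>x. continuous_on \<Lambda> (\<lambda>l. P l x)"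
    and sets_\<omega>: "sets \<omega> = sets (restrict_space borel \<Lambda>)"
    and finite_\<omega>: "finite_measure \<omega>"
begin

sublocale \<omega>: finite_measure \<omega> by (rule finite_\<omega>)

lemma space_\<omega>: "space \<omega> = \<Lambda>"
  using sets_eq_imp_space_eq[OF sets_\<omega>] by (simp add: space_restrict_space)

lemma linear_P: "l \<in> \<Lambda> \<Longrightarrow> linear (P l)"
  using proj by (simp add: orthogonal_projection_def)

text \<open>
  Split off the component in the kernel; the projection is isometric on the rest.
\<close>

lemma norm_P_le:
  assumes l: "l \<in> \<Lambda>"
  shows "norm (P l x) \<le> norm x"
proof -
  interpret linear "P l" by (rule linear_P[OF l])
  have sub: "subspace {z. P l z = 0}" by (rule linear_subspace_kernel[OF linear_P[OF l]])
  obtain y z where yz: "y \<in> span {z. P l z = 0}" "\<And>w. w \<in> span {z. P l z = 0} \<Longrightarrow> orthogonal z w" "x = y + z"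
    using orthogonal_subspace_decomp_exists[of "{z. P l z = 0}" x] by metis
  have y: "P l y = 0" using yz(1) sub by (simp add: span_eq_iff[THEN iffD2])
  have "z \<in> orthogonal_comp {z. P l z = 0}"
    using yz(2) by (auto simp: orthogonal_comp_def orthogonal_commute span_base)
  then have "norm (P l z) = norm z"
    using proj[OF l] by (simp add: orthogonal_projection_def)
  moreover have "P l x = P l z" using y yz(3) by (simp add: add)
  moreover have "norm z \<le> norm x"
  proof (rule power2_le_imp_le)
    have "orthogonal y z" using yz(1,2) by (simp add: orthogonal_commute)
    then have "(norm x)\<^sup>2 = (norm y)\<^sup>2 + (norm z)\<^sup>2"
      using norm_add_Pythagorean yz(3) by blast
    then show "(norm z)\<^sup>2 \<le> (norm x)\<^sup>2" by simp
  qed simp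
  ultimately show ?thesis by simp
qed

lemma dist_P_le:
  assumes l: "l \<in> \<Lambda>"
  shows "dist (P l x) (P l y) \<le> dist x y"
  using norm_P_le[OF l, of "x - y"] linear_diff[OF linear_P[OF l], of x y] by (simp add: dist_norm)

lemma continuous_P: "l \<in> \<Lambda> \<Longrightarrow> continuous_on S (P l)"
  using linear_P linear_continuous_on linear_conv_bounded_linear by blast

lemma measurable_P_single: "l \<in> \<Lambda> \<Longrightarrow> P l \<in> borel \<rightarrow>\<^sub>M borel"
  by (rule borel_measurable_continuous_onI[OF continuous_P])

lemma measurable_P_parameter: "(\<lambda>l. P l x) \<in> \<omega> \<rightarrow>\<^sub>M borel"
  using borel_measurable_continuous_on_restrict[OF cont] by (simp add: measurable_cong_sets[OF sets_\<omega> refl])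

text \<open>
  Expansion in a basis separates the variables \<open>l\<close> and \<open>x\<close>, so continuity in \<open>l\<close> for fixed \<open>x\<close> is enough.
\<close>

lemma measurable_P: "(\<lambda>(l, x). P l x) \<in> \<omega> \<Otimes>\<^sub>M borel \<rightarrow>\<^sub>M borel"
proof -
  note [measurable] = measurable_P_parameter
  have "(\<lambda>p. \<Sum>b\<in>Basis. (snd p \<bullet> b) *\<^sub>R P (fst p) b) \<in> \<omega> \<Otimes>\<^sub>M borel \<rightarrow>\<^sub>M borel"
    by measurable
  also have "?this \<longleftrightarrow> ?thesis"
  proof (rule measurable_cong)
    fix p assume "p \<in> space (\<omega> \<Otimes>\<^sub>M (borel :: 'a measure))"
    then obtain l x where p: "p = (l, x)" "l \<in> \<Lambda>" by (cases p) (auto simp: space_pair_measure space_\<omega>)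
    interpret linear "P l" by (rule linear_P[OF p(2)])
    have "P l x = P l (\<Sum>b\<in>Basis. (x \<bullet> b) *\<^sub>R b)" by (simp add: euclidean_representation)
    then show "(\<Sum>b\<in>Basis. (snd p \<bullet> b) *\<^sub>R P (fst p) b) = (case p of (l, x) \<Rightarrow> P l x)"
      using p by (simp add: sum scale)
  qed
  finally show ?thesis .
qed

definition projected_density :: "'a measure \<Rightarrow> 'l \<Rightarrow> 'b \<Rightarrow> ennreal" where
  "projected_density \<mu> l = upper_derivative (distr \<mu> borel (P l))"

lemma measurable_projected_density:
  assumes "finite_measure \<mu>" "sets \<mu> = sets borel"
  shows "(\<lambda>(l, u). projected_density \<mu> l u) \<in> borel_measurable (\<omega> \<Otimes>\<^sub>M borel)"
  unfolding projected_density_def by (rule measurable_upper_derivative_distr[OF assms measurable_P])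

lemma finite_measure_projection:
  assumes "finite_measure \<mu>" "sets \<mu> = sets borel" "l \<in> \<Lambda>"
  shows "finite_measure (distr \<mu> borel (P l))"
  by (rule finite_measure.finite_measure_distr[OF assms(1)])
     (use measurable_P_single[OF assms(3)] in \<open>simp add: measurable_cong_sets[OF assms(2) refl]\<close>)

lemma emeasure_projection:
  assumes "sets \<mu> = sets borel" "l \<in> \<Lambda>" "B \<in> sets borel"
  shows "emeasure (distr \<mu> borel (P l)) B = emeasure \<mu> {x. P l x \<in> B}"
  using emeasure_distr[of "P l" \<mu> borel B] measurable_P_single[OF assms(2)] assms(3) sets_eq_imp_space_eq[OF assms(1)]
  by (simp add: measurable_cong_sets[OF assms(1) refl] vimage_def)

end

text \<open>
  The energy bound is assumed on the unit ball only, with growth constant one; \<open>local_energy\<close>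
  below recovers it for all balls and all growth constants.
\<close>

locale projection_energy = projection_family P \<Lambda> \<omega>
  for P :: "'l::metric_space \<Rightarrow> 'a::euclidean_space \<Rightarrow> 'b::euclidean_space" and \<Lambda> \<omega> +
  fixes s C :: real
  assumes s_gt: "real DIM('b) < s" and C_pos: "0 < C"
    and energy: "\<And>\<mu>. \<mu> \<in> compactly_supported_measures (cball (0 :: 'a) 1) \<Longrightarrow>
        (\<And>x r. r > 0 \<Longrightarrow> emeasure \<mu> (cball x r) \<le> ennreal (r powr s)) \<Longrightarrow>
        (AE l in \<omega>. absolutely_continuous lborel (distr \<mu> borel (P l))) \<and>
        (\<integral>\<^sup>+ l. (\<integral>\<^sup>+ u. (measure_derivative (distr \<mu> borel (P l)) u)\<^sup>2 \<partial>lborel) \<partial>\<omega>) < ennreal C"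
begin

abbreviation restrict_to_ball :: "'a measure \<Rightarrow> 'a \<Rightarrow> real \<Rightarrow> 'a measure" where
  "restrict_to_ball \<mu> a r \<equiv> density \<mu> (indicator (cball a r))"

lemma unit_ball_energy:
  assumes \<nu>: "\<nu> \<in> compactly_supported_measures (cball 0 1)"
    and growth: "\<And>x r. r > 0 \<Longrightarrow> emeasure \<nu> (cball x r) \<le> ennreal (r powr s)"
  shows "AE l in \<omega>. absolutely_continuous lborel (distr \<nu> borel (P l))"
    and "(\<integral>\<^sup>+ l. (\<integral>\<^sup>+ u. (projected_density \<nu> l u)\<^sup>2 \<partial>lborel) \<partial>\<omega>) \<le> ennreal C"
proof -
  have fin: "finite_measure \<nu>" "sets \<nu> = sets borel"
    using \<nu> by (auto simp: compactly_supported_measures_def)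
  show AC: "AE l in \<omega>. absolutely_continuous lborel (distr \<nu> borel (P l))"
    using energy[OF \<nu> growth] by blast
  have "(\<integral>\<^sup>+ l. (\<integral>\<^sup>+ u. (projected_density \<nu> l u)\<^sup>2 \<partial>lborel) \<partial>\<omega>)
      = (\<integral>\<^sup>+ l. (\<integral>\<^sup>+ u. (measure_derivative (distr \<nu> borel (P l)) u)\<^sup>2 \<partial>lborel) \<partial>\<omega>)"
  proof (rule nn_integral_cong_AE, use AC AE_space in eventually_elim)
    case (elim l)
    then have l: "l \<in> \<Lambda>" by (simp add: space_\<omega>)
    show ?case
      unfolding projected_density_def
      by (rule nn_integral_cong_AE,
          use upper_derivative_ae(3)[OF finite_measure_projection[OF fin l] sets_distr elim(1)] in eventually_elim) simp
  qed
  then show "(\<integral>\<^sup>+ l. (\<integral>\<^sup>+ u. (projected_density \<nu> l u)\<^sup>2 \<partial>lborel) \<partial>\<omega>) \<le> ennreal C"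
    using energy[OF \<nu> growth] by (simp add: less_imp_le)
qed

text \<open>
  Translate and dilate the ball to the unit ball and divide by \<open>c * r powr s\<close>: the resulting measure
  has growth constant one, and the energy hypothesis for it transforms back by
  \<open>upper_derivative_affine_image\<close>. A ball of measure zero has to be treated apart, since the
  hypothesis is about non-zero measures.
\<close>

lemma local_energy:
  assumes fin: "finite_measure \<mu>" and sets: "sets \<mu> = sets borel" and c: "0 < c" and r: "0 < r"
    and growth: "\<And>x r. 0 < r \<Longrightarrow> emeasure \<mu> (cball x r) \<le> ennreal (c * r powr s)"
  shows "AE l in \<omega>. absolutely_continuous lborel (distr (restrict_to_ball \<mu> a r) borel (P l))"
    and "(\<integral>\<^sup>+ l. (\<integral>\<^sup>+ u. (projected_density (restrict_to_ball \<mu> a r) l u)\<^sup>2 \<partial>lborel) \<partial>\<omega>)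
       \<le> ennreal (C * c\<^sup>2 * r powr (2 * s - DIM('b)))"
proof -
  note [measurable_cong] = sets
  define \<mu>' where "\<mu>' = restrict_to_ball \<mu> a r"
  have sp: "space \<mu> = UNIV" using sets_eq_imp_space_eq[OF sets] by simp
  have sets': "sets \<mu>' = sets borel" by (simp add: \<mu>'_def sets)
  have em': "emeasure \<mu>' B = emeasure \<mu> (cball a r \<inter> B)" if "B \<in> sets borel" for B
    unfolding \<mu>'_def using that by (intro emeasure_restricted) (simp_all add: sets)
  have fin': "finite_measure \<mu>'"
    using finite_measure.emeasure_finite[OF fin] em'[of UNIV] sets_eq_imp_space_eq[OF sets']
    by (intro finite_measureI) simp
  have goal: "(AE l in \<omega>. absolutely_continuous lborel (distr \<mu>' borel (P l))) \<and>
     (\<integral>\<^sup>+ l. (\<integral>\<^sup>+ u. (projected_density \<mu>' l u)\<^sup>2 \<partial>lborel) \<partial>\<omega>) \<le> ennreal (C * c\<^sup>2 * r powr (2 * s - DIM('b)))"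
  proof (cases "emeasure \<mu>' UNIV = 0")
    case True
    then have z: "emeasure \<mu>' B = 0" for B using emeasure_mono[of B UNIV \<mu>'] sets' by simp
    have zp: "emeasure (distr \<mu>' borel (P l)) B = 0" for l B
      by (cases "P l \<in> \<mu>' \<rightarrow>\<^sub>M borel \<and> B \<in> sets borel")
         (auto simp: emeasure_distr z emeasure_notin_sets distr_def emeasure_measure_of_conv)
    have "projected_density \<mu>' l u = 0" for l u
      by (simp add: projected_density_def upper_derivative_def ball_ratio_def zp Limsup_const)
    moreover have "absolutely_continuous lborel (distr \<mu>' borel (P l))" for l
      by (auto simp: absolutely_continuous_def null_sets_def zp)
    ultimately show ?thesis by simp
  next
    case False
    define \<kappa> where "\<kappa> = 1 / (c * r powr s)"
    have \<kappa>: "0 < \<kappa>" using c r by (simp add: \<kappa>_def)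
    define T where "T = (\<lambda>y. (1 / r) *\<^sub>R (y - a))"
    have T[measurable]: "T \<in> borel \<rightarrow>\<^sub>M borel" unfolding T_def by measurable
    define \<nu> where "\<nu> = scale_measure (ennreal \<kappa>) (distr \<mu>' borel T)"
    have sets\<nu>: "sets \<nu> = sets borel" by (simp add: \<nu>_def)
    have em\<nu>: "emeasure \<nu> B = ennreal \<kappa> * emeasure \<mu>' {y. T y \<in> B}" if B: "B \<in> sets borel" for B
    proof -
      have "T \<in> \<mu>' \<rightarrow>\<^sub>M borel" using T by (simp add: measurable_cong_sets[OF sets' refl])
      then show ?thesis
        using B sets_eq_imp_space_eq[OF sets'] by (simp add: \<nu>_def emeasure_distr vimage_def)
    qed
    have Tball: "{y. T y \<in> cball z \<rho>} = cball (a + r *\<^sub>R z) (r * \<rho>)" for z \<rho>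
    proof -
      have "dist (a + r *\<^sub>R z) y = r * dist z (T y)" for y
      proof -
        have "a + r *\<^sub>R z - y = r *\<^sub>R (z - T y)"
          using r by (simp add: T_def algebra_simps)
        then show ?thesis using r by (simp add: dist_norm)
      qed
      then show ?thesis using r by auto
    qed
    have fin\<nu>: "finite_measure \<nu>"
      using em\<nu>[of UNIV] finite_measure.emeasure_finite[OF fin'] sets_eq_imp_space_eq[OF sets\<nu>]
      by (intro finite_measureI) (auto simp: ennreal_mult_eq_top_iff)
    have outside: "emeasure \<nu> (- cball 0 1) = 0"
    proof -
      have "emeasure \<nu> (- cball 0 1) = ennreal \<kappa> * emeasure \<mu>' {y. T y \<in> - cball 0 1}"
        by (rule em\<nu>) auto
      also have "{y. T y \<in> - cball 0 1} = - cball a r"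
        using Tball[of 0 1] by auto
      also have "emeasure \<mu>' (- cball a r) = 0"
        by (subst em') auto
      finally show ?thesis by simp
    qed
    have supp: "measure_support \<nu> \<subseteq> cball 0 1"
      using outside by (auto simp: measure_support_def)
    have "closed (measure_support \<nu>)" unfolding measure_support_def by (rule closed_Inter) auto
    then have "compact (measure_support \<nu>)"
      using supp compact_cball[of 0 1] by (metis compact_Int_closed inf.absorb_iff2)
    then have \<nu>: "\<nu> \<in> compactly_supported_measures (cball 0 1)"
      using False supp sets\<nu> fin\<nu> em\<nu>[of UNIV] \<kappa> by (simp add: compactly_supported_measures_def)
    have grow: "emeasure \<nu> (cball z \<rho>) \<le> ennreal (\<rho> powr s)" if \<rho>: "0 < \<rho>" for z \<rho>
    proof -
      have "emeasure \<nu> (cball z \<rho>) = ennreal \<kappa> * emeasure \<mu>' (cball (a + r *\<^sub>R z) (r * \<rho>))"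
        using em\<nu>[of "cball z \<rho>"] unfolding Tball by simp
      also have "\<dots> \<le> ennreal \<kappa> * emeasure \<mu> (cball (a + r *\<^sub>R z) (r * \<rho>))"
        by (intro mult_left_mono) (auto simp: em' sets intro!: emeasure_mono)
      also have "\<dots> \<le> ennreal \<kappa> * ennreal (c * (r * \<rho>) powr s)"
        by (intro mult_left_mono growth) (use r \<rho> in auto)
      also have "\<dots> = ennreal (\<rho> powr s)"
        using r c \<rho> by (simp add: \<kappa>_def ennreal_mult[symmetric] powr_mult)
      finally show ?thesis .
    qed
    define k where "k = c * r powr s"
    have k: "0 < k" "\<kappa> = 1 / k" using c r by (simp_all add: k_def \<kappa>_def)
    \<comment> \<open>By linearity the projections of \<open>\<nu>\<close> and \<open>\<mu>'\<close> are related by the affine map \<open>\<lambda>v. P l a + r *\<^sub>R v\<close>.\<close>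
    have scaled: "absolutely_continuous lborel (distr \<mu>' borel (P l)) \<and>
        (\<integral>\<^sup>+ u. (projected_density \<mu>' l u)\<^sup>2 \<partial>lborel)
          = ennreal (k\<^sup>2 / r ^ DIM('b)) * (\<integral>\<^sup>+ u. (projected_density \<nu> l u)\<^sup>2 \<partial>lborel)"
      if l: "l \<in> \<Lambda>" and ac: "absolutely_continuous lborel (distr \<nu> borel (P l))" for l
    proof -
      have image: "emeasure (distr \<mu>' borel (P l)) B
          = ennreal k * emeasure (distr \<nu> borel (P l)) {v. P l a + r *\<^sub>R v \<in> B}" if B: "B \<in> sets borel" for B
      proof -
        have 1: "{v. P l a + r *\<^sub>R v \<in> B} \<in> sets borel"
          using measurable_sets[of "\<lambda>v. P l a + r *\<^sub>R v" borel borel B] B by (simp add: vimage_def)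
        have 2: "{x. P l x \<in> {v. P l a + r *\<^sub>R v \<in> B}} \<in> sets borel"
          using measurable_sets[OF measurable_P_single[OF l] 1] by (simp add: vimage_def)
        have 3: "P l a + r *\<^sub>R P l (T y) = P l y" for y
        proof -
          interpret linear "P l" by (rule linear_P[OF l])
          show ?thesis using r by (simp add: T_def scale diff)
        qed
        have "emeasure (distr \<nu> borel (P l)) {v. P l a + r *\<^sub>R v \<in> B}
            = emeasure \<nu> {x. P l x \<in> {v. P l a + r *\<^sub>R v \<in> B}}"
          by (rule emeasure_projection[OF sets\<nu> l 1])
        also have "\<dots> = ennreal \<kappa> * emeasure \<mu>' {y. T y \<in> {x. P l x \<in> {v. P l a + r *\<^sub>R v \<in> B}}}"
          by (rule em\<nu>[OF 2])
        also have "\<dots> = ennreal \<kappa> * emeasure (distr \<mu>' borel (P l)) B"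
          by (simp add: 3 emeasure_projection[OF sets' l B])
        finally show ?thesis
          using k by (simp add: mult.assoc[symmetric] ennreal_mult[symmetric])
      qed
      note fins = finite_measure_projection[OF fin\<nu> sets\<nu> l] finite_measure_projection[OF fin' sets' l]
      show ?thesis
        unfolding projected_density_def
        using upper_derivative_affine_image[OF fins(1) sets_distr ac fins(2) sets_distr r k(1) image] by blast
    qed
    have E\<nu>: "AE l in \<omega>. absolutely_continuous lborel (distr \<nu> borel (P l))"
      "(\<integral>\<^sup>+ l. (\<integral>\<^sup>+ u. (projected_density \<nu> l u)\<^sup>2 \<partial>lborel) \<partial>\<omega>) \<le> ennreal C"
      by (rule unit_ball_energy[OF \<nu>], erule grow)+
    have 1: "AE l in \<omega>. absolutely_continuous lborel (distr \<mu>' borel (P l))"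
      using E\<nu>(1) AE_space by eventually_elim (use scaled in \<open>auto simp: space_\<omega>\<close>)
    have meas: "(\<lambda>l. \<integral>\<^sup>+ u. (projected_density \<nu> l u)\<^sup>2 \<partial>lborel) \<in> borel_measurable \<omega>"
      using measurable_projected_density[OF fin\<nu> sets\<nu>] by measurable
    have "(\<integral>\<^sup>+ l. (\<integral>\<^sup>+ u. (projected_density \<mu>' l u)\<^sup>2 \<partial>lborel) \<partial>\<omega>)
        = (\<integral>\<^sup>+ l. ennreal (k\<^sup>2 / r ^ DIM('b)) * (\<integral>\<^sup>+ u. (projected_density \<nu> l u)\<^sup>2 \<partial>lborel) \<partial>\<omega>)"
      by (rule nn_integral_cong_AE, use E\<nu>(1) AE_space in eventually_elim) (use scaled in \<open>auto simp: space_\<omega>\<close>)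
    also have "\<dots> = ennreal (k\<^sup>2 / r ^ DIM('b)) * (\<integral>\<^sup>+ l. (\<integral>\<^sup>+ u. (projected_density \<nu> l u)\<^sup>2 \<partial>lborel) \<partial>\<omega>)"
      by (rule nn_integral_cmult[OF meas])
    also have "\<dots> \<le> ennreal (k\<^sup>2 / r ^ DIM('b)) * ennreal C"
      by (rule mult_left_mono[OF E\<nu>(2)]) simp
    also have "\<dots> = ennreal (C * c\<^sup>2 * r powr (2 * s - DIM('b)))"
    proof -
      have "r powr (2 * s - DIM('b)) = (r powr s)\<^sup>2 / r ^ DIM('b)"
        using r by (simp add: powr_diff powr_realpow powr_powr[symmetric] mult.commute)
      then have "C * c\<^sup>2 * r powr (2 * s - DIM('b)) = k\<^sup>2 / r ^ DIM('b) * C"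
        by (simp add: k_def power_mult_distrib)
      moreover have "0 \<le> k\<^sup>2 / r ^ DIM('b)" using r by simp
      ultimately show ?thesis using C_pos by (simp add: ennreal_mult[symmetric])
    qed
    finally show ?thesis using 1 by blast
  qed
  then show "AE l in \<omega>. absolutely_continuous lborel (distr (restrict_to_ball \<mu> a r) borel (P l))"
    "(\<integral>\<^sup>+ l. (\<integral>\<^sup>+ u. (projected_density (restrict_to_ball \<mu> a r) l u)\<^sup>2 \<partial>lborel) \<partial>\<omega>)
       \<le> ennreal (C * c\<^sup>2 * r powr (2 * s - DIM('b)))"
    by (simp_all add: \<mu>'_def)
qed

end

section \<open>Nets and the lower bound for slices\<close>

lemma ennreal_limsup_add_le:
  fixes f g :: "nat \<Rightarrow> ennreal"
  shows "limsup (\<lambda>n. f n + g n) \<le> limsup f + limsup g"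
proof (cases "limsup f < top \<and> limsup g < top")
  case True
  show ?thesis
  proof (rule ennreal_le_epsilon)
    fix e :: real assume e: "0 < e"
    have less: "x < x + ennreal (e / 2)" if "x < top" for x
      using ennreal_add_left_cancel_less[of x 0 "ennreal (e / 2)"] that e by simp
    have "eventually (\<lambda>n. f n < limsup f + ennreal (e / 2)) sequentially"
      "eventually (\<lambda>n. g n < limsup g + ennreal (e / 2)) sequentially"
      using less True by (auto intro!: Limsup_lessD)
    then have "eventually (\<lambda>n. f n + g n \<le> (limsup f + ennreal (e / 2)) + (limsup g + ennreal (e / 2))) sequentially"
      by eventually_elim (intro add_mono less_imp_le)
    then have "limsup (\<lambda>n. f n + g n) \<le> (limsup f + ennreal (e / 2)) + (limsup g + ennreal (e / 2))"
      by (rule Limsup_bounded)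
    also have "\<dots> = limsup f + limsup g + (ennreal (e / 2) + ennreal (e / 2))"
      by (simp only: ac_simps)
    also have "ennreal (e / 2) + ennreal (e / 2) = ennreal e"
      using e by (simp add: ennreal_plus[symmetric] del: ennreal_plus)
    finally show "limsup (\<lambda>n. f n + g n) \<le> limsup f + limsup g + ennreal e" .
  qed
next
  case False
  then have "limsup f = top \<or> limsup g = top" by (simp add: less_top[symmetric])
  then have "limsup f + limsup g = top" by auto
  then show ?thesis by (simp only: top_greatest)
qed

lemma ennreal_limsup_sum_le:
  fixes f :: "'i \<Rightarrow> nat \<Rightarrow> ennreal"
  assumes "finite I"
  shows "limsup (\<lambda>n. \<Sum>i\<in>I. f i n) \<le> (\<Sum>i\<in>I. limsup (f i))"
  using assms
proof (induction I rule: finite_induct)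
  case (insert i I)
  then have "limsup (\<lambda>n. \<Sum>i\<in>insert i I. f i n) = limsup (\<lambda>n. f i n + (\<Sum>i\<in>I. f i n))" by simp
  also have "\<dots> \<le> limsup (f i) + limsup (\<lambda>n. \<Sum>i\<in>I. f i n)" by (rule ennreal_limsup_add_le)
  also have "\<dots> \<le> limsup (f i) + (\<Sum>i\<in>I. limsup (f i))" by (intro add_left_mono insert.IH)
  finally show ?case using insert by simp
qed (simp add: Limsup_const)

text \<open>
  Balls of half the radius about the points of a separated set are disjoint and each has mass at
  least a constant times \<open>d powr s\<close>, which bounds the cardinality; a separated set of maximal
  cardinality is a net.
\<close>

lemma exists_nets_of_lower_regular:
  fixes M :: "'a::euclidean_space measure" and K :: "'a set" and q s :: real
  assumes fin: "finite_measure M" and sets: "sets M = sets borel" and q: "0 < q"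
    and lower: "\<And>x r. x \<in> K \<Longrightarrow> 0 < r \<Longrightarrow> r \<le> 1 \<Longrightarrow> ennreal (q * r powr s) \<le> emeasure M (cball x r)"
  obtains X :: "nat \<Rightarrow> 'a set" and N where "\<And>j. finite (X j)"
    "\<And>j. K \<subseteq> (\<Union>x\<in>X j. cball x ((1/2) ^ j))" "0 \<le> N" "\<And>j. real (card (X j)) \<le> N * (2 ^ j) powr s"
proof -
  interpret finite_measure M by fact
  have sp: "space M = UNIV" using sets_eq_imp_space_eq[OF sets] by simp
  define T where "T = measure M UNIV"
  have T: "0 \<le> T" "emeasure M UNIV = ennreal T" by (simp_all add: T_def emeasure_eq_measure)
  have net: "\<exists>Y. finite Y \<and> K \<subseteq> (\<Union>x\<in>Y. cball x d) \<and> real (card Y) \<le> T / (q * (d / 2) powr s)"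
    if d: "0 < d" "d \<le> 1" for d
  proof -
    define Sep where "Sep = (\<lambda>Y. finite Y \<and> Y \<subseteq> K \<and> (\<forall>x\<in>Y. \<forall>y\<in>Y. x \<noteq> y \<longrightarrow> d < dist x y))"
    have bound: "real (card Y) \<le> T / (q * (d / 2) powr s)" if Y: "Sep Y" for Y
    proof -
      have finY: "finite Y" "Y \<subseteq> K" using Y by (auto simp: Sep_def)
      have "disjoint_family_on (\<lambda>y. cball y (d / 2)) Y"
        unfolding disjoint_family_on_def
      proof (intro ballI impI)
        fix x y assume xy: "x \<in> Y" "y \<in> Y" "x \<noteq> y"
        then have far: "d < dist x y" using Y by (auto simp: Sep_def)
        show "cball x (d / 2) \<inter> cball y (d / 2) = {}"
        proof (rule equals0I)
          fix z assume "z \<in> cball x (d / 2) \<inter> cball y (d / 2)"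
          then show False using far dist_triangle2[of x y z] by (auto simp: dist_commute)
        qed
      qed
      then have "(\<Sum>y\<in>Y. emeasure M (cball y (d / 2))) = emeasure M (\<Union>y\<in>Y. cball y (d / 2))"
        using finY by (intro sum_emeasure) (auto simp: sets)
      also have "\<dots> \<le> emeasure M UNIV" by (rule emeasure_mono) (auto simp: sets)
      finally have "(\<Sum>y\<in>Y. emeasure M (cball y (d / 2))) \<le> ennreal T" by (simp add: T)
      moreover have "(\<Sum>y\<in>Y. ennreal (q * (d / 2) powr s)) \<le> (\<Sum>y\<in>Y. emeasure M (cball y (d / 2)))"
        by (intro sum_mono lower) (use finY d in auto)
      ultimately have "(\<Sum>y\<in>Y. ennreal (q * (d / 2) powr s)) \<le> ennreal T" by (rule order_trans[rotated])
      then have "ennreal (real (card Y) * (q * (d / 2) powr s)) \<le> ennreal T"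
        using q by (simp add: ennreal_mult ennreal_of_nat_eq_real_of_nat)
      then have "real (card Y) * (q * (d / 2) powr s) \<le> T" using T by simp
      then show ?thesis using q d by (simp add: pos_le_divide_eq)
    qed
    obtain b :: nat where "T / (q * (d / 2) powr s) < real b"
      using reals_Archimedean2 by blast
    then have b: "card Y < b" if "Sep Y" for Y
      using bound[OF that] by linarith
    have "\<exists>Y. Sep Y \<and> (\<forall>Z. Sep Z \<longrightarrow> card Z \<le> card Y)"
      by (rule ex_has_greatest_nat[of Sep "{}" card b]) (use b in \<open>auto simp: Sep_def\<close>)
    then obtain Y where Y: "Sep Y" "\<And>Z. Sep Z \<Longrightarrow> card Z \<le> card Y" by blast
    have "K \<subseteq> (\<Union>x\<in>Y. cball x d)"
    proof
      fix x assume x: "x \<in> K"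
      show "x \<in> (\<Union>x\<in>Y. cball x d)"
      proof (rule ccontr)
        assume n: "x \<notin> (\<Union>x\<in>Y. cball x d)"
        then have far: "d < dist y x" if "y \<in> Y" for y using that by auto
        then have "x \<notin> Y" using d by force
        moreover have "Sep (insert x Y)"
          using Y(1) x far by (auto simp: Sep_def dist_commute)
        ultimately show False using Y(2)[of "insert x Y"] Y(1) by (simp add: Sep_def)
      qed
    qed
    then show ?thesis using Y(1) bound[OF Y(1)] by (auto simp: Sep_def)
  qed
  have "\<exists>Y. finite Y \<and> K \<subseteq> (\<Union>x\<in>Y. cball x ((1/2) ^ j)) \<and> real (card Y) \<le> T / (q * ((1/2) ^ j / 2) powr s)" for j :: nat
    by (rule net) (auto simp: power_le_one)
  then obtain X where X: "\<And>j::nat. finite (X j)" "\<And>j. K \<subseteq> (\<Union>x\<in>X j. cball x ((1/2) ^ j))"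
      "\<And>j. real (card (X j)) \<le> T / (q * ((1/2) ^ j / 2) powr s)" by metis
  show thesis
  proof (rule that[OF X(1,2)])
    show "0 \<le> T * 2 powr s / q" using T q by simp
    show "real (card (X j)) \<le> T * 2 powr s / q * (2 ^ j) powr s" for j
      using X(3)[of j] powr_mult[of 2 "2 ^ j" s] by (simp add: powr_divide power_one_over field_simps)
  qed
qed

text \<open>
  The error \<open>\<eta>\<close> is there for \<open>d = 0\<close>, to which no scale is comparable.
\<close>

lemma exists_comparable_scale:
  fixes d t \<eta> :: real
  assumes d: "0 \<le> d" "d \<le> 1" and t: "0 < t" and \<eta>: "0 < \<eta>"
  obtains j :: nat where "d \<le> (1/2) ^ j" "((1/2) ^ j) powr t \<le> 2 powr t * d powr t + \<eta>"
proof (cases "d = 0")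
  case True
  have "(1/2) powr t < (1::real)" using t powr_less_mono2[of t "1/2" 1] by simp
  then obtain j where "((1/2) powr t) ^ j < \<eta>"
    using real_arch_pow_inv[OF \<eta>] by blast
  moreover have "((1/2) powr t) ^ j = ((1/2) ^ j) powr t"
    by (simp add: powr_power powr_realpow[symmetric] powr_powr mult.commute)
  ultimately show ?thesis using True that[of j] by simp
next
  case False
  then have d0: "0 < d" using d by simp
  define j where "j = (LEAST n. (1/2) ^ Suc n < d)"
  obtain n where n: "(1/2::real) ^ n < d" using real_arch_pow_inv[OF d0, of "1/2"] by auto
  have "(1/2::real) ^ Suc n \<le> (1/2) ^ n" by simp
  then have ex: "\<exists>n. (1/2) ^ Suc n < d" using n by (intro exI[of _ n]) linarith
  have j: "(1/2) ^ Suc j < d" unfolding j_def by (rule LeastI_ex[OF ex])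
  have le: "d \<le> (1/2) ^ j"
  proof (cases j)
    case (Suc i)
    then have "\<not> (1/2) ^ Suc i < d" using not_less_Least[of i "\<lambda>n. (1/2) ^ Suc n < d"] by (simp add: j_def)
    then show ?thesis using Suc by simp
  qed (use d in simp)
  have "((1/2) ^ j) powr t \<le> (2 * d) powr t"
    using j t by (intro powr_mono2) auto
  then have "((1/2) ^ j) powr t \<le> 2 powr t * d powr t + \<eta>"
    using d \<eta> by (simp add: powr_mult)
  then show ?thesis using le that by blast
qed

text \<open>
  Used in place of the Cauchy-Schwarz inequality: summed over a family of balls with \<open>c\<close>
  proportional to the weight of each, it bounds a sum of densities by the sum of the weights plus
  a weighted energy.
\<close>

lemma ennreal_le_add_square_div:
  fixes h :: ennreal and c :: real
  assumes c: "0 < c"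
  shows "h \<le> ennreal c + h\<^sup>2 * ennreal (1 / c)"
proof (cases h)
  case (real x)
  have "x \<le> c + x\<^sup>2 * (1 / c)"
  proof (cases "x \<le> c")
    case False
    then have "x * c \<le> x * x" using real by (intro mult_left_mono) auto
    then have "x \<le> x\<^sup>2 * (1 / c)" using c by (simp add: field_simps power2_eq_square)
    then show ?thesis using c by linarith
  qed (use c in \<open>simp add: add_increasing2\<close>)
  then have "ennreal x \<le> ennreal (c + x\<^sup>2 * (1 / c))" by (rule ennreal_leI)
  also have "\<dots> = ennreal c + ennreal (x\<^sup>2) * ennreal (1 / c)"
    using c real by (simp add: ennreal_mult[symmetric])
  finally show ?thesis using real by (simp add: ennreal_power)
qed (use c in \<open>simp add: ennreal_top_mult\<close>)

context projection_family
begin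

text \<open>
  The balls have three times the net radius, so that a set of diameter at most the net radius
  that meets the covered set lies in the interior of one of them. Weighting by \<open>(2 ^ j) powr t\<close>
  makes this a discrete version of the \<open>t\<close>-energy of the slice over \<open>u\<close>.
\<close>

definition net_energy :: "real \<Rightarrow> 'a measure \<Rightarrow> (nat \<Rightarrow> 'a set) \<Rightarrow> 'l \<Rightarrow> 'b \<Rightarrow> ennreal" where
  "net_energy t \<mu> X l u = (\<Sum>j. \<Sum>x\<in>X j.
     (projected_density (density \<mu> (indicator (cball x (3 * (1/2) ^ j)))) l u)\<^sup>2 * ennreal ((2 ^ j) powr t))"

lemma measurable_net_energy:
  assumes "finite_measure \<mu>" "sets \<mu> = sets borel"
  shows "(\<lambda>(l, u). net_energy t \<mu> X l u) \<in> borel_measurable (\<omega> \<Otimes>\<^sub>M borel)"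
proof -
  have [measurable]: "(\<lambda>p. projected_density (density \<mu> (indicator (cball x r))) (fst p) (snd p))
      \<in> borel_measurable (\<omega> \<Otimes>\<^sub>M borel)" for x r
  proof -
    have "finite_measure (density \<mu> (indicator (cball x r)))"
      by (rule finite_measure.finite_measure_restricted[OF assms(1)]) (simp add: assms(2))
    then show ?thesis
      using measurable_projected_density[of "density \<mu> (indicator (cball x r))"] assms(2)
      by (simp add: case_prod_beta)
  qed
  show ?thesis unfolding net_energy_def case_prod_beta by measurable
qed

text \<open>
  If the slice is \<open>t\<close>-null it lies in finitely many net balls whose radii have small \<open>t\<close>-sum. By
  compactness the same balls cover the part of \<open>K\<close> that projects near \<open>u\<close>, so the density of
  the projected measure at \<open>u\<close> is at most the sum of the densities of the pieces in these balls,
  and the finite energy makes that sum small. The argument is pointwise: no exceptional set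
  depending on the cover arises.
\<close>

lemma density_zero_of_null_slice:
  assumes fin: "finite_measure \<mu>" and sets: "sets \<mu> = sets borel" and K: "compact K"
    and null: "emeasure \<mu> (- K) = 0" and l: "l \<in> \<Lambda>" and t: "0 < t"
    and X: "\<And>j. finite (X j)" "\<And>j. K \<subseteq> (\<Union>x\<in>X j. cball x ((1/2) ^ j))"
    and slice: "hausdorff_outer t (K \<inter> P l -` {u}) = 0"
    and finite_energy: "net_energy t \<mu> X l u < \<infinity>"
  shows "projected_density \<mu> l u = 0"
proof -
  interpret \<mu>: finite_measure \<mu> by fact
  have sp: "space \<mu> = UNIV" using sets_eq_imp_space_eq[OF sets] by simp
  define S where "S = K \<inter> P l -` {u}"
  define w where "w = (\<lambda>j::nat. ((1/2) ^ j) powr t)"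
  have w: "0 < w j" "(2 ^ j) powr t = 1 / w j" for j
    by (simp_all add: w_def power_one_over powr_divide)
  define h where "h = (\<lambda>(j::nat, x). projected_density (density \<mu> (indicator (cball x (3 * (1/2) ^ j)))) l u)"
  have energy: "net_energy t \<mu> X l u = (\<Sum>j. \<Sum>x\<in>X j. (h (j, x))\<^sup>2 * ennreal (1 / w j))"
    by (simp add: net_energy_def h_def w)
  obtain e0 where e0: "0 \<le> e0" "net_energy t \<mu> X l u = ennreal e0"
    using finite_energy by (cases "net_energy t \<mu> X l u") auto
  have "projected_density \<mu> l u \<le> 0 + ennreal \<epsilon>" if \<epsilon>: "0 < \<epsilon>" for \<epsilon> :: real
  proof -
    \<comment> \<open>\<open>\<kappa>\<close> makes the energy term at most \<open>\<epsilon> / 2\<close>; given \<open>\<kappa>\<close>, the size \<open>\<eta>\<close> of the cover does the same for the sum of the weights.\<close>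
    define \<kappa> where "\<kappa> = 2 * (e0 + 1) / \<epsilon>"
    have \<kappa>: "0 < \<kappa>" "e0 / \<kappa> \<le> \<epsilon> / 2" using e0 \<epsilon> by (auto simp: \<kappa>_def field_simps)
    define \<eta> where "\<eta> = \<epsilon> / (2 * \<kappa> * (2 powr t + 1))"
    define D where "D = 2 * \<kappa> * (2 powr t + 1)"
    have pos: "0 < D" using \<kappa> by (simp add: D_def add_pos_pos)
    have \<eta>: "0 < \<eta>" using \<epsilon> pos by (simp add: \<eta>_def D_def[symmetric])
    have \<eta>D: "\<eta> * D = \<epsilon>" using pos by (simp add: \<eta>_def D_def[symmetric])
    have \<eta>2: "\<kappa> * (2 powr t * \<eta> + \<eta>) = \<epsilon> / 2"
    proof -
      have "\<kappa> * (2 powr t * \<eta> + \<eta>) = \<eta> * D / 2" by (simp add: D_def algebra_simps)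
      also have "\<dots> = \<epsilon> / 2" by (simp add: \<eta>D)
      finally show ?thesis .
    qed
    have S0: "hausdorff_outer t S < \<infinity>" using slice by (simp add: S_def)
    obtain E where E: "S \<subseteq> (\<Union>i::nat. E i)" "\<And>i. closed (E i)" "\<And>i. bounded (E i)" "\<And>i. diameter (E i) \<le> 1"
        "(\<Sum>i. diam_pow t (E i)) \<le> hausdorff_outer t S + ennreal \<eta>"
      by (rule hausdorff_closed_cover[OF S0 zero_less_one \<eta>]) (rule that; assumption)
    \<comment> \<open>Each covering set that meets the slice is placed in a net ball of comparable size; a single point has no size, whence the summable errors \<open>\<eta> * (1/2) ^ Suc i\<close>.\<close>
    define I0 where "I0 = {i. E i \<inter> S \<noteq> {}}"
    have "\<forall>i\<in>I0. \<exists>p. snd p \<in> X (fst p) \<and> E i \<subseteq> ball (snd p) (3 * (1/2) ^ fst p) \<and>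
        w (fst p) \<le> 2 powr t * diameter (E i) powr t + \<eta> * (1/2) ^ Suc i"
    proof
      fix i assume "i \<in> I0"
      then obtain y where y: "y \<in> E i" "y \<in> S" by (auto simp: I0_def)
      have "0 < \<eta> * (1/2) ^ Suc i" using \<eta> by simp
      then obtain j where j: "diameter (E i) \<le> (1/2) ^ j" "w j \<le> 2 powr t * diameter (E i) powr t + \<eta> * (1/2) ^ Suc i"
        unfolding w_def by (rule exists_comparable_scale[OF diameter_ge_0[OF E(3)[of i]] E(4)[of i] t])
      have "y \<in> K" using y by (simp add: S_def)
      then obtain x where x: "x \<in> X j" "dist x y \<le> (1/2) ^ j" using X(2)[of j] by fastforce
      have "E i \<subseteq> ball x (3 * (1/2) ^ j)"
      proof
        fix z assume "z \<in> E i"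
        then have "dist y z \<le> (1/2) ^ j"
          using diameter_bounded_bound[OF E(3) y(1), of z] j(1) by linarith
        then have "dist x z \<le> 2 * (1/2) ^ j" using dist_triangle[of x z y] x(2) by linarith
        also have "\<dots> < 3 * (1/2) ^ j" by simp
        finally show "z \<in> ball x (3 * (1/2) ^ j)" by simp
      qed
      then show "\<exists>p. snd p \<in> X (fst p) \<and> E i \<subseteq> ball (snd p) (3 * (1/2) ^ fst p) \<and>
        w (fst p) \<le> 2 powr t * diameter (E i) powr t + \<eta> * (1/2) ^ Suc i"
        using x(1) j(2) by (intro exI[of _ "(j, x)"]) simp
    qed
    from bchoice[OF this] obtain p where p:
        "\<And>i. i \<in> I0 \<Longrightarrow> snd (p i) \<in> X (fst (p i))"
        "\<And>i. i \<in> I0 \<Longrightarrow> E i \<subseteq> ball (snd (p i)) (3 * (1/2) ^ fst (p i))"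
        "\<And>i. i \<in> I0 \<Longrightarrow> w (fst (p i)) \<le> 2 powr t * diameter (E i) powr t + \<eta> * (1/2) ^ Suc i" by blast
    let ?C = "\<lambda>q. cball (snd q) (3 * (1/2) ^ fst q)" and ?piece = "\<lambda>q. density \<mu> (indicator (cball (snd q) (3 * (1/2) ^ fst q)))"
    define B where "B = (\<lambda>q::nat \<times> 'a. ball (snd q) (3 * (1/2) ^ fst q))"
    have "closed (P l -` {u})"
      by (rule closed_vimage) (use continuous_P[OF l, of UNIV] in auto)
    then have compS: "compact S" unfolding S_def by (rule compact_Int_closed[OF K])
    have "S \<subseteq> (\<Union>i\<in>I0. B (p i))"
    proof
      fix y assume y: "y \<in> S"
      then obtain i where i: "y \<in> E i" using E(1) by blast
      then have "i \<in> I0" using y by (auto simp: I0_def)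
      then show "y \<in> (\<Union>i\<in>I0. B (p i))" using subsetD[OF p(2) i] unfolding B_def by blast
    qed
    then obtain I where I: "I \<subseteq> I0" "finite I" "S \<subseteq> (\<Union>i\<in>I. B (p i))"
      by (rule compactE_image[OF compS, of I0 "\<lambda>i. B (p i)", rotated]) (auto simp: B_def)
    \<comment> \<open>Different covering sets may share a net ball, so the sums run over the image.\<close>
    define Q where "Q = p ` I"
    have finQ: "finite Q" using I by (simp add: Q_def)
    define O' where "O' = (\<Union>q\<in>Q. B q)"
    have openO: "open O'" by (auto simp: O'_def B_def)
    have SO: "S \<subseteq> O'" using I by (auto simp: O'_def Q_def)
    have "compact (P l ` (K - O'))"
      by (intro compact_continuous_image continuous_P[OF l] compact_diff[OF K openO])
    then have "open (- P l ` (K - O'))" by (simp add: compact_imp_closed open_Compl)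
    moreover have "u \<in> - P l ` (K - O')" using SO by (auto simp: S_def)
    ultimately obtain d where d: "0 < d" "cball u d \<subseteq> - P l ` (K - O')"
      using open_contains_cball by blast
    have measV: "{x. P l x \<in> cball u \<delta>} \<in> sets borel" for \<delta>
      using measurable_sets[OF measurable_P_single[OF l], of "cball u \<delta>"] by (simp add: vimage_def)
    have ratio: "ball_ratio (distr \<mu> borel (P l)) u \<delta>
        \<le> (\<Sum>q\<in>Q. ball_ratio (distr (?piece q) borel (P l)) u \<delta>)"
      if \<delta>: "\<delta> \<le> d" for \<delta>
    proof -
      define V where "V = {x. P l x \<in> cball u \<delta>}"
      have V[measurable]: "V \<in> sets borel" using measV by (simp add: V_def)
      have "V \<subseteq> - K \<union> (\<Union>q\<in>Q. ?C q \<inter> V)"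
      proof
        fix x assume x: "x \<in> V"
        have "x \<in> O'" if "x \<in> K"
        proof (rule ccontr)
          assume "x \<notin> O'"
          then have "P l x \<in> P l ` (K - O')" using that by auto
          moreover have "P l x \<in> cball u d" using x \<delta> by (auto simp: V_def)
          ultimately show False using d(2) by blast
        qed
        then show "x \<in> - K \<union> (\<Union>q\<in>Q. ?C q \<inter> V)"
          using x by (auto simp: O'_def B_def dest: less_imp_le)
      qed
      moreover have mK: "- K \<in> sets \<mu>"
        using K by (simp add: sets compact_imp_closed borel_open open_Compl)
      moreover have mQ: "(\<Union>q\<in>Q. ?C q \<inter> V) \<in> sets \<mu>"
        by (intro sets.finite_UN finQ sets.Int) (simp_all add: sets V)
      ultimately have "emeasure \<mu> V \<le> emeasure \<mu> (- K \<union> (\<Union>q\<in>Q. ?C q \<inter> V))"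
        by (intro emeasure_mono sets.Un)
      also have "\<dots> \<le> emeasure \<mu> (- K) + emeasure \<mu> (\<Union>q\<in>Q. ?C q \<inter> V)"
        by (rule emeasure_subadditive[OF mK mQ])
      also have "\<dots> \<le> 0 + (\<Sum>q\<in>Q. emeasure \<mu> (?C q \<inter> V))"
        unfolding null by (intro add_left_mono emeasure_subadditive_finite finQ) (use V in \<open>auto simp: sets\<close>)
      finally have "emeasure \<mu> V \<le> (\<Sum>q\<in>Q. emeasure \<mu> (?C q \<inter> V))" by simp
      moreover have "emeasure (distr \<mu> borel (P l)) (cball u \<delta>) = emeasure \<mu> V"
        by (simp add: emeasure_projection[OF sets l] V_def)
      moreover have "emeasure (distr (density \<mu> (indicator (cball x r))) borel (P l)) (cball u \<delta>) = emeasure \<mu> (cball x r \<inter> V)" for x r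
        using emeasure_projection[of "density \<mu> (indicator (cball x r))" l "cball u \<delta>"] l sets V
        by (simp add: V_def emeasure_restricted)
      ultimately show ?thesis
        unfolding ball_ratio_def divide_ennreal_def sum_distrib_right[symmetric]
        by (intro mult_right_mono) simp_all
    qed
    have "projected_density \<mu> l u \<le> limsup (\<lambda>k. \<Sum>q\<in>Q. ball_ratio (distr (?piece q) borel (P l)) u (1 / Suc k))"
      unfolding projected_density_def upper_derivative_def
    proof (rule Limsup_mono)
      have "eventually (\<lambda>k. 1 / real (Suc k) < d) sequentially"
        using LIMSEQ_inverse_real_of_nat d(1) by (simp add: inverse_eq_divide order_tendstoD(2))
      then show "eventually (\<lambda>k. ball_ratio (distr \<mu> borel (P l)) u (1 / Suc k) \<le>
         (\<Sum>q\<in>Q. ball_ratio (distr (?piece q) borel (P l)) u (1 / Suc k))) sequentially"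
        by eventually_elim (rule ratio, simp)
    qed
    also have "\<dots> \<le> (\<Sum>q\<in>Q. h q)"
      by (rule order_trans[OF ennreal_limsup_sum_le[OF finQ]])
         (simp add: h_def projected_density_def upper_derivative_def case_prod_beta)
    also have "\<dots> \<le> (\<Sum>q\<in>Q. ennreal (\<kappa> * w (fst q)) + (h q)\<^sup>2 * ennreal (1 / (\<kappa> * w (fst q))))"
      by (intro sum_mono ennreal_le_add_square_div) (use \<kappa> w in simp)
    also have "\<dots> = (\<Sum>q\<in>Q. ennreal (\<kappa> * w (fst q))) + (\<Sum>q\<in>Q. (h q)\<^sup>2 * ennreal (1 / (\<kappa> * w (fst q))))"
      by (rule sum.distrib)
    also have "(\<Sum>q\<in>Q. ennreal (\<kappa> * w (fst q))) \<le> ennreal (\<epsilon> / 2)"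
    proof -
      have "(\<Sum>q\<in>Q. ennreal (\<kappa> * w (fst q))) \<le> (\<Sum>i\<in>I. ennreal (\<kappa> * w (fst (p i))))"
        using sum_image_le[of I "\<lambda>q. ennreal (\<kappa> * w (fst q))" p] I(2) by (simp add: Q_def comp_def)
      also have "\<dots> \<le> (\<Sum>i\<in>I. ennreal \<kappa> * (ennreal (2 powr t) * diam_pow t (E i) + ennreal (\<eta> * (1/2) ^ Suc i)))"
      proof (rule sum_mono)
        fix i assume i: "i \<in> I"
        then have iI0: "i \<in> I0" using I by auto
        then have ne: "E i \<noteq> {}" by (auto simp: I0_def)
        have "ennreal (\<kappa> * w (fst (p i))) \<le> ennreal (\<kappa> * (2 powr t * diameter (E i) powr t + \<eta> * (1/2) ^ Suc i))"
          using p(3)[OF iI0] \<kappa> by (intro ennreal_leI mult_left_mono) auto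
        also have "\<dots> = ennreal \<kappa> * (ennreal (2 powr t) * diam_pow t (E i) + ennreal (\<eta> * (1/2) ^ Suc i))"
          using \<kappa> \<eta> ne t by (simp add: diam_pow_def ennreal_mult)
        finally show "ennreal (\<kappa> * w (fst (p i))) \<le> \<dots>" .
      qed
      also have "\<dots> \<le> (\<Sum>i. ennreal \<kappa> * (ennreal (2 powr t) * diam_pow t (E i) + ennreal (\<eta> * (1/2) ^ Suc i)))"
        by (rule sum_le_suminf) (use I in auto)
      also have "\<dots> = ennreal \<kappa> * (ennreal (2 powr t) * (\<Sum>i. diam_pow t (E i)) + (\<Sum>i. ennreal (\<eta> * (1/2) ^ Suc i)))"
        by (simp add: suminf_add[symmetric])
      also have "(\<Sum>i. ennreal (\<eta> * (1/2) ^ Suc i)) = ennreal \<eta>"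
        using \<eta> sums_mult[OF power_half_series, of \<eta>] by (intro suminf_ennreal_eq) auto
      also have "ennreal \<kappa> * (ennreal (2 powr t) * (\<Sum>i. diam_pow t (E i)) + ennreal \<eta>)
          \<le> ennreal \<kappa> * (ennreal (2 powr t) * ennreal \<eta> + ennreal \<eta>)"
        using E(5) slice by (intro mult_left_mono add_right_mono) (auto simp: S_def)
      also have "\<dots> = ennreal (\<epsilon> / 2)"
        using \<eta> \<kappa> by (simp add: ennreal_mult[symmetric] ennreal_plus[symmetric] \<eta>2 del: ennreal_plus)
      finally show ?thesis .
    qed
    also have "(\<Sum>q\<in>Q. (h q)\<^sup>2 * ennreal (1 / (\<kappa> * w (fst q)))) \<le> ennreal (\<epsilon> / 2)"
    proof -
      obtain J where J: "\<And>q. q \<in> Q \<Longrightarrow> fst q < J"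
      proof
        fix q assume "q \<in> Q"
        then show "fst q < Suc (Max (fst ` Q))" using finQ by (simp add: less_Suc_eq_le)
      qed
      have QX: "Q \<subseteq> (SIGMA j:{..<J}. X j)"
      proof
        fix q assume q: "q \<in> Q"
        then have "snd q \<in> X (fst q)" using p(1) I by (auto simp: Q_def)
        then show "q \<in> (SIGMA j:{..<J}. X j)" using J[OF q] by (cases q) auto
      qed
      have "(\<Sum>q\<in>Q. (h q)\<^sup>2 * ennreal (1 / (\<kappa> * w (fst q)))) = (\<Sum>q\<in>Q. ennreal (1 / \<kappa>) * ((h q)\<^sup>2 * ennreal (1 / w (fst q))))"
      proof (rule sum.cong[OF refl])
        fix q assume "q \<in> Q"
        have "ennreal (1 / (\<kappa> * w (fst q))) = ennreal (1 / \<kappa>) * ennreal (1 / w (fst q))"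
          using \<kappa> w(1)[of "fst q"] by (simp add: ennreal_mult[symmetric])
        then show "(h q)\<^sup>2 * ennreal (1 / (\<kappa> * w (fst q))) = ennreal (1 / \<kappa>) * ((h q)\<^sup>2 * ennreal (1 / w (fst q)))"
          by (simp only: mult.left_commute)
      qed
      also have "\<dots> = ennreal (1 / \<kappa>) * (\<Sum>q\<in>Q. (h q)\<^sup>2 * ennreal (1 / w (fst q)))"
        by (simp add: sum_distrib_left)
      also have "(\<Sum>q\<in>Q. (h q)\<^sup>2 * ennreal (1 / w (fst q))) \<le> (\<Sum>q\<in>(SIGMA j:{..<J}. X j). (h q)\<^sup>2 * ennreal (1 / w (fst q)))"
        by (rule sum_mono2[OF _ QX]) (use X(1) in auto)
      also have "\<dots> = (\<Sum>j<J. \<Sum>x\<in>X j. (h (j, x))\<^sup>2 * ennreal (1 / w j))"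
        by (subst sum.Sigma) (use X(1) in \<open>auto simp: case_prod_beta\<close>)
      also have "\<dots> \<le> net_energy t \<mu> X l u"
        unfolding energy by (rule sum_le_suminf) auto
      also have "ennreal (1 / \<kappa>) * net_energy t \<mu> X l u = ennreal (e0 / \<kappa>)"
        using e0 \<kappa> by (simp add: ennreal_mult[symmetric])
      also have "\<dots> \<le> ennreal (\<epsilon> / 2)" using \<kappa> by (intro ennreal_leI)
      finally show ?thesis by (simp add: mult_left_mono)
    qed
    also have "ennreal (\<epsilon> / 2) + ennreal (\<epsilon> / 2) = 0 + ennreal \<epsilon>"
      using \<epsilon> by (simp add: ennreal_plus[symmetric] del: ennreal_plus)
    finally show ?thesis by (simp add: add_mono)
  qed
  then have "projected_density \<mu> l u \<le> 0" by (rule ennreal_le_epsilon)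
  then show ?thesis by simp
qed

end

section \<open>Almost every slice\<close>

context projection_family
begin

text \<open>
  A covering set of diameter \<open>d\<close> meets the slices over a set of measure at most a constant times
  \<open>d ^ m\<close>, so the \<open>(s - m)\<close>-sums of the induced covers of the slices have integral at most a constant
  times the \<open>s\<close>-sum of the cover. \<open>G\<close> is the lower limit of these sums over finer and finer
  covers, and Fatou's lemma bounds its integral. It is measurable in both variables because each
  covering set enters only through one of its points and its diameter.
\<close>

lemma slice_hausdorff_finite:
  assumes fin: "hausdorff_outer s A < \<infinity>" and s: "real DIM('b) < s"
  obtains G :: "'l \<times> 'b \<Rightarrow> ennreal" where "G \<in> borel_measurable (\<omega> \<Otimes>\<^sub>M borel)"
    "\<forall>l\<in>\<Lambda>. AE u in lborel. G (l, u) < \<infinity>"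
    "\<forall>l\<in>\<Lambda>. \<forall>u. G (l, u) < \<infinity> \<longrightarrow> hausdorff_outer (s - DIM('b)) (P l -` {u} \<inter> A) < \<infinity>"
proof -
  define \<tau> where "\<tau> = s - DIM('b)"
  have \<tau>: "0 < \<tau>" using s by (simp add: \<tau>_def)
  let ?cover = "\<lambda>n E. A \<subseteq> (\<Union>i::nat. E i) \<and> (\<forall>i. closed (E i)) \<and> (\<forall>i. bounded (E i) \<and> diameter (E i) \<le> 1 / Suc n) \<and>
      (\<Sum>i. diam_pow s (E i)) \<le> hausdorff_outer s A + ennreal 1"
  have "\<exists>E. ?cover n E" for n
  proof -
    have p: "0 < 1 / real (Suc n)" by simp
    show ?thesis
      by (rule hausdorff_closed_cover[OF fin p zero_less_one]) (intro exI conjI allI; assumption)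
  qed
  from choice[OF allI, OF this] obtain E where "\<forall>n. ?cover n (E n)" ..
  then have E: "\<And>n. A \<subseteq> (\<Union>i::nat. E n i)" "\<And>n i. bounded (E n i)" "\<And>n i. diameter (E n i) \<le> 1 / Suc n"
      "\<And>n. (\<Sum>i. diam_pow s (E n i)) \<le> hausdorff_outer s A + ennreal 1"
    by simp_all
  define d where "d = (\<lambda>n i. diameter (E n i))"
  have dd: "diameter (E n i) = d n i" for n i by (simp add: d_def)
  have d: "0 \<le> d n i" for n i unfolding d_def by (rule diameter_ge_0[OF E(2)])
  \<comment> \<open>An empty covering set gets an arbitrary point, but contributes zero to the sum.\<close>
  define a where "a = (\<lambda>n i. SOME x. x \<in> E n i)"
  define g where "g = (\<lambda>n i (p::'l \<times> 'b). diam_pow \<tau> (E n i) * indicator {p. dist (P (fst p) (a n i)) (snd p) \<le> d n i} p)"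
  define G where "G = (\<lambda>p. liminf (\<lambda>n. \<Sum>i. g n i p))"
  note [measurable] = measurable_P_parameter
  have g_meas[measurable]: "g n i \<in> borel_measurable (\<omega> \<Otimes>\<^sub>M borel)" for n i
  proof -
    have "(\<lambda>p. if dist (P (fst p) (a n i)) (snd p) \<le> d n i then diam_pow \<tau> (E n i) else 0) \<in> borel_measurable (\<omega> \<Otimes>\<^sub>M borel)"
      by measurable
    then show ?thesis unfolding g_def
      by (rule measurable_cong[THEN iffD1, rotated]) (simp add: indicator_def)
  qed
  show thesis
  proof (rule that[of G]; (intro ballI allI impI)?)
    show "G \<in> borel_measurable (\<omega> \<Otimes>\<^sub>M borel)" unfolding G_def by measurable
  next
    fix l assume l: "l \<in> \<Lambda>"
    then have lsp: "l \<in> space \<omega>" by (simp add: space_\<omega>)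
    have gl[measurable]: "(\<lambda>u. g n i (l, u)) \<in> borel_measurable borel" for n i
      using measurable_compose[OF measurable_Pair1'[OF lsp] g_meas] .
    define \<alpha> where "\<alpha> = unit_ball_vol (real DIM('b))"
    have \<alpha>: "0 \<le> \<alpha>" by (simp add: \<alpha>_def)
    have one: "(\<integral>\<^sup>+u. g n i (l, u) \<partial>lborel) \<le> ennreal \<alpha> * diam_pow s (E n i)" for n i
    proof -
      have "(\<integral>\<^sup>+u. g n i (l, u) \<partial>lborel) = (\<integral>\<^sup>+u. diam_pow \<tau> (E n i) * indicator (cball (P l (a n i)) (d n i)) u \<partial>lborel)"
        by (intro nn_integral_cong) (simp add: g_def indicator_def)
      also have "\<dots> = diam_pow \<tau> (E n i) * emeasure lborel (cball (P l (a n i)) (d n i))"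
        by (rule nn_integral_cmult_indicator) simp
      also have "\<dots> = diam_pow \<tau> (E n i) * ennreal (\<alpha> * d n i ^ DIM('b))"
        by (simp add: emeasure_cball[OF d] \<alpha>_def)
      also have "\<dots> \<le> ennreal \<alpha> * diam_pow s (E n i)"
      proof (cases "E n i = {} \<or> d n i = 0")
        case False
        then have d0: "0 < d n i" using d[of n i] by simp
        have "d n i powr s = d n i powr \<tau> * d n i ^ DIM('b)"
          using d0 by (simp add: \<tau>_def powr_diff powr_realpow)
        then show ?thesis
          using False \<tau> s \<alpha> d0 by (simp add: diam_pow_def dd ennreal_mult[symmetric] ac_simps)
      qed (use \<tau> in \<open>auto simp: diam_pow_def dd\<close>)
      finally show ?thesis .
    qed
    define T where "T = ennreal \<alpha> * (hausdorff_outer s A + ennreal 1)"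
    have T: "T < \<infinity>" using fin by (simp add: T_def ennreal_mult_less_top)
    have sum: "(\<integral>\<^sup>+u. (\<Sum>i. g n i (l, u)) \<partial>lborel) \<le> T" for n
    proof -
      have "(\<integral>\<^sup>+u. (\<Sum>i. g n i (l, u)) \<partial>lborel) = (\<Sum>i. \<integral>\<^sup>+u. g n i (l, u) \<partial>lborel)"
        by (rule nn_integral_suminf) simp
      also have "\<dots> \<le> (\<Sum>i. ennreal \<alpha> * diam_pow s (E n i))" by (intro suminf_le one) auto
      also have "\<dots> = ennreal \<alpha> * (\<Sum>i. diam_pow s (E n i))" by simp
      also have "\<dots> \<le> T" unfolding T_def by (intro mult_left_mono E) simp
      finally show ?thesis .
    qed
    have "(\<integral>\<^sup>+u. G (l, u) \<partial>lborel) \<le> liminf (\<lambda>n. \<integral>\<^sup>+u. (\<Sum>i. g n i (l, u)) \<partial>lborel)"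
      unfolding G_def by (rule nn_integral_liminf) measurable
    also have "\<dots> \<le> liminf (\<lambda>n. T)" by (intro Liminf_mono always_eventually allI sum)
    also have "\<dots> = T" by (simp add: Liminf_const)
    finally have "(\<integral>\<^sup>+u. G (l, u) \<partial>lborel) \<noteq> \<infinity>" using T by auto
    moreover have "(\<lambda>u. G (l, u)) \<in> borel_measurable lborel" unfolding G_def by measurable
    ultimately have "AE u in lborel. G (l, u) \<noteq> \<infinity>" by (intro nn_integral_PInf_AE)
    then show "AE u in lborel. G (l, u) < \<infinity>" by (simp add: less_top)
  next
    fix l u assume l: "l \<in> \<Lambda>" and finG: "G (l, u) < \<infinity>"
    define S where "S = P l -` {u} \<inter> A"
    have le: "hausdorff_content (1 / Suc n) \<tau> S \<le> (\<Sum>i. g n i (l, u))" for n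
    proof -
      define R where "R = (\<lambda>i. if E n i \<inter> S = {} then {} else E n i)"
      have "hausdorff_content (1 / Suc n) \<tau> S \<le> (\<Sum>i. diam_pow \<tau> (R i))"
        unfolding hausdorff_content_def
      proof (intro INF_lower CollectI conjI allI)
        show "S \<subseteq> (\<Union>i. R i)"
        proof
          fix x assume x: "x \<in> S"
          then obtain i where "x \<in> E n i" using E(1)[of n] by (auto simp: S_def)
          then have "x \<in> R i" using x by (auto simp: R_def)
          then show "x \<in> (\<Union>i. R i)" by blast
        qed
        show "bounded (R i)" "diameter (R i) \<le> 1 / real (Suc n)" for i
          using E(2)[of n i] E(3)[of n i] by (simp_all add: R_def)
      qed
      also have "\<dots> \<le> (\<Sum>i. g n i (l, u))"
      proof (intro suminf_le)
        fix i show "diam_pow \<tau> (R i) \<le> g n i (l, u)"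
        proof (cases "E n i \<inter> S = {}")
          case False
          then obtain x where x: "x \<in> E n i" "P l x = u" by (auto simp: S_def)
          then have "a n i \<in> E n i" unfolding a_def by (metis someI)
          then have "dist (a n i) x \<le> d n i"
            unfolding d_def using x(1) by (intro diameter_bounded_bound[OF E(2)])
          then have "dist (P l (a n i)) u \<le> d n i" using dist_P_le[OF l, of "a n i" x] x(2) by simp
          then show ?thesis by (simp add: R_def g_def)
        qed (simp add: R_def)
      qed auto
      finally show ?thesis .
    qed
    have "hausdorff_outer \<tau> S = liminf (\<lambda>n. hausdorff_content (1 / Suc n) \<tau> S)"
      by (rule lim_imp_Liminf[symmetric, OF _ hausdorff_content_tendsto_outer]) simp
    also have "\<dots> \<le> G (l, u)"
      unfolding G_def by (intro Liminf_mono always_eventually allI le)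
    finally show "hausdorff_outer (s - DIM('b)) (P l -` {u} \<inter> A) < \<infinity>"
      using finG by (auto simp: \<tau>_def S_def)
  qed
qed

end

context projection_energy
begin

text \<open>
  Level \<open>j\<close> contributes at most \<open>N * 2 powr (j * s)\<close> balls, each with energy of order
  \<open>2 powr (- j * (2 * s - m))\<close> and weight \<open>2 powr (j * t)\<close>; the resulting series is geometric with
  ratio \<open>2 powr (t - (s - m)) < 1\<close>.
\<close>

lemma net_energy_ae_finite:
  assumes fin: "finite_measure \<mu>" and sets: "sets \<mu> = sets borel" and c: "0 < c"
    and growth: "\<And>x r. 0 < r \<Longrightarrow> emeasure \<mu> (cball x r) \<le> ennreal (c * r powr s)"
    and X: "\<And>j. finite (X j)" "0 \<le> N" "\<And>j. real (card (X j)) \<le> N * (2 ^ j) powr s"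
    and t: "t < s - DIM('b)"
  shows "AE l in \<omega>. AE u in lborel. net_energy t \<mu> X l u < \<infinity>"
proof -
  interpret pair_sigma_finite \<omega> "lborel :: 'b measure"
    by (intro pair_sigma_finite.intro \<omega>.sigma_finite_measure_axioms sigma_finite_lborel)
  have swap: "borel_measurable (\<omega> \<Otimes>\<^sub>M borel) = borel_measurable (\<omega> \<Otimes>\<^sub>M (lborel :: 'b measure))"
    by (intro measurable_cong_sets sets_pair_measure_cong) simp_all
  define m where "m = real DIM('b)"
  define f where "f = (\<lambda>j x (p :: 'l \<times> 'b). (projected_density (restrict_to_ball \<mu> x (3 * (1/2) ^ j)) (fst p) (snd p))\<^sup>2)"
  have finr: "finite_measure (restrict_to_ball \<mu> x r)" for x r
    by (rule finite_measure.finite_measure_restricted[OF fin]) (simp add: sets)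
  have f[measurable]: "f j x \<in> borel_measurable (\<omega> \<Otimes>\<^sub>M (lborel :: 'b measure))" for j x
  proof -
    have "(\<lambda>p. projected_density (restrict_to_ball \<mu> x (3 * (1/2) ^ j)) (fst p) (snd p)) \<in> borel_measurable (\<omega> \<Otimes>\<^sub>M (lborel :: 'b measure))"
      using measurable_projected_density[OF finr, of x "3 * (1/2) ^ j"] sets unfolding swap by (simp add: case_prod_beta)
    then show ?thesis unfolding f_def by measurable
  qed
  define D where "D = N * (C * c\<^sup>2 * 3 powr (2 * s - m))"
  have D: "0 \<le> D" using X(2) C_pos by (simp add: D_def)
  have int: "(\<integral>\<^sup>+p. f j x p \<partial>(\<omega> \<Otimes>\<^sub>M lborel)) \<le> ennreal (C * c\<^sup>2 * (3 * (1/2) ^ j) powr (2 * s - m))" for j x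
  proof -
    have "(\<integral>\<^sup>+p. f j x p \<partial>(\<omega> \<Otimes>\<^sub>M lborel))
        = (\<integral>\<^sup>+ l. (\<integral>\<^sup>+ u. (projected_density (restrict_to_ball \<mu> x (3 * (1/2) ^ j)) l u)\<^sup>2 \<partial>lborel) \<partial>\<omega>)"
      using lborel.nn_integral_fst[OF f, of j x] by (simp add: f_def)
    also have "\<dots> \<le> ennreal (C * c\<^sup>2 * (3 * (1/2) ^ j) powr (2 * s - m))"
      unfolding m_def by (rule local_energy(2)[OF fin sets c _ growth]) simp_all
    finally show ?thesis .
  qed
  have level_bound: "(\<Sum>x\<in>X j. (\<integral>\<^sup>+p. f j x p \<partial>(\<omega> \<Otimes>\<^sub>M lborel)) * ennreal ((2 ^ j) powr t)) \<le> ennreal (D * (2 powr (t - (s - m))) ^ j)" for j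
  proof -
    have "(\<Sum>x\<in>X j. (\<integral>\<^sup>+p. f j x p \<partial>(\<omega> \<Otimes>\<^sub>M lborel)) * ennreal ((2 ^ j) powr t))
        \<le> (\<Sum>x\<in>X j. ennreal (C * c\<^sup>2 * (3 * (1/2) ^ j) powr (2 * s - m)) * ennreal ((2 ^ j) powr t))"
      by (intro sum_mono mult_right_mono int) simp
    also have "\<dots> = ennreal (real (card (X j)) * (C * c\<^sup>2 * (3 * (1/2) ^ j) powr (2 * s - m) * (2 ^ j) powr t))"
      using C_pos by (simp add: ennreal_mult ennreal_of_nat_eq_real_of_nat)
    also have "\<dots> \<le> ennreal (N * (2 ^ j) powr s * (C * c\<^sup>2 * (3 * (1/2) ^ j) powr (2 * s - m) * (2 ^ j) powr t))"
      using X(3)[of j] C_pos by (intro ennreal_leI mult_right_mono) auto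
    also have "N * (2 ^ j) powr s * (C * c\<^sup>2 * (3 * (1/2) ^ j) powr (2 * s - m) * (2 ^ j) powr t) = D * (2 powr (t - (s - m))) ^ j"
    proof -
      have p: "(2 ^ j) powr y = 2 powr (real j * y)" for y :: real
      proof -
        have "(2 ^ j :: real) = 2 powr real j" by (simp add: powr_realpow)
        then show ?thesis by (simp only: powr_powr)
      qed
      have h: "(1/2::real) ^ j = 2 powr (- real j)"
        by (simp add: powr_minus powr_realpow power_divide inverse_eq_divide)
      have h2: "(3 * (1/2) ^ j) powr (2 * s - m) = 3 powr (2 * s - m) * 2 powr (- real j * (2 * s - m))"
        unfolding h by (simp add: powr_mult powr_powr)
      have g: "(2 powr (t - (s - m))) ^ j = 2 powr (real j * s) * 2 powr (- real j * (2 * s - m)) * 2 powr (real j * t)"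
      proof -
        have "(2 powr (t - (s - m))) ^ j = 2 powr ((t - (s - m)) * real j)" by (simp add: powr_power mult.commute)
        also have "(t - (s - m)) * real j = real j * s + - real j * (2 * s - m) + real j * t" by (simp add: algebra_simps)
        finally show ?thesis by (simp only: powr_add)
      qed
      show ?thesis unfolding p h2 g D_def by (simp only: ac_simps)
    qed
    finally show ?thesis .
  qed
  have ratio: "norm (2 powr (t - (s - m)) :: real) < 1"
    using t powr_less_mono[of "t - (s - m)" 0 2] by (simp add: m_def)
  have "(\<integral>\<^sup>+p. net_energy t \<mu> X (fst p) (snd p) \<partial>(\<omega> \<Otimes>\<^sub>M lborel))
      = (\<integral>\<^sup>+p. (\<Sum>j. \<Sum>x\<in>X j. f j x p * ennreal ((2 ^ j) powr t)) \<partial>(\<omega> \<Otimes>\<^sub>M lborel))"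
    by (simp add: net_energy_def f_def)
  also have "\<dots> = (\<Sum>j. \<integral>\<^sup>+p. (\<Sum>x\<in>X j. f j x p * ennreal ((2 ^ j) powr t)) \<partial>(\<omega> \<Otimes>\<^sub>M lborel))"
    by (rule nn_integral_suminf) measurable
  also have "\<dots> = (\<Sum>j. \<Sum>x\<in>X j. (\<integral>\<^sup>+p. f j x p \<partial>(\<omega> \<Otimes>\<^sub>M lborel)) * ennreal ((2 ^ j) powr t))"
    by (simp add: nn_integral_sum nn_integral_multc)
  also have "\<dots> \<le> (\<Sum>j. ennreal (D * (2 powr (t - (s - m))) ^ j))"
    by (intro suminf_le level_bound) auto
  also have "\<dots> < \<infinity>"
  proof -
    have "summable (\<lambda>j. D * (2 powr (t - (s - m))) ^ j)"
      by (intro summable_mult summable_geometric ratio)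
    then show ?thesis using D by (subst suminf_ennreal2) auto
  qed
  finally have "(\<integral>\<^sup>+p. net_energy t \<mu> X (fst p) (snd p) \<partial>(\<omega> \<Otimes>\<^sub>M lborel)) \<noteq> \<infinity>" by simp
  moreover have "(\<lambda>p. net_energy t \<mu> X (fst p) (snd p)) \<in> borel_measurable (\<omega> \<Otimes>\<^sub>M (lborel :: 'b measure))"
    using measurable_net_energy[OF fin sets] unfolding swap by (simp add: case_prod_beta)
  ultimately have "AE p in \<omega> \<Otimes>\<^sub>M (lborel :: 'b measure). net_energy t \<mu> X (fst p) (snd p) \<noteq> \<infinity>"
    by (intro nn_integral_PInf_AE)
  from AE_pair[OF this] show ?thesis by (simp add: less_top)
qed

lemma projections_absolutely_continuous:
  assumes fin: "finite_measure \<mu>" and sets: "sets \<mu> = sets borel" and c: "0 < c"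
    and growth: "\<And>x r. 0 < r \<Longrightarrow> emeasure \<mu> (cball x r) \<le> ennreal (c * r powr s)"
    and K: "compact K" and null: "emeasure \<mu> (- K) = 0"
  shows "AE l in \<omega>. absolutely_continuous lborel (distr \<mu> borel (P l))"
proof -
  obtain R where R: "0 < R" "K \<subseteq> cball 0 R"
    using bounded_subset_ballD[OF compact_imp_bounded[OF K], of 0] ball_subset_cball by blast
  have "restrict_to_ball \<mu> 0 R = \<mu>"
  proof (rule measure_eqI)
    fix B assume "B \<in> sets (restrict_to_ball \<mu> 0 R)"
    then have B: "B \<in> sets \<mu>" by simp
    have nullK: "- K \<in> null_sets \<mu>"
      using null K by (simp add: null_sets_def sets compact_imp_closed borel_open open_Compl)
    have "emeasure (restrict_to_ball \<mu> 0 R) B = emeasure \<mu> (cball 0 R \<inter> B)"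
      by (rule emeasure_restricted) (use B in \<open>simp_all add: sets\<close>)
    also have "\<dots> = emeasure \<mu> B"
      by (rule emeasure_eq_AE, use AE_not_in[OF nullK] in eventually_elim)
         (use R B in \<open>auto simp: sets\<close>)
    finally show "emeasure (restrict_to_ball \<mu> 0 R) B = emeasure \<mu> B" .
  qed simp
  then show ?thesis using local_energy(1)[OF fin sets c R(1) growth, of 0] by simp
qed

text \<open>
  \<open>Z\<close> collects the pairs at which the density is positive and all energies for a sequence of
  exponents increasing to \<open>s - m\<close>, as well as the bound for the upper estimate, are finite. There
  the dimension is \<open>s - m\<close>. Almost every projection of \<open>\<mu>\<close> has its density as Radon-Nikodym
  derivative, and therefore gives full measure to the sections of \<open>Z\<close>. Having one measurable set
  for all parameters is what makes Fubini's theorem applicable later.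
\<close>

lemma slices_of_compact_piece:
  assumes fin: "finite_measure \<mu>" and sets: "sets \<mu> = sets borel" and c: "0 < c"
    and growth: "\<And>x r. 0 < r \<Longrightarrow> emeasure \<mu> (cball x r) \<le> ennreal (c * r powr s)"
    and K: "compact K" and null: "emeasure \<mu> (- K) = 0" and KA: "K \<subseteq> A" and finA: "hausdorff_outer s A < \<infinity>"
    and X: "\<And>j. finite (X j)" "\<And>j. K \<subseteq> (\<Union>x\<in>X j. cball x ((1/2) ^ j))"
      "0 \<le> N" "\<And>j. real (card (X j)) \<le> N * (2 ^ j) powr s"
  obtains Z where "Z \<in> sets (\<omega> \<Otimes>\<^sub>M (borel :: 'b measure))"
    "\<And>l u. (l, u) \<in> Z \<Longrightarrow> hausdorff_dim (P l -` {u} \<inter> A) = ereal (s - DIM('b))"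
    "AE l in \<omega>. AE x in \<mu>. (l, P l x) \<in> Z"
    "0 < emeasure \<mu> UNIV \<Longrightarrow> AE l in \<omega>. 0 < emeasure lborel {u. (l, u) \<in> Z}"
proof -
  define \<tau> where "\<tau> = s - DIM('b)"
  have \<tau>: "0 < \<tau>" using s_gt by (simp add: \<tau>_def)
  define t where "t = (\<lambda>n::nat. \<tau> - \<tau> / real (n + 2))"
  have t: "0 < t n" "t n < \<tau>" for n using \<tau> by (simp_all add: t_def field_simps add_pos_nonneg)
  obtain G :: "'l \<times> 'b \<Rightarrow> ennreal" where G: "G \<in> borel_measurable (\<omega> \<Otimes>\<^sub>M (borel :: 'b measure))"
    "\<forall>l\<in>\<Lambda>. AE u in lborel. G (l, u) < \<infinity>"
    "\<forall>l\<in>\<Lambda>. \<forall>u. G (l, u) < \<infinity> \<longrightarrow> hausdorff_outer \<tau> (P l -` {u} \<inter> A) < \<infinity>"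
    by (rule slice_hausdorff_finite[OF finA s_gt, folded \<tau>_def]) (rule that; assumption)
  define Z where "Z = {p \<in> space (\<omega> \<Otimes>\<^sub>M (borel :: 'b measure)). projected_density \<mu> (fst p) (snd p) \<noteq> 0 \<and>
     (\<forall>n. net_energy (t n) \<mu> X (fst p) (snd p) < \<infinity>) \<and> G p < \<infinity>}"
  have [measurable]: "(\<lambda>p. projected_density \<mu> (fst p) (snd p)) \<in> borel_measurable (\<omega> \<Otimes>\<^sub>M (borel :: 'b measure))"
    "(\<lambda>p. net_energy (t n) \<mu> X (fst p) (snd p)) \<in> borel_measurable (\<omega> \<Otimes>\<^sub>M (borel :: 'b measure))" for n
    using measurable_projected_density[OF fin sets] measurable_net_energy[OF fin sets] by (simp_all add: case_prod_beta)
  note [measurable] = G(1)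
  have Z: "Z \<in> sets (\<omega> \<Otimes>\<^sub>M (borel :: 'b measure))" unfolding Z_def by measurable
  have mem: "(l, u) \<in> Z \<longleftrightarrow> l \<in> \<Lambda> \<and> projected_density \<mu> l u \<noteq> 0 \<and> (\<forall>n. net_energy (t n) \<mu> X l u < \<infinity>) \<and> G (l, u) < \<infinity>" for l u
    by (auto simp: Z_def space_pair_measure space_\<omega>)
  have dim: "hausdorff_dim (P l -` {u} \<inter> A) = ereal (s - DIM('b))" if "(l, u) \<in> Z" for l u
  proof (rule antisym)
    have l: "l \<in> \<Lambda>" and D: "projected_density \<mu> l u \<noteq> 0" "\<And>n. net_energy (t n) \<mu> X l u < \<infinity>" "G (l, u) < \<infinity>"
      using that by (auto simp: mem)
    show "hausdorff_dim (P l -` {u} \<inter> A) \<le> ereal (s - DIM('b))"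
      unfolding \<tau>_def[symmetric] by (rule hausdorff_dim_le[OF \<tau>]) (use G(3) l D(3) in blast)
    have "ereal \<tau> \<le> hausdorff_dim (K \<inter> P l -` {u})"
    proof (rule le_hausdorff_dim[OF _ \<tau>])
      fix t' assume t': "0 < t'" "t' < \<tau>"
      obtain n where n: "\<tau> / (\<tau> - t') < real n" using reals_Archimedean2 by blast
      then have "\<tau> < real n * (\<tau> - t')" using t' by (simp add: pos_divide_less_eq)
      also have "\<dots> \<le> real (n + 2) * (\<tau> - t')" using t' by (intro mult_right_mono) auto
      finally have "\<tau> / real (n + 2) < \<tau> - t'" by (simp add: pos_divide_less_eq mult.commute)
      then have "t' \<le> t n" by (simp add: t_def)
      moreover have "hausdorff_outer (t n) (K \<inter> P l -` {u}) \<noteq> 0"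
        using density_zero_of_null_slice[OF fin sets K null l t(1) X(1,2) _ D(2)] D(1) by blast
      ultimately show "\<exists>t''. t' \<le> t'' \<and> hausdorff_outer t'' (K \<inter> P l -` {u}) \<noteq> 0" by blast
    qed
    also have "\<dots> \<le> hausdorff_dim (P l -` {u} \<inter> A)"
      by (rule hausdorff_dim_mono) (use KA in auto)
    finally show "ereal (s - DIM('b)) \<le> hausdorff_dim (P l -` {u} \<inter> A)" by (simp add: \<tau>_def)
  qed
  have AC: "AE l in \<omega>. absolutely_continuous lborel (distr \<mu> borel (P l))"
    by (rule projections_absolutely_continuous[OF fin sets c growth K null])
  have "\<forall>n. AE l in \<omega>. AE u in lborel. net_energy (t n) \<mu> X l u < \<infinity>"
    using net_energy_ae_finite[OF fin sets c growth X(1,3,4)] t(2) unfolding \<tau>_def by blast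
  then have NE: "AE l in \<omega>. \<forall>n. AE u in lborel. net_energy (t n) \<mu> X l u < \<infinity>"
    by (simp add: AE_all_countable)
  have main: "AE l in \<omega>. l \<in> \<Lambda> \<and> absolutely_continuous lborel (distr \<mu> borel (P l)) \<and>
      (AE u in distr \<mu> borel (P l). (l, u) \<in> Z)"
    using AC NE AE_space
  proof eventually_elim
    case (elim l)
    then have l: "l \<in> \<Lambda>" by (simp add: space_\<omega>)
    have fp: "finite_measure (distr \<mu> borel (P l))" by (rule finite_measure_projection[OF fin sets l])
    have "AE u in lborel. \<forall>n. net_energy (t n) \<mu> X l u < \<infinity>"
      using elim(2) by (simp add: AE_all_countable)
    then have "AE u in lborel. 0 < projected_density \<mu> l u \<longrightarrow> (l, u) \<in> Z"
      using bspec[OF G(2) l] by eventually_elim (use l in \<open>auto simp: mem\<close>)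
    then have "AE u in density lborel (projected_density \<mu> l). (l, u) \<in> Z"
      unfolding projected_density_def
      using measurable_upper_derivative[OF fp sets_distr] by (subst AE_density) auto
    then have "AE u in distr \<mu> borel (P l). (l, u) \<in> Z"
      unfolding projected_density_def upper_derivative_ae(2)[OF fp sets_distr elim(1), symmetric] .
    then show ?case using l elim(1) by blast
  qed
  have Zl: "{u. (l, u) \<in> Z} \<in> sets borel" for l
    using sets_Pair1[OF Z, of l] by (simp add: vimage_def)
  show thesis
  proof (rule that[OF Z dim])
    show "AE l in \<omega>. AE x in \<mu>. (l, P l x) \<in> Z"
      using main
    proof eventually_elim
      case (elim l)
      have "P l \<in> \<mu> \<rightarrow>\<^sub>M borel"
        using measurable_P_single elim by (simp add: measurable_cong_sets[OF sets refl])
      then show ?case using elim Zl[of l] by (subst (asm) AE_distr_iff) auto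
    qed
    assume pos: "0 < emeasure \<mu> UNIV"
    show "AE l in \<omega>. 0 < emeasure lborel {u. (l, u) \<in> Z}"
      using main
    proof eventually_elim
      case (elim l)
      then have l: "l \<in> \<Lambda>" and ac: "absolutely_continuous lborel (distr \<mu> borel (P l))"
        and ae: "AE u in distr \<mu> borel (P l). (l, u) \<in> Z" by auto
      show ?case
      proof (rule ccontr)
        assume "\<not> 0 < emeasure lborel {u. (l, u) \<in> Z}"
        then have "{u. (l, u) \<in> Z} \<in> null_sets lborel" using Zl by (auto simp: null_sets_def)
        then have "{u. (l, u) \<in> Z} \<in> null_sets (distr \<mu> borel (P l))"
          using ac by (auto simp: absolutely_continuous_def)
        then have "AE u in distr \<mu> borel (P l). u \<notin> {u. (l, u) \<in> Z}" by (rule AE_not_in)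
        with ae have "AE u in distr \<mu> borel (P l). False" by eventually_elim simp
        then have "emeasure (distr \<mu> borel (P l)) UNIV = 0"
          by (simp add: AE_iff_null null_sets_def)
        then show False using pos emeasure_projection[OF sets l, of UNIV] by simp
      qed
    qed
  qed
qed

end

section \<open>Decomposition into compact regular pieces\<close>

lemma compact_exhaustion:
  fixes M :: "'a::polish_space measure"
  assumes fin: "finite_measure M" and sets: "sets M = sets borel" and B: "B \<in> sets borel"
  obtains K :: "nat \<Rightarrow> 'a set" where "\<And>i. compact (K i)" "\<And>i. K i \<subseteq> B" "emeasure M (B - (\<Union>i. K i)) = 0"
proof -
  interpret finite_measure M by fact
  have fin_top: "emeasure M (space M) \<noteq> \<infinity>" by simp
  have "\<exists>K. compact K \<and> K \<subseteq> B \<and> emeasure M B \<le> emeasure M K + ennreal (1 / Suc i)" for i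
  proof (cases "emeasure M B = 0")
    case False
    then have "emeasure M B - ennreal (1 / Suc i) < emeasure M B"
      by (intro ennreal_between) (auto simp: zero_less_iff_neq_zero less_top[symmetric])
    then have "\<exists>K. compact K \<and> K \<subseteq> B \<and> emeasure M B - ennreal (1 / Suc i) < emeasure M K"
      using inner_regular[OF sets fin_top B] by (auto simp: less_SUP_iff)
    then obtain K where K: "compact K" "K \<subseteq> B" "emeasure M B - ennreal (1 / Suc i) \<le> emeasure M K"
      using less_imp_le by blast
    then have "emeasure M B \<le> emeasure M K + ennreal (1 / Suc i)"
      by (simp add: ennreal_minus_le_iff add.commute)
    then show ?thesis using K by blast
  qed (auto intro: exI[of _ "{}"])
  then obtain K where K: "\<And>i. compact (K i)" "\<And>i. K i \<subseteq> B"
      "\<And>i. emeasure M B \<le> emeasure M (K i) + ennreal (1 / Suc i)" by metis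
  have meas: "K i \<in> sets M" for i using K(1) by (simp add: sets borel_compact)
  have UK: "(\<Union>i. K i) \<in> sets M" by (intro sets.countable_UN) (use meas in auto)
  have "emeasure M (B - (\<Union>i. K i)) \<le> 0 + ennreal (1 / Suc i)" for i
  proof -
    have "emeasure M (B - (\<Union>i. K i)) \<le> emeasure M (B - K i)"
      by (rule emeasure_mono) (use meas B in \<open>auto simp: sets\<close>)
    also have "\<dots> = emeasure M B - emeasure M (K i)"
      by (rule emeasure_Diff) (use meas B K in \<open>auto simp: sets\<close>)
    also have "\<dots> \<le> ennreal (1 / Suc i)"
      using K(3)[of i] by (simp add: ennreal_minus_le_iff add.commute)
    finally show ?thesis by simp
  qed
  moreover have "(\<lambda>i. ennreal (1 / Suc i)) \<longlonglongrightarrow> ennreal 0"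
    using LIMSEQ_inverse_real_of_nat by (intro tendsto_ennrealI) (simp add: inverse_eq_divide)
  ultimately have "emeasure M (B - (\<Union>i. K i)) \<le> ennreal 0"
    by (intro LIMSEQ_le_const) auto
  then have "emeasure M (B - (\<Union>i. K i)) = 0" by simp
  with K show thesis by (intro that) auto
qed

text \<open>
  Remove from a Borel hull of \<open>A\<close> a Borel hull of the null set by which it exceeds \<open>A\<close>.
\<close>

lemma hausdorff_measurable_inner_borel:
  fixes A :: "'a::metric_space set"
  assumes A: "A \<in> sets (hausdorff_measure s)" and fin: "hausdorff_outer s A < \<infinity>"
  obtains B where "B \<in> sets borel" "B \<subseteq> A" "hausdorff_outer s (A - B) = 0"
proof -
  obtain G where G: "G \<in> sets borel" "A \<subseteq> G" "hausdorff_outer s G = hausdorff_outer s A"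
    using hausdorff_outer_borel_regular[OF fin] by metis
  have "hausdorff_outer s (G - A) = emeasure (hausdorff_measure s) (G - A)"
    using A borel_sets_hausdorff_measure[OF G(1)] by (subst emeasure_hausdorff_measure) auto
  also have "\<dots> = emeasure (hausdorff_measure s) G - emeasure (hausdorff_measure s) A"
    by (rule emeasure_Diff)
       (use A G fin borel_sets_hausdorff_measure[OF G(1), of s] in \<open>auto simp: emeasure_hausdorff_measure\<close>)
  also have "\<dots> = 0"
    using A G fin borel_sets_hausdorff_measure[OF G(1), of s] by (simp add: emeasure_hausdorff_measure)
  finally have zero: "hausdorff_outer s (G - A) = 0" .
  then obtain H where H: "H \<in> sets borel" "G - A \<subseteq> H" "hausdorff_outer s H = 0"
    using hausdorff_outer_borel_regular[of s "G - A"] by (metis ennreal_zero_less_top infinity_ennreal_def)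
  have "hausdorff_outer s (A - (G - H)) \<le> hausdorff_outer s H"
    by (rule hausdorff_outer_mono) (use G in auto)
  then show thesis using H G by (intro that[of "G - H"]) auto
qed

text \<open>
  A strict inequality for one radius survives a slight enlargement of the radius, and the enlarged
  balls about all nearby points contain the original one.
\<close>

lemma closed_growth_set:
  fixes M :: "'a::metric_space measure"
  assumes sets: "sets M = sets borel" and s: "0 < s" and k: "0 \<le> k"
  shows "closed {x. \<forall>r>0. emeasure M (cball x r) \<le> ennreal (k * r powr s)}" (is "closed ?F")
proof -
  have "open (- ?F)"
    unfolding open_dist
  proof
    fix x assume "x \<in> - ?F"
    then obtain r where r: "0 < r" "ennreal (k * r powr s) < emeasure M (cball x r)" by (auto simp: not_le)
    have "((\<lambda>r'. ennreal (k * r' powr s)) \<longlongrightarrow> ennreal (k * r powr s)) (at_right r)"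
      using r(1) by (intro tendsto_ennrealI tendsto_intros) auto
    then have "eventually (\<lambda>r'. ennreal (k * r' powr s) < emeasure M (cball x r)) (at_right r)"
      using r(2) by (rule order_tendstoD(2))
    then obtain b where b: "r < b" "\<And>r'. r < r' \<Longrightarrow> r' < b \<Longrightarrow> ennreal (k * r' powr s) < emeasure M (cball x r)"
      unfolding eventually_at_right_field by blast
    define r' where "r' = (r + b) / 2"
    have r': "r < r'" "r' < b" using b by (auto simp: r'_def)
    have "y \<in> - ?F" if y: "dist y x < r' - r" for y
    proof -
      have "cball x r \<subseteq> cball y r'"
      proof
        fix z assume "z \<in> cball x r"
        then show "z \<in> cball y r'" using y dist_triangle[of y z x] by simp
      qed
      then have "emeasure M (cball x r) \<le> emeasure M (cball y r')"
        by (rule emeasure_mono) (simp add: sets)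
      then have "ennreal (k * r' powr s) < emeasure M (cball y r')"
        using b(2)[OF r'] by (rule less_le_trans[rotated])
      then show ?thesis using r r' by (auto simp: not_le intro!: exI[of _ r'])
    qed
    then show "\<exists>e>0. \<forall>y. dist y x < e \<longrightarrow> y \<in> - ?F"
      using r' by (intro exI[of _ "r' - r"]) auto
  qed
  then show ?thesis by (simp add: closed_def)
qed

lemma closed_lower_regular_set:
  fixes M :: "'a::metric_space measure"
  assumes sets: "sets M = sets borel" and s: "0 < s" and q: "0 \<le> q"
  shows "closed {x. \<forall>r. 0 < r \<longrightarrow> r \<le> 1 \<longrightarrow> ennreal (q * r powr s) \<le> emeasure M (cball x r)}" (is "closed ?L")
proof -
  have "open (- ?L)"
    unfolding open_dist
  proof
    fix x assume "x \<in> - ?L"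
    then obtain r where r: "0 < r" "r \<le> 1" "emeasure M (cball x r) < ennreal (q * r powr s)" by (auto simp: not_le)
    have "((\<lambda>r'. ennreal (q * r' powr s)) \<longlongrightarrow> ennreal (q * r powr s)) (at_left r)"
      using r(1) by (intro tendsto_ennrealI tendsto_intros) auto
    then have "eventually (\<lambda>r'. emeasure M (cball x r) < ennreal (q * r' powr s)) (at_left r)"
      using r(3) by (rule order_tendstoD(1))
    then obtain b where b: "b < r" "\<And>r'. b < r' \<Longrightarrow> r' < r \<Longrightarrow> emeasure M (cball x r) < ennreal (q * r' powr s)"
      unfolding eventually_at_left_field by blast
    define r' where "r' = (r + max b 0) / 2"
    have r': "b < r'" "0 < r'" "r' < r" using b r by (auto simp: r'_def)
    have "y \<in> - ?L" if y: "dist y x < r - r'" for y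
    proof -
      have "cball y r' \<subseteq> cball x r"
      proof
        fix z assume "z \<in> cball y r'"
        then show "z \<in> cball x r" using y dist_triangle[of x z y] by (simp add: dist_commute)
      qed
      then have "emeasure M (cball y r') \<le> emeasure M (cball x r)"
        by (rule emeasure_mono) (simp add: sets)
      then have "emeasure M (cball y r') < ennreal (q * r' powr s)"
        using b(2)[OF r'(1,3)] by (rule le_less_trans)
      then show ?thesis using r r' by (auto simp: not_le intro!: exI[of _ r'])
    qed
    then show "\<exists>e>0. \<forall>y. dist y x < e \<longrightarrow> y \<in> - ?L"
      using r' by (intro exI[of _ "r - r'"]) auto
  qed
  then show ?thesis by (simp add: closed_def)
qed

text \<open>
  Positive lower density gives the bound for radii below some \<open>b\<close>; monotonicity in the radius extends
  it to all radii up to one, with a smaller constant.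
\<close>

lemma lower_density_pos_imp_lower_regular:
  fixes A :: "'a::metric_space set"
  assumes pos: "0 < lower_density s A x" and s: "0 < s"
  shows "\<exists>k::nat. \<forall>r. 0 < r \<longrightarrow> r \<le> 1 \<longrightarrow> ennreal (1 / Suc k * r powr s) \<le> hausdorff_outer s (A \<inter> cball x r)"
proof -
  define H where "H = (\<lambda>r. hausdorff_outer s (A \<inter> cball x r))"
  obtain c where c: "0 < c" "c < lower_density s A x"
    using dense[OF pos] by blast
  then obtain c' where c': "c = ennreal c'" "0 < c'"
    by (cases c) (auto simp: ennreal_less_zero_iff less_top[symmetric] top_unique)
  have "eventually (\<lambda>r. c < ennreal ((2 * r) powr - s) * H r) (at_right 0)"
    using c(2) unfolding lower_density_def H_def by (rule less_LiminfD)
  then obtain b where b: "0 < b" "\<And>r. 0 < r \<Longrightarrow> r < b \<Longrightarrow> c < ennreal ((2 * r) powr - s) * H r"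
    unfolding eventually_at_right_field by blast
  have small: "ennreal (c' * (2 * r) powr s) \<le> H r" if r: "0 < r" "r < b" for r
  proof -
    have "ennreal ((2 * r) powr s) * c \<le> ennreal ((2 * r) powr s) * (ennreal ((2 * r) powr - s) * H r)"
      using b(2)[OF r] by (intro mult_left_mono less_imp_le) auto
    also have "\<dots> = H r"
      using r by (simp add: mult.assoc[symmetric] ennreal_mult[symmetric] powr_add[symmetric])
    finally show ?thesis using c' by (simp add: ennreal_mult mult.commute)
  qed
  define \<rho> where "\<rho> = min 1 (b / 2)"
  have \<rho>: "0 < \<rho>" "\<rho> \<le> 1" "\<rho> < b" using b by (auto simp: \<rho>_def)
  define q where "q = c' * (2 * \<rho>) powr s"
  have q: "0 < q" using c' \<rho> by (simp add: q_def)
  obtain k :: nat where k: "1 / real (Suc k) < q" using nat_approx_posE[OF q] by blast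
  have "ennreal (1 / Suc k * r powr s) \<le> H r" if r: "0 < r" "r \<le> 1" for r
  proof -
    have "1 / Suc k * r powr s \<le> q * r powr s" using k by (intro mult_right_mono) auto
    also have "\<dots> = c' * (2 * (\<rho> * r)) powr s" using \<rho> r by (simp add: q_def powr_mult)
    finally have "ennreal (1 / Suc k * r powr s) \<le> ennreal (c' * (2 * (\<rho> * r)) powr s)" by (rule ennreal_leI)
    also have "\<dots> \<le> H (\<rho> * r)"
    proof (rule small)
      have "\<rho> * r \<le> \<rho>" using \<rho> r by (simp add: mult_left_le)
      then show "\<rho> * r < b" using \<rho> by linarith
    qed (use \<rho> r in simp)
    also have "\<dots> \<le> H r"
      unfolding H_def
    proof (rule hausdorff_outer_mono)
      have "\<rho> * r \<le> r" using \<rho> r by (simp add: mult_left_le_one_le)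
      then show "A \<inter> cball x (\<rho> * r) \<subseteq> A \<inter> cball x r" by auto
    qed
    finally show ?thesis .
  qed
  then show ?thesis unfolding H_def by blast
qed

text \<open>
  The identity map transports the restriction to the Borel sets, where regularity and the
  projection lemmas apply.
\<close>

definition hausdorff_restriction :: "real \<Rightarrow> 'a::metric_space set \<Rightarrow> 'a measure" where
  "hausdorff_restriction s A = distr (restrict_space (hausdorff_measure s) A) borel (\<lambda>x. x)"

lemma sets_hausdorff_restriction [simp]: "sets (hausdorff_restriction s A) = sets borel"
  by (simp add: hausdorff_restriction_def)

lemma measurable_id_hausdorff:
  fixes A :: "'a::metric_space set"
  shows "(\<lambda>x. x) \<in> restrict_space (hausdorff_measure s) A \<rightarrow>\<^sub>M borel"
  by (rule measurable_restrict_space1, rule measurableI) (auto simp: borel_sets_hausdorff_measure)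

lemma emeasure_hausdorff_restriction:
  fixes A :: "'a::metric_space set"
  assumes A: "A \<in> sets (hausdorff_measure s)" and B: "B \<in> sets borel"
  shows "emeasure (hausdorff_restriction s A) B = hausdorff_outer s (A \<inter> B)"
proof -
  have "emeasure (hausdorff_restriction s A) B = emeasure (restrict_space (hausdorff_measure s) A) (A \<inter> B)"
    unfolding hausdorff_restriction_def
    using B by (simp add: emeasure_distr[OF measurable_id_hausdorff] space_restrict_space Int_commute)
  also have "\<dots> = emeasure (hausdorff_measure s) (A \<inter> B)"
    by (rule emeasure_restrict_space) (use A in auto)
  also have "\<dots> = hausdorff_outer s (A \<inter> B)"
    using A borel_sets_hausdorff_measure[OF B] by (intro emeasure_hausdorff_measure) auto
  finally show ?thesis .
qed

lemma finite_measure_hausdorff_restriction: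
  fixes A :: "'a::metric_space set"
  assumes A: "A \<in> sets (hausdorff_measure s)" and fin: "hausdorff_outer s A < \<infinity>"
  shows "finite_measure (hausdorff_restriction s A)"
proof (rule finite_measureI)
  have "space (hausdorff_restriction s A) = UNIV" by (simp add: hausdorff_restriction_def)
  then show "emeasure (hausdorff_restriction s A) (space (hausdorff_restriction s A)) \<noteq> \<infinity>"
    using fin emeasure_hausdorff_restriction[OF A, of UNIV] by auto
qed

text \<open>
  Almost every point of \<open>A\<close> satisfies growth bounds from both sides with constants from a countable set: the
  upper one by \<open>infinite_upper_density_null\<close>, the lower one by the density hypothesis. For fixed
  constants the points with these bounds form a closed set, whose intersection with a Borel subset
  of \<open>A\<close> of full measure is exhausted by compact sets.
\<close>

lemma compact_pieces:
  fixes A :: "'a::euclidean_space set"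
  assumes A: "A \<in> sets (hausdorff_measure s)" and fin: "hausdorff_outer s A < \<infinity>" and s: "0 < s"
    and density: "AE x in restrict_space (hausdorff_measure s) A. 0 < lower_density s A x"
  obtains \<K> where "countable \<K>"
    "\<And>K. K \<in> \<K> \<Longrightarrow> compact K" "\<And>K. K \<in> \<K> \<Longrightarrow> K \<subseteq> A"
    "\<And>K. K \<in> \<K> \<Longrightarrow> \<exists>k>0. \<forall>x\<in>K. \<forall>r>0. hausdorff_outer s (A \<inter> cball x r) \<le> ennreal (k * r powr s)"
    "\<And>K. K \<in> \<K> \<Longrightarrow> \<exists>q>0. \<forall>x\<in>K. \<forall>r. 0 < r \<longrightarrow> r \<le> 1 \<longrightarrow> ennreal (q * r powr s) \<le> hausdorff_outer s (A \<inter> cball x r)"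
    "hausdorff_outer s (A - \<Union>\<K>) = 0"
proof -
  define M where "M = hausdorff_restriction s A"
  have finM: "finite_measure M" and setsM: "sets M = sets borel"
    using finite_measure_hausdorff_restriction[OF A fin] by (simp_all add: M_def)
  have em: "emeasure M B = hausdorff_outer s (A \<inter> B)" if "B \<in> sets borel" for B
    unfolding M_def by (rule emeasure_hausdorff_restriction[OF A that])
  \<comment> \<open>Used below at \<open>Suc k\<close>, so that the constant is positive.\<close>
  define F where "F = (\<lambda>k::nat. {x. \<forall>r>0. emeasure M (cball x r) \<le> ennreal (real k * r powr s)})"
  define L where "L = (\<lambda>k::nat. {x. \<forall>r. 0 < r \<longrightarrow> r \<le> 1 \<longrightarrow> ennreal (1 / Suc k * r powr s) \<le> emeasure M (cball x r)})"
  have closedF: "closed (F k)" for k unfolding F_def by (rule closed_growth_set[OF setsM s]) simp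
  have closedL: "closed (L k)" for k unfolding L_def by (rule closed_lower_regular_set[OF setsM s]) simp
  obtain A0 where A0: "A0 \<in> sets borel" "A0 \<subseteq> A" "hausdorff_outer s (A - A0) = 0"
    by (rule hausdorff_measurable_inner_borel[OF A fin]) (rule that; assumption)
  define D where "D = (\<lambda>(k, j). A0 \<inter> (F (Suc k) \<inter> L j))"
  have "\<exists>K :: nat \<Rightarrow> 'a set. (\<forall>i. compact (K i)) \<and> (\<forall>i. K i \<subseteq> D p) \<and> emeasure M (D p - (\<Union>i. K i)) = 0" for p
  proof -
    have "D p \<in> sets borel"
      using A0 closedF closedL by (auto simp: D_def split: prod.split)
    then show ?thesis
      by (rule compact_exhaustion[OF finM setsM]) (intro exI conjI allI; assumption)
  qed
  from choice[OF allI, OF this] obtain K :: "nat \<times> nat \<Rightarrow> nat \<Rightarrow> 'a set" where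
    "\<forall>p. (\<forall>i. compact (K p i)) \<and> (\<forall>i. K p i \<subseteq> D p) \<and> emeasure M (D p - (\<Union>i. K p i)) = 0" ..
  then have K: "\<And>p i. compact (K p i)" "\<And>p i. K p i \<subseteq> D p" "\<And>p. emeasure M (D p - (\<Union>i. K p i)) = 0"
    by blast+
  define \<K> where "\<K> = range (\<lambda>(p, i). K p i)"
  define low where "low = {x\<in>A. \<not> 0 < lower_density s A x}"
  have low: "hausdorff_outer s low = 0"
  proof -
    obtain N where N: "{x \<in> space (restrict_space (hausdorff_measure s) A). \<not> 0 < lower_density s A x} \<subseteq> N"
        "emeasure (restrict_space (hausdorff_measure s) A) N = 0" "N \<in> sets (restrict_space (hausdorff_measure s) A)"
      using density by (rule AE_E)
    have "N \<subseteq> A" and NH: "N \<in> sets (hausdorff_measure s)"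
      using N(3) A by (auto simp: sets_restrict_space)
    then have "hausdorff_outer s N = 0"
      using N(2) A by (simp add: emeasure_restrict_space emeasure_hausdorff_measure)
    moreover have "low \<subseteq> N" using N(1) by (auto simp: low_def space_restrict_space)
    ultimately show ?thesis using hausdorff_outer_mono[of low N s] by simp
  qed
  define high where "high = {x. \<forall>k::nat. \<exists>r>0. ennreal (real k * r powr s) < emeasure M (cball x r)}"
  have high: "hausdorff_outer s high = 0"
    unfolding high_def by (rule infinite_upper_density_null[OF setsM finM s])
  define rest where "rest = (\<Union>p. D p - (\<Union>i. K p i))"
  have rest: "hausdorff_outer s rest = 0"
  proof -
    have piece: "hausdorff_outer s (D p - (\<Union>i. K p i)) = 0" for p
    proof -
      have "D p \<in> sets borel"
        using A0 closedF closedL by (auto simp: D_def split: prod.split)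
      moreover have "(\<Union>i. K p i) \<in> sets borel" by (intro sets.countable_UN image_subsetI borel_compact K(1))
      ultimately have "hausdorff_outer s (A \<inter> (D p - (\<Union>i. K p i))) = 0"
        using em[of "D p - (\<Union>i. K p i)"] K(3)[of p] by simp
      moreover have "A \<inter> (D p - (\<Union>i. K p i)) = D p - (\<Union>i. K p i)"
        using A0(2) by (auto simp: D_def split: prod.splits)
      ultimately show ?thesis by simp
    qed
    have "rest \<subseteq> (\<Union>n. D (prod_decode n) - (\<Union>i. K (prod_decode n) i))"
    proof
      fix x assume "x \<in> rest"
      then obtain p where "x \<in> D p - (\<Union>i. K p i)" unfolding rest_def by blast
      then show "x \<in> (\<Union>n. D (prod_decode n) - (\<Union>i. K (prod_decode n) i))"
        by (intro UN_I[of "prod_encode p"]) simp_all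
    qed
    then have "hausdorff_outer s rest \<le> (\<Sum>n. hausdorff_outer s (D (prod_decode n) - (\<Union>i. K (prod_decode n) i)))"
      by (rule order_trans[OF hausdorff_outer_mono hausdorff_outer_countable_subadditive])
    then show ?thesis by (simp add: piece)
  qed
  have cover: "A - \<Union>\<K> \<subseteq> (A - A0) \<union> (low \<union> (high \<union> rest))"
  proof
    fix x assume x: "x \<in> A - \<Union>\<K>"
    show "x \<in> (A - A0) \<union> (low \<union> (high \<union> rest))"
    proof (cases "x \<in> A0 \<and> x \<notin> low \<and> x \<notin> high")
      case True
      have "0 < lower_density s A x" using True x by (auto simp: low_def zero_less_iff_neq_zero)
      from lower_density_pos_imp_lower_regular[OF this s]
      obtain j where "\<forall>r. 0 < r \<longrightarrow> r \<le> 1 \<longrightarrow> ennreal (1 / Suc j * r powr s) \<le> hausdorff_outer s (A \<inter> cball x r)"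
        by blast
      then have xL: "x \<in> L j" by (simp add: L_def em)
      have "\<not> (\<forall>k::nat. \<exists>r>0. ennreal (real k * r powr s) < emeasure M (cball x r))"
        using True by (simp add: high_def)
      then obtain k :: nat where nk: "\<not> (\<exists>r>0. ennreal (real k * r powr s) < emeasure M (cball x r))"
        by blast
      have k: "emeasure M (cball x r) \<le> ennreal (real k * r powr s)" if "0 < r" for r
        using nk that by (meson not_less)
      have "x \<in> F (Suc k)"
        unfolding F_def
      proof (intro CollectI allI impI)
        fix r :: real assume r: "0 < r"
        have "ennreal (real k * r powr s) \<le> ennreal (real (Suc k) * r powr s)"
          by (intro ennreal_leI mult_right_mono) auto
        then show "emeasure M (cball x r) \<le> ennreal (real (Suc k) * r powr s)"
          using k[OF r] by (rule order_trans[rotated])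
      qed
      then have "x \<in> D (k, j)" using True xL by (simp add: D_def)
      moreover have "x \<notin> K (k, j) i" for i using x by (auto simp: \<K>_def)
      ultimately have "x \<in> rest" by (auto simp: rest_def)
      then show ?thesis by simp
    qed (use x in auto)
  qed
  have null: "hausdorff_outer s (A - \<Union>\<K>) = 0"
  proof -
    have "hausdorff_outer s (A - \<Union>\<K>) \<le> hausdorff_outer s (A - A0) + (hausdorff_outer s low + (hausdorff_outer s high + hausdorff_outer s rest))"
      by (intro order_trans[OF hausdorff_outer_mono[OF cover]] order_trans[OF hausdorff_outer_subadditive]
          add_left_mono hausdorff_outer_subadditive)
    then show ?thesis by (simp add: A0 low high rest)
  qed
  show thesis
  proof (rule that[OF _ _ _ _ _ null])
    show "countable \<K>" by (simp add: \<K>_def)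
    fix C assume "C \<in> \<K>"
    then obtain k j i where C: "C = K (k, j) i" by (auto simp: \<K>_def)
    have CD: "C \<subseteq> A0 \<inter> (F (Suc k) \<inter> L j)" using K(2)[of "(k, j)" i] by (simp add: C D_def)
    show "compact C" using K(1) by (simp add: C)
    show "C \<subseteq> A" using CD A0 by auto
    show "\<exists>k>0. \<forall>x\<in>C. \<forall>r>0. hausdorff_outer s (A \<inter> cball x r) \<le> ennreal (k * r powr s)"
      by (rule exI[of _ "real (Suc k)"]) (use CD in \<open>auto simp: F_def em\<close>)
    show "\<exists>q>0. \<forall>x\<in>C. \<forall>r. 0 < r \<longrightarrow> r \<le> 1 \<longrightarrow> ennreal (q * r powr s) \<le> hausdorff_outer s (A \<inter> cball x r)"
      by (rule exI[of _ "1 / real (Suc j)"]) (use CD in \<open>auto simp: L_def em\<close>)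
  qed
qed

text \<open>
  A ball meeting \<open>K\<close> lies in a ball of twice the radius about a point of \<open>K\<close>. This turns the upper
  bound at points of \<open>K\<close> into a growth condition for the restriction to \<open>K\<close> about all points of the
  space. The lower bound, in contrast, is used for the restriction to the whole of \<open>A\<close>.
\<close>

lemma (in projection_energy) slices_through_piece:
  fixes A K :: "'a set"
  assumes A: "A \<in> sets (hausdorff_measure s)" and fin: "hausdorff_outer s A < \<infinity>"
    and K: "compact K" "K \<subseteq> A"
    and upper: "\<exists>k>0. \<forall>x\<in>K. \<forall>r>0. hausdorff_outer s (A \<inter> cball x r) \<le> ennreal (k * r powr s)"
    and lower: "\<exists>q>0. \<forall>x\<in>K. \<forall>r. 0 < r \<longrightarrow> r \<le> 1 \<longrightarrow> ennreal (q * r powr s) \<le> hausdorff_outer s (A \<inter> cball x r)"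
  shows "\<exists>Z \<in> sets (\<omega> \<Otimes>\<^sub>M (borel :: 'b measure)).
    (\<forall>l u. (l, u) \<in> Z \<longrightarrow> hausdorff_dim (P l -` {u} \<inter> A) = ereal (s - DIM('b))) \<and>
    (AE l in \<omega>. AE x in hausdorff_restriction s A. x \<in> K \<longrightarrow> (l, P l x) \<in> Z) \<and>
    (0 < hausdorff_outer s K \<longrightarrow> (AE l in \<omega>. 0 < emeasure lborel {u. (l, u) \<in> Z}))"
proof -
  define M where "M = hausdorff_restriction s A"
  have finM: "finite_measure M" and setsM: "sets M = sets borel"
    using finite_measure_hausdorff_restriction[OF A fin] by (simp_all add: M_def)
  have em: "emeasure M B = hausdorff_outer s (A \<inter> B)" if "B \<in> sets borel" for B
    unfolding M_def by (rule emeasure_hausdorff_restriction[OF A that])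
  have KM: "K \<in> sets M" using K by (simp add: setsM borel_compact)
  define \<mu> where "\<mu> = density M (indicator K)"
  have em\<mu>: "emeasure \<mu> B = hausdorff_outer s (A \<inter> (K \<inter> B))" if "B \<in> sets borel" for B
    using that KM unfolding \<mu>_def by (subst emeasure_restricted) (auto simp: setsM em)
  have fin\<mu>: "finite_measure \<mu>" and sets\<mu>: "sets \<mu> = sets borel"
    unfolding \<mu>_def using finite_measure.finite_measure_restricted[OF finM KM] by (simp_all add: setsM)
  obtain k where k: "0 < k" "\<And>x r. x \<in> K \<Longrightarrow> 0 < r \<Longrightarrow> hausdorff_outer s (A \<inter> cball x r) \<le> ennreal (k * r powr s)"
    using upper by blast
  obtain q where q: "0 < q" "\<And>x r. x \<in> K \<Longrightarrow> 0 < r \<Longrightarrow> r \<le> 1 \<Longrightarrow> ennreal (q * r powr s) \<le> emeasure M (cball x r)"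
    using lower by (auto simp: em)
  have growth: "emeasure \<mu> (cball x r) \<le> ennreal (k * 2 powr s * r powr s)" if r: "0 < r" for x r
  proof (cases "K \<inter> cball x r = {}")
    case True
    then show ?thesis by (simp add: em\<mu>)
  next
    case False
    then obtain y where y: "y \<in> K" "dist x y \<le> r" by auto
    have "A \<inter> (K \<inter> cball x r) \<subseteq> A \<inter> cball y (2 * r)"
    proof
      fix z assume "z \<in> A \<inter> (K \<inter> cball x r)"
      then show "z \<in> A \<inter> cball y (2 * r)" using y(2) dist_triangle3[of y z x] by simp
    qed
    then have "emeasure \<mu> (cball x r) \<le> hausdorff_outer s (A \<inter> cball y (2 * r))"
      by (simp add: em\<mu> hausdorff_outer_mono)
    also have "\<dots> \<le> ennreal (k * (2 * r) powr s)" by (rule k(2)) (use y r in auto)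
    also have "\<dots> = ennreal (k * 2 powr s * r powr s)" using r by (simp add: powr_mult mult.assoc)
    finally show ?thesis .
  qed
  have c: "0 < k * 2 powr s" using k by simp
  have null: "emeasure \<mu> (- K) = 0"
    using K by (subst em\<mu>) (auto intro: borel_open simp: compact_imp_closed)
  obtain X :: "nat \<Rightarrow> 'a set" and N where X: "\<And>j. finite (X j)" "\<And>j. K \<subseteq> (\<Union>x\<in>X j. cball x ((1/2) ^ j))"
      "0 \<le> N" "\<And>j. real (card (X j)) \<le> N * (2 ^ j) powr s"
    using exists_nets_of_lower_regular[OF finM setsM q(1), of K s] q(2) by metis
  obtain Z where Z: "Z \<in> sets (\<omega> \<Otimes>\<^sub>M (borel :: 'b measure))"
    "\<And>l u. (l, u) \<in> Z \<Longrightarrow> hausdorff_dim (P l -` {u} \<inter> A) = ereal (s - DIM('b))"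
    "AE l in \<omega>. AE x in \<mu>. (l, P l x) \<in> Z"
    "0 < emeasure \<mu> UNIV \<Longrightarrow> AE l in \<omega>. 0 < emeasure lborel {u. (l, u) \<in> Z}"
    using slices_of_compact_piece[OF fin\<mu> sets\<mu> c growth K(1) null K(2) fin X] by blast
  have ae: "AE l in \<omega>. AE x in M. x \<in> K \<longrightarrow> (l, P l x) \<in> Z"
    using Z(3)
  proof eventually_elim
    case (elim l)
    have "AE x in M. 0 < (indicator K x :: ennreal) \<longrightarrow> (l, P l x) \<in> Z"
      using elim KM unfolding \<mu>_def by (subst (asm) AE_density) auto
    then show ?case by eventually_elim (auto simp: indicator_def split: if_splits)
  qed
  have "emeasure \<mu> UNIV = hausdorff_outer s K" using K(2) by (simp add: em\<mu> Int_absorb1)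
  then show ?thesis using Z ae unfolding M_def by (intro bexI[of _ Z]) auto
qed

section \<open>Dimension of almost all slices\<close>

theorem theorem3p1:
  fixes P :: "'l::metric_space \<Rightarrow> real ^ 'n \<Rightarrow> real ^ 'm"
    and \<Lambda> :: "'l set"
    and \<omega> :: "'l measure"
    and s :: real
    and A :: "(real ^ 'n) set"
  assumes n_ge_2: "CARD('n) \<ge> 2"
    and compact_\<Lambda>: "compact \<Lambda>"
    and proj: "\<And>l. l \<in> \<Lambda> \<Longrightarrow> orthogonal_projection (P l)"
    and cont: "\<And>x. continuous_on \<Lambda> (\<lambda>l. P l x)"
    and sets_\<omega>: "sets \<omega> = sets (restrict_space borel \<Lambda>)"
    and finite_\<omega>: "finite_measure \<omega>"
    and nonzero_\<omega>: "emeasure \<omega> \<Lambda> \<noteq> 0"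
    and s_gt: "s > real CARD('m)"
    and energy: "\<exists>C::real. C > 0 \<and>
      (\<forall>\<mu> \<in> compactly_supported_measures (cball (0 :: real ^ 'n) 1).
        (\<forall>x r. r > 0 \<longrightarrow> emeasure \<mu> (cball x r) \<le> ennreal (r powr s)) \<longrightarrow>
        (AE l in \<omega>. absolutely_continuous lborel (distr \<mu> borel (P l))) \<and>
        (\<integral>\<^sup>+ l. (\<integral>\<^sup>+ u. (measure_derivative (distr \<mu> borel (P l)) u)\<^sup>2 \<partial>lborel) \<partial>\<omega>) < ennreal C)"
    and meas_A: "A \<in> sets (hausdorff_measure s)"
    and pos_A: "0 < emeasure (hausdorff_measure s) A"
    and fin_A: "emeasure (hausdorff_measure s) A < \<infinity>"
    and density_A: "AE x in restrict_space (hausdorff_measure s) A. 0 < lower_density s A x"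
  shows "(AE (x, l) in restrict_space (hausdorff_measure s) A \<Otimes>\<^sub>M \<omega>.
           hausdorff_dim (P l -` {P l x} \<inter> A) = ereal (s - real CARD('m))) \<and>
         (AE l in \<omega>.
           0 < outer_measure_of lborel
                 {u. hausdorff_dim (P l -` {u} \<inter> A) = ereal (s - real CARD('m))})"
proof -
  obtain C :: real where C: "C > 0 \<and>
      (\<forall>\<mu> \<in> compactly_supported_measures (cball (0 :: real ^ 'n) 1).
        (\<forall>x r. r > 0 \<longrightarrow> emeasure \<mu> (cball x r) \<le> ennreal (r powr s)) \<longrightarrow>
        (AE l in \<omega>. absolutely_continuous lborel (distr \<mu> borel (P l))) \<and>
        (\<integral>\<^sup>+ l. (\<integral>\<^sup>+ u. (measure_derivative (distr \<mu> borel (P l)) u)\<^sup>2 \<partial>lborel) \<partial>\<omega>) < ennreal C)"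
    using energy ..
  interpret projection_energy P \<Lambda> \<omega> s C
    by (intro projection_energy.intro projection_family.intro projection_energy_axioms.intro)
       (use proj cont sets_\<omega> finite_\<omega> s_gt C in simp_all)
  have finA: "hausdorff_outer s A < \<infinity>" and posA: "0 < hausdorff_outer s A"
    using fin_A pos_A by (simp_all add: emeasure_hausdorff_measure[OF meas_A])
  have s0: "0 < s" using s_gt by (rule le_less_trans[rotated]) simp
  define \<tau> where "\<tau> = ereal (s - real CARD('m))"
  define H where "H = restrict_space (hausdorff_measure s) A"
  have HR: "hausdorff_restriction s A = distr H borel (\<lambda>x. x)"
    by (simp add: hausdorff_restriction_def H_def)
  have spH: "space H = A" by (simp add: H_def space_restrict_space)
  have finH: "finite_measure H"
  proof (rule finite_measureI)
    have "emeasure H A = hausdorff_outer s A"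
      unfolding H_def using meas_A by (simp add: emeasure_restrict_space emeasure_hausdorff_measure)
    then show "emeasure H (space H) \<noteq> \<infinity>" using finA by (simp add: spH)
  qed
  interpret H: finite_measure H by (rule finH)
  interpret pair_sigma_finite H \<omega>
    by (intro pair_sigma_finite.intro H.sigma_finite_measure_axioms \<omega>.sigma_finite_measure_axioms)
  have idH: "(\<lambda>x. x) \<in> H \<rightarrow>\<^sub>M borel" unfolding H_def by (rule measurable_id_hausdorff)
  obtain \<K> where \<K>: "countable \<K>"
    "\<And>K. K \<in> \<K> \<Longrightarrow> compact K" "\<And>K. K \<in> \<K> \<Longrightarrow> K \<subseteq> A"
    "\<And>K. K \<in> \<K> \<Longrightarrow> \<exists>k>0. \<forall>x\<in>K. \<forall>r>0. hausdorff_outer s (A \<inter> cball x r) \<le> ennreal (k * r powr s)"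
    "\<And>K. K \<in> \<K> \<Longrightarrow> \<exists>q>0. \<forall>x\<in>K. \<forall>r. 0 < r \<longrightarrow> r \<le> 1 \<longrightarrow> ennreal (q * r powr s) \<le> hausdorff_outer s (A \<inter> cball x r)"
    "hausdorff_outer s (A - \<Union>\<K>) = 0"
    by (rule compact_pieces[OF meas_A finA s0 density_A]) (rule that; assumption)
  let ?good = "\<lambda>K Z. Z \<in> sets (\<omega> \<Otimes>\<^sub>M (borel :: (real ^ 'm) measure)) \<and>
    (\<forall>l u. (l, u) \<in> Z \<longrightarrow> hausdorff_dim (P l -` {u} \<inter> A) = \<tau>) \<and>
    (AE l in \<omega>. AE x in hausdorff_restriction s A. x \<in> K \<longrightarrow> (l, P l x) \<in> Z) \<and>
    (0 < hausdorff_outer s K \<longrightarrow> (AE l in \<omega>. 0 < emeasure lborel {u. (l, u) \<in> Z}))"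
  have "\<forall>K\<in>\<K>. \<exists>Z. ?good K Z"
    using slices_through_piece[OF meas_A finA \<K>(2-5)] unfolding \<tau>_def by (simp add: Bex_def)
  from bchoice[OF this] obtain Z where "\<forall>K\<in>\<K>. ?good K (Z K)" ..
  then have Z: "\<And>K. K \<in> \<K> \<Longrightarrow> Z K \<in> sets (\<omega> \<Otimes>\<^sub>M (borel :: (real ^ 'm) measure))"
    "\<And>K l u. K \<in> \<K> \<Longrightarrow> (l, u) \<in> Z K \<Longrightarrow> hausdorff_dim (P l -` {u} \<inter> A) = \<tau>"
    "\<And>K. K \<in> \<K> \<Longrightarrow> AE l in \<omega>. AE x in hausdorff_restriction s A. x \<in> K \<longrightarrow> (l, P l x) \<in> Z K"
    "\<And>K. K \<in> \<K> \<Longrightarrow> 0 < hausdorff_outer s K \<Longrightarrow> AE l in \<omega>. 0 < emeasure lborel {u. (l, u) \<in> Z K}"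
    by blast+
  have swapP: "(\<lambda>p. (snd p, P (snd p) (fst p))) \<in> H \<Otimes>\<^sub>M \<omega> \<rightarrow>\<^sub>M \<omega> \<Otimes>\<^sub>M borel"
  proof (rule measurable_Pair)
    have "(\<lambda>p. (snd p, fst p)) \<in> H \<Otimes>\<^sub>M \<omega> \<rightarrow>\<^sub>M \<omega> \<Otimes>\<^sub>M borel"
      by (intro measurable_Pair measurable_snd measurable_compose[OF measurable_fst idH])
    from measurable_compose[OF this measurable_P]
    show "(\<lambda>p. P (snd p) (fst p)) \<in> H \<Otimes>\<^sub>M \<omega> \<rightarrow>\<^sub>M borel" by simp
  qed (rule measurable_snd)
  \<comment> \<open>For almost every \<open>l\<close> the condition holds for almost every \<open>x\<close>; measurability of \<open>Z K\<close> permits the exchange.\<close>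
  have pieces: "AE p in H \<Otimes>\<^sub>M \<omega>. fst p \<in> K \<longrightarrow> (snd p, P (snd p) (fst p)) \<in> Z K" if K: "K \<in> \<K>" for K
  proof -
    have "(\<lambda>p. fst p) -` K \<inter> space (H \<Otimes>\<^sub>M \<omega>) \<in> sets (H \<Otimes>\<^sub>M \<omega>)"
      by (rule measurable_sets[OF measurable_compose[OF measurable_fst idH]]) (use \<K>(2)[OF K] in \<open>simp add: borel_compact\<close>)
    then have [measurable]: "Measurable.pred (H \<Otimes>\<^sub>M \<omega>) (\<lambda>p. fst p \<in> K)"
      unfolding pred_def by (simp add: vimage_def Int_def conj_commute)
    have [measurable]: "Measurable.pred (H \<Otimes>\<^sub>M \<omega>) (\<lambda>p. (snd p, P (snd p) (fst p)) \<in> Z K)"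
      using measurable_sets[OF swapP Z(1)[OF K]] unfolding pred_def by (simp add: vimage_def Int_def conj_commute)
    have meas: "{p \<in> space (H \<Otimes>\<^sub>M \<omega>). fst p \<in> K \<longrightarrow> (snd p, P (snd p) (fst p)) \<in> Z K} \<in> sets (H \<Otimes>\<^sub>M \<omega>)"
      by measurable
    have "AE l in \<omega>. AE x in H. x \<in> K \<longrightarrow> (l, P l x) \<in> Z K"
      using Z(3)[OF K] AE_space
    proof eventually_elim
      case (elim l)
      then have l: "l \<in> \<Lambda>" by (simp add: space_\<omega>)
      have 1: "{u. (l, u) \<in> Z K} \<in> sets borel" using sets_Pair1[OF Z(1)[OF K], of l] by (simp add: vimage_def)
      have 2: "{x. (l, P l x) \<in> Z K} \<in> sets borel"
        using measurable_sets[OF measurable_P_single[OF l] 1] by (simp add: vimage_def)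
      have "{x. x \<in> K \<longrightarrow> (l, P l x) \<in> Z K} = - K \<union> {x. (l, P l x) \<in> Z K}" by auto
      moreover have "- K \<in> sets borel" using \<K>(2)[OF K] by (simp add: compact_imp_closed borel_open open_Compl)
      ultimately have "{x \<in> space borel. x \<in> K \<longrightarrow> (l, P l x) \<in> Z K} \<in> sets borel" using 2 by simp
      then show ?case
        using elim(1) unfolding HR by (subst (asm) AE_distr_iff[OF idH])
    qed
    then have "AE x in H. AE l in \<omega>. x \<in> K \<longrightarrow> (l, P l x) \<in> Z K"
      using AE_commute[of "\<lambda>x l. x \<in> K \<longrightarrow> (l, P l x) \<in> Z K"] meas by simp
    then show ?thesis by (intro AE_pair_measure meas) simp
  qed
  have UK: "\<Union>\<K> \<in> sets borel"
    by (rule sets.countable_Union[OF \<K>(1)]) (intro subsetI borel_compact \<K>(2))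
  have "AE x in H. x \<in> \<Union>\<K>"
  proof (rule AE_I)
    show "{x \<in> space H. x \<notin> \<Union>\<K>} \<subseteq> A - \<Union>\<K>" by (auto simp: spH)
    have dm: "A - \<Union>\<K> \<in> sets (hausdorff_measure s)"
      using meas_A borel_sets_hausdorff_measure[OF UK] by auto
    then show "emeasure H (A - \<Union>\<K>) = 0"
      unfolding H_def using meas_A \<K>(6) by (subst emeasure_restrict_space) (auto simp: emeasure_hausdorff_measure)
    show "A - \<Union>\<K> \<in> sets H" unfolding H_def using meas_A dm by (subst sets_restrict_space_iff) auto
  qed
  then have cover: "AE p in H \<Otimes>\<^sub>M \<omega>. fst p \<in> \<Union>\<K>"
  proof (intro AE_pair_measure)
    have "(\<lambda>p. fst p) -` \<Union>\<K> \<inter> space (H \<Otimes>\<^sub>M \<omega>) \<in> sets (H \<Otimes>\<^sub>M \<omega>)"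
      by (rule measurable_sets[OF measurable_compose[OF measurable_fst idH] UK])
    also have "(\<lambda>p. fst p) -` \<Union>\<K> \<inter> space (H \<Otimes>\<^sub>M \<omega>) = {p \<in> space (H \<Otimes>\<^sub>M \<omega>). fst p \<in> \<Union>\<K>}" by auto
    finally show "{p \<in> space (H \<Otimes>\<^sub>M \<omega>). fst p \<in> \<Union>\<K>} \<in> sets (H \<Otimes>\<^sub>M \<omega>)" .
    assume "AE x in H. x \<in> \<Union>\<K>"
    then show "AE x in H. AE l in \<omega>. fst (x, l) \<in> \<Union>\<K>" by eventually_elim simp
  qed
  have "AE p in H \<Otimes>\<^sub>M \<omega>. \<forall>K\<in>\<K>. fst p \<in> K \<longrightarrow> (snd p, P (snd p) (fst p)) \<in> Z K"
    by (subst AE_ball_countable[OF \<K>(1)]) (use pieces in blast)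
  with cover have part1: "AE p in H \<Otimes>\<^sub>M \<omega>. hausdorff_dim (P (snd p) -` {P (snd p) (fst p)} \<inter> A) = \<tau>"
  proof eventually_elim
    case (elim p)
    then obtain K where "K \<in> \<K>" "fst p \<in> K" by blast
    then show ?case using elim(2) Z(2) by blast
  qed
  \<comment> \<open>Otherwise \<open>A\<close> would be null. Such a piece has projections that charge a set of values \<open>u\<close> of positive measure.\<close>
  have "\<exists>K\<in>\<K>. 0 < hausdorff_outer s K"
  proof (rule ccontr)
    assume "\<not> ?thesis"
    then have zero: "hausdorff_outer s K = 0" if "K \<in> \<K>" for K using that by (auto simp: zero_less_iff_neq_zero)
    have "(\<Union>K\<in>\<K>. K) \<in> null_sets (hausdorff_measure s)"
    proof (rule null_sets_UN'[OF \<K>(1)])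
      fix K assume K: "K \<in> \<K>"
      have "K \<in> sets (hausdorff_measure s)"
        using borel_sets_hausdorff_measure[OF borel_compact[OF \<K>(2)[OF K]]] .
      then show "K \<in> null_sets (hausdorff_measure s)"
        using zero[OF K] by (simp add: null_sets_def emeasure_hausdorff_measure)
    qed
    then have "hausdorff_outer s (\<Union>\<K>) = 0"
      using emeasure_hausdorff_measure[of "\<Union>\<K>" s] by (simp add: null_sets_def)
    then have "hausdorff_outer s (A \<inter> \<Union>\<K>) = 0"
      using hausdorff_outer_mono[of "A \<inter> \<Union>\<K>" "\<Union>\<K>" s] by simp
    then have "hausdorff_outer s A \<le> 0"
      using hausdorff_outer_subadditive[of s "A \<inter> \<Union>\<K>" "A - \<Union>\<K>"] \<K>(6) by (simp add: Int_Diff_Un)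
    then show False using posA by simp
  qed
  then obtain K where K: "K \<in> \<K>" "0 < hausdorff_outer s K" by blast
  have part2: "AE l in \<omega>. 0 < outer_measure_of lborel {u. hausdorff_dim (P l -` {u} \<inter> A) = \<tau>}"
    using Z(4)[OF K]
  proof eventually_elim
    case (elim l)
    have "{u. (l, u) \<in> Z K} \<in> sets lborel" using sets_Pair1[OF Z(1)[OF K(1)], of l] by (simp add: vimage_def)
    then have "emeasure lborel {u. (l, u) \<in> Z K} = outer_measure_of lborel {u. (l, u) \<in> Z K}" by simp
    also have "\<dots> \<le> outer_measure_of lborel {u. hausdorff_dim (P l -` {u} \<inter> A) = \<tau>}"
      by (rule outer_measure_of_mono) (use Z(2)[OF K(1)] in auto)
    finally show ?case using elim by simp
  qed
  show ?thesis
    using part1 part2 unfolding H_def \<tau>_def case_prod_beta by (rule conjI)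
qed

end
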